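(* For any fixed real number $\rho$, $$\#\left\{k\in\mathbb{Z} : 1 \le k \le p \text{ and } H_p\left(\frac{k+1/2}{p}\right) < \rho\sqrt{p}\right\} \sim c_{\rho}\, p$$ as $p\to\infty$ through primes, where $$c_{\rho} = \frac{1}{2} + \frac{1}{\pi} \int_{0}^{\infty} \sin(\rho \pi x) \prod_{\substack{n \geq 1 \\ n \text{ odd}}} \cos^2\left(\frac{2x}{n}\right) \frac{dx}{x}.$$ Moreover, for positive $\rho$, both $c_{-\rho}$ and $1-c_\rho$ are equal to $\exp\left(-\exp\left(\pi\rho/2 + O(1)\right)\right)$.
   Context: For an odd prime $p$, $\left(\frac{\cdot}{p}\right)$ denotes the Legendre symbol. The real-valued function $H_p$ of a real variable $t$ is defined by $$H_p(t) = 2\sum_{a=1}^{(p-1)/2}\left(\frac{a}{p}\right)\cos((2a-p)\pi t)\quad\text{if } p\equiv 1 \pmod 4,$$ $$H_p(t) = 2\sum_{a=1}^{(p-1)/2}\left(\frac{a}{p}\right)\sin((2a-p)\pi t)\quad\text{if } p\equiv 3 \pmod 4.$$ Equivalently, with $f_p(z)=\sum_{a=0}^{p-1}\left(\frac{a}{p}\right)z^a$, one has $H_p(t)=e^{-\pi i p t} f_p(e^{2\pi i t})$ if $p\equiv1\pmod 4$ and $H_p(t)=-i\,e^{-\pi i p t} f_p(e^{2\pi i t})$ if $p\equiv3\pmod 4$. The $O(1)$ denotes a quantity bounded in absolute value by an absolute constant. *)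

theory Defs
  imports
    "HOL-Analysis.Analysis"
    "HOL-Number_Theory.Number_Theory"
    "HOL-Library.Landau_Symbols"
begin

(* Meaningful for odd primes p only; for those, the second case is p mod 4 = 3. *)
definition Hp :: "nat \<Rightarrow> real \<Rightarrow> real" where
  "Hp p t =
     (if p mod 4 = 1
      then 2 * (\<Sum>a = 1..(p - 1) div 2.
             of_int (Legendre (int a) (int p)) * cos ((2 * real a - real p) * pi * t))
      else 2 * (\<Sum>a = 1..(p - 1) div 2.
             of_int (Legendre (int a) (int p)) * sin ((2 * real a - real p) * pi * t)))"

(* The odd n >= 1 are written n = 2 * m + 1. The library's infinite product allows finitely many
   zero factors, which do occur here for isolated x. *)
definition c_rho :: "real \<Rightarrow> real" where
  "c_rho \<rho> = 1 / 2 + 1 / pi *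
     (LBINT x:{0<..}. sin (\<rho> * pi * x) * (\<Prod>m. (cos (2 * x / real (2 * m + 1)))\<^sup>2) / x)"

end

theory Submission
  imports Defs
    "HOL-Computational_Algebra.Computational_Algebra"
    "HOL-Probability.Probability"
    "HOL-Real_Asymp.Real_Asymp"
begin

text \<open>
Let \<open>p > 2\<close> be prime, let \<open>chi\<close> be the Legendre symbol modulo \<open>p\<close>, and let \<open>k\<close> be uniform in
\<open>{1..p}\<close>. Expanding \<open>chi\<close> into additive characters and summing a geometric series gives, up to a
sign that does not depend on \<open>k\<close>,
  \<open>pi * H_p((k + 1/2)/p) / sqrt p = (-1)^k * (\<Sum>m. chi(k + m) * (pi/p) * cot(pi * (1/2 - m)/p))\<close>,
where \<open>\<bar>m\<bar> \<le> (p - 1)/2\<close> (\<open>Hp_eq_cot_sum\<close>). For fixed \<open>m\<close> the weight tends to \<open>2/(1 - 2*m)\<close>, and any finite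
number of the quantities \<open>(-1)^k\<close> and \<open>chi(k + m)\<close> behave for large \<open>p\<close> like independent fair signs. The
values therefore converge in distribution to \<open>Y = (\<Sum>m\<in>\<int>. eps_m * 2/(1 - 2*m))\<close> with independent fair
signs \<open>eps_m\<close>. Every odd \<open>n \<ge> 1\<close> is \<open>\<bar>1 - 2*m\<bar>\<close> for exactly two \<open>m\<close>, so the characteristic function of
\<open>Y\<close> at \<open>x\<close> is the product of \<open>cos(2*x/n)^2\<close> over the odd \<open>n\<close>. It decays exponentially; hence \<open>Y\<close> has no
atoms, and Levy's inversion formula for the symmetric interval \<open>(-pi*\<rho>, pi*\<rho>]\<close> yields
\<open>P(Y < pi*\<rho>) = c_\<rho>\<close> (\<open>c_rho_eq_cdf\<close>). Because \<open>Y\<close> is symmetric, both signs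
of the Gauss sum lead to the same limit.

Independence means that the sum over \<open>k\<close> of \<open>(\<plusminus>1)^k\<close> times a product of \<open>chi(k + m)\<close>, \<open>m\<close> in a fixed
nonempty finite set, is \<open>o(p)\<close> (\<open>alternating_sum_small\<close>). Without the factor \<open>(\<plusminus>1)^k\<close> this is a weak
form of Weil's bound for the curve \<open>y^2 = \<Prod>(x + m)\<close>. It is obtained by Stepanov's method: a nonzero
polynomial of degree only \<open>l*p/2 + O(p)\<close> vanishes to order \<open>l\<close> at every \<open>x\<close> where the symbol takes a given
value, so this value is taken at most \<open>p/2 + O(p/l)\<close> times; as only \<open>o(p)\<close> is wanted, \<open>l\<close> stays fixed while \<open>p\<close>
grows. All of this takes place in the integer polynomials modulo \<open>p\<close>, where the linear system for this
polynomial is solved by the pigeonhole principle. The factor \<open>(\<plusminus>1)^k\<close> is then removed by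
van der Corput's device of averaging over shifts of \<open>k\<close>. The terms with large \<open>\<bar>m\<bar>\<close> are negligible in mean
square, since different shifts of \<open>chi\<close> have correlation \<open>-1/p\<close> (\<open>mean_square_chi_le\<close>).

For the tails, \<open>log(cosh y) \<le> min(\<bar>y\<bar>, y^2/2)\<close> gives \<open>log(E(exp(s*Y))) \<le> 2*s*log s + O(s)\<close>, and the
exponential moment method with \<open>s\<close> of the order of \<open>exp(r/2)\<close> bounds \<open>P(Y > r)\<close> by \<open>exp(-exp(r/2 + O(1)))\<close>.
Conversely, prescribing the \<open>2*N\<close> signs of the largest weights costs a factor \<open>4^(-N)\<close>
and makes their contribution at least \<open>2*log(N + 1)\<close>, while the remaining terms are nonnegative with
probability at least \<open>1/2\<close>; take \<open>N\<close> of the order of \<open>exp(r/2)\<close>. Both estimates are counts of sign patterns for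
finite sections of the sum, uniform in the section, and pass to the limit.
\<close>

section \<open>Stepanov's method for integer polynomials modulo a prime\<close>

text \<open>A constant of its own, because the simplifier would multiply out explicit linear factors.\<close>

definition X_minus :: "int \<Rightarrow> int poly" where
  "X_minus b = [:- b, 1:]"

lemma poly_X_minus [simp]: "poly (X_minus b) x = x - b"
  by (simp add: X_minus_def)

lemma pderiv_X_minus [simp]: "pderiv (X_minus b) = 1"
  by (simp add: X_minus_def pderiv_pCons)

lemma degree_X_minus [simp]: "degree (X_minus b) = 1"
  by (simp add: X_minus_def)

lemma X_minus_nonzero [simp]: "X_minus b \<noteq> 0"
  by (simp add: X_minus_def)

lemma degree_X_minus_power: "degree (X_minus b ^ l) = l"
  by (induction l) (simp_all add: degree_mult_eq)

lemma prime_const_poly: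
  fixes q :: int assumes "prime q" shows "prime_elem [:q:]"
  using assms by (simp add: prime_elem_const_poly_iff prime_imp_prime_elem del: prime_elem_iff_prime_abs)

lemma const_dvd_cancel_linear:
  fixes q :: int
  assumes "prime q" "[:q:] dvd X_minus b * S"
  shows "[:q:] dvd S"
proof -
  have "\<not> [:q:] dvd X_minus b"
  proof
    assume "[:q:] dvd X_minus b"
    then have "q dvd poly.coeff (X_minus b) 1" by (simp add: const_poly_dvd_iff)
    then show False using assms(1) by (auto simp: X_minus_def)
  qed
  then show ?thesis
    using prime_elem_dvd_multD[OF prime_const_poly[OF assms(1)] assms(2)] by blast
qed

lemma const_dvd_poly:
  fixes q :: int
  assumes "[:q:] dvd P" shows "q dvd poly P x"
  using assms by (auto elim!: dvdE)

text \<open>Synthetic division: the remainder of \<open>S\<close> by \<open>x - b\<close> is the constant \<open>S(b)\<close>.\<close>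

lemma root_mod_imp_linear_factor:
  fixes q :: int
  assumes "q dvd poly S b"
  shows "[:q:] dvd S - X_minus b * synthetic_div S b"
proof -
  have "S - X_minus b * synthetic_div S b = [:poly S b:]"
    using synthetic_div_correct'[of b S] by (simp add: X_minus_def eq_diff_eq diff_eq_eq)
  then show ?thesis using assms by simp
qed

text \<open>Read modulo \<open>q\<close>, a power of \<open>x - b\<close> is coprime to every \<open>K\<close> with \<open>K(b) \<noteq> 0\<close>. The factors \<open>x - b\<close>
are split off from \<open>Q\<close> one at a time, which only needs that the constant \<open>q\<close> is prime in \<open>\<int>[x]\<close>.\<close>

lemma linear_power_dvd_cancel_mod:
  fixes q :: int
  assumes q: "prime q" and K: "\<not> q dvd poly K b"
    and "[:q:] dvd K * Q - X_minus b ^ l * S"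
  shows "\<exists>U. [:q:] dvd Q - X_minus b ^ l * U"
  using assms(3)
proof (induction l arbitrary: Q S)
  case 0
  then show ?case by (intro exI[of _ Q]) simp
next
  case (Suc l)
  have "q dvd poly (K * Q - X_minus b ^ Suc l * S) b"
    using Suc.prems by (rule const_dvd_poly)
  then have "q dvd poly Q b" using K q by (simp add: prime_dvd_mult_iff)
  then obtain Q1 where Q1: "[:q:] dvd Q - X_minus b * Q1"
    using root_mod_imp_linear_factor by blast
  have "[:q:] dvd (K * Q - X_minus b ^ Suc l * S) - K * (Q - X_minus b * Q1)"
    using dvd_diff[OF Suc.prems dvd_mult[OF Q1]] .
  then have "[:q:] dvd X_minus b * (K * Q1 - X_minus b ^ l * S)"
    by (simp add: algebra_simps)
  then have "[:q:] dvd K * Q1 - X_minus b ^ l * S"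
    using const_dvd_cancel_linear q by blast
  then obtain U where U: "[:q:] dvd Q1 - X_minus b ^ l * U" using Suc.IH by blast
  have "[:q:] dvd (Q - X_minus b * Q1) + X_minus b * (Q1 - X_minus b ^ l * U)"
    using Q1 U by (intro dvd_add dvd_mult)
  then show ?case by (intro exI[of _ U]) (simp add: algebra_simps)
qed

lemma prod_linear_powers_dvd_mod:
  fixes q :: int
  assumes q: "prime q" and "finite A" and "A \<subseteq> {0..<q}"
    and "\<And>a. a \<in> A \<Longrightarrow> \<exists>S. [:q:] dvd R - X_minus a ^ l * S"
  shows "\<exists>Q. [:q:] dvd R - (\<Prod>a\<in>A. X_minus a ^ l) * Q"
  using assms(2-)
proof (induction A rule: finite_induct)
  case empty
  then show ?case by (intro exI[of _ R]) simp
next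
  case (insert b A)
  let ?K = "\<Prod>a\<in>A. X_minus a ^ l"
  obtain Q where Q: "[:q:] dvd R - ?K * Q" using insert by auto
  obtain S where S: "[:q:] dvd R - X_minus b ^ l * S" using insert.prems by blast
  have "\<not> q dvd b - a" if "a \<in> A" for a
  proof
    assume "q dvd b - a"
    then have "b mod q = a mod q" by (simp add: mod_eq_dvd_iff)
    moreover have "a \<in> {0..<q}" "b \<in> {0..<q}" using insert that by auto
    ultimately show False using insert that by auto
  qed
  then have "\<not> q dvd poly ?K b"
    using q \<open>finite A\<close> by (auto simp: poly_prod poly_power prime_dvd_prod_iff prime_dvd_power_iff
      dest: prime_dvd_power)
  moreover have "[:q:] dvd ?K * Q - X_minus b ^ l * S"
    using dvd_diff[OF S Q] by (simp add: algebra_simps)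
  ultimately obtain U where U: "[:q:] dvd Q - X_minus b ^ l * U"
    using linear_power_dvd_cancel_mod[OF q] by blast
  have "[:q:] dvd (R - ?K * Q) + ?K * (Q - X_minus b ^ l * U)"
    using Q U by (intro dvd_add dvd_mult)
  then show ?case using insert by (intro exI[of _ U]) (simp add: algebra_simps)
qed

text \<open>The leading coefficient of \<open>Q\<close> modulo \<open>q\<close> survives multiplication by the monic \<open>K\<close>, and so shows
up in \<open>R\<close> at an index that is at least the degree of \<open>K\<close>.\<close>

lemma degree_ge_of_monic_dvd_mod:
  fixes q :: int and K :: "int poly"
  assumes q: "prime q" and K: "lead_coeff K = 1"
    and R: "\<not> [:q:] dvd R" and Q: "[:q:] dvd R - K * Q"
  shows "degree K \<le> degree R"
proof -
  have nQ: "\<not> [:q:] dvd Q"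
  proof
    assume "[:q:] dvd Q"
    then have "[:q:] dvd (R - K * Q) + K * Q" using Q by (intro dvd_add dvd_mult)
    then show False using R by simp
  qed
  define I where "I = {i. \<not> q dvd poly.coeff Q i}"
  have "I \<subseteq> {..degree Q}" 
  proof
    fix i assume "i \<in> I"
    then have "poly.coeff Q i \<noteq> 0" by (auto simp: I_def)
    then show "i \<in> {..degree Q}" by (simp add: le_degree)
  qed
  then have fin: "finite I" by (rule finite_subset) auto
  have ne: "I \<noteq> {}" using nQ by (auto simp: I_def const_poly_dvd_iff)
  define i where "i = Max I"
  have iI: "i \<in> I" unfolding i_def using fin ne by (rule Max_in)
  have gt: "q dvd poly.coeff Q j" if "j > i" for j
  proof (rule ccontr)
    assume "\<not> q dvd poly.coeff Q j"
    then have "j \<in> I" by (simp add: I_def)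
    then show False using that Max_ge[OF fin, of j] by (simp add: i_def)
  qed
  have "poly.coeff (K * Q) (degree K + i) = (\<Sum>j\<le>degree K + i. poly.coeff K j * poly.coeff Q (degree K + i - j))"
    by (simp add: coeff_mult)
  also have "\<dots> = poly.coeff K (degree K) * poly.coeff Q i +
      (\<Sum>j\<in>{..degree K + i} - {degree K}. poly.coeff K j * poly.coeff Q (degree K + i - j))"
    by (subst sum.remove[of _ "degree K"]) auto
  finally have eq: "poly.coeff (K * Q) (degree K + i) = poly.coeff Q i +
      (\<Sum>j\<in>{..degree K + i} - {degree K}. poly.coeff K j * poly.coeff Q (degree K + i - j))"
    using K by simp
  have "q dvd (\<Sum>j\<in>{..degree K + i} - {degree K}. poly.coeff K j * poly.coeff Q (degree K + i - j))"
  proof (rule dvd_sum)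
    fix j assume j: "j \<in> {..degree K + i} - {degree K}"
    show "q dvd poly.coeff K j * poly.coeff Q (degree K + i - j)"
    proof (cases "j < degree K")
      case True
      then show ?thesis using gt by auto
    next
      case False
      then show ?thesis using j by (simp add: coeff_eq_0)
    qed
  qed
  then have "\<not> q dvd poly.coeff (K * Q) (degree K + i)"
    using iI eq by (auto simp: I_def dvd_add_left_iff)
  moreover have "q dvd poly.coeff (R - K * Q) (degree K + i)"
    using Q by (auto simp: const_poly_dvd_iff)
  ultimately have "poly.coeff R (degree K + i) \<noteq> 0"
    by auto
  then show ?thesis using le_degree by fastforce
qed

text \<open>A nonzero polynomial over a field has at most as many roots, counted with multiplicity, as its degree;
here the field is that of the residues modulo \<open>q\<close>, and its polynomials are represented by integer ones.\<close>

lemma card_multiple_roots_mod_le_degree: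
  fixes q :: int
  assumes q: "prime q" and A: "A \<subseteq> {0..<q}" and R: "\<not> [:q:] dvd R"
    and "\<And>a. a \<in> A \<Longrightarrow> \<exists>S. [:q:] dvd R - X_minus a ^ l * S"
  shows "l * card A \<le> degree R"
proof -
  have fin: "finite A" using A finite_subset by blast
  let ?K = "\<Prod>a\<in>A. X_minus a ^ l"
  obtain Q where "[:q:] dvd R - ?K * Q"
    using prod_linear_powers_dvd_mod[OF q fin A assms(4)] by blast
  moreover have "lead_coeff ?K = 1"
    by (subst lead_coeff_prod) (simp_all add: lead_coeff_power X_minus_def)
  ultimately have "degree ?K \<le> degree R"
    using degree_ge_of_monic_dvd_mod q R by blast
  moreover have "degree ?K = (\<Sum>a\<in>A. l)"
    by (subst degree_prod_eq_sum_degree) (auto simp: degree_X_minus_power)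
  ultimately have "(\<Sum>a\<in>A. l) \<le> degree R" by (simp only:)
  then show ?thesis by (simp add: mult.commute[of l])
qed

lemma dvd_const_smult: "[:q:] dvd Polynomial.smult q (P :: int poly)"
  by (simp add: const_poly_dvd_iff)

text \<open>The derivation \<open>f * d/dx\<close>. Away from the zeros of \<open>f\<close> it detects the order of vanishing just like \<open>d/dx\<close>,
but it maps \<open>r + s * f^h\<close> to an expression of the same shape, without denominators.\<close>

definition euler_op :: "int poly \<Rightarrow> int poly \<Rightarrow> int poly" where
  "euler_op f P = f * pderiv P"

lemma euler_op_diff: "euler_op f (P - Q) = euler_op f P - euler_op f Q"
  by (simp add: euler_op_def pderiv_diff algebra_simps)

lemma euler_op_pow_diff: "(euler_op f ^^ k) (P - Q) = (euler_op f ^^ k) P - (euler_op f ^^ k) Q"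
  by (induction k) (simp_all add: euler_op_diff)

lemma const_dvd_euler_op: "[:q:] dvd P \<Longrightarrow> [:q:] dvd euler_op f P"
  by (auto simp: euler_op_def pderiv_smult elim!: dvdE intro: dvd_const_smult)

lemma const_dvd_euler_op_pow: "[:q:] dvd P \<Longrightarrow> [:q:] dvd (euler_op f ^^ k) P"
  by (induction k) (simp_all add: const_dvd_euler_op)

lemma smult_of_nat_eq: "Polynomial.smult (of_nat n) P = of_nat n * (P :: int poly)"
  by (simp add: of_nat_poly)

text \<open>Each application lowers the order of vanishing at \<open>b\<close> by exactly one, so \<open>v\<close> applications expose \<open>S(b)\<close>.\<close>

lemma euler_op_pow_linear_power:
  "poly ((euler_op f ^^ v) (X_minus b ^ v * S)) b = fact v * poly f b ^ v * poly S b"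
proof (induction v arbitrary: S)
  case 0
  then show ?case by simp
next
  case (Suc v)
  have "euler_op f (X_minus b ^ Suc v * S)
      = X_minus b ^ v * (of_nat (Suc v) * f * S + X_minus b * f * pderiv S)"
    unfolding euler_op_def pderiv_mult pderiv_power_Suc
    by (simp only: pderiv_X_minus smult_of_nat_eq) (simp add: algebra_simps)
  then have eq: "(euler_op f ^^ Suc v) (X_minus b ^ Suc v * S)
     = (euler_op f ^^ v) (X_minus b ^ v * (of_nat (Suc v) * f * S + X_minus b * f * pderiv S))"
    by (simp add: funpow_Suc_right del: funpow.simps)
  show ?case unfolding eq Suc.IH by (simp add: algebra_simps)
qed

text \<open>If \<open>R\<close> vanished at \<open>b\<close> to an order \<open>v < l\<close> only, the \<open>v\<close>-th iterate would be nonzero at \<open>b\<close>: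
\<open>v < q\<close> makes the factor \<open>fact v\<close> a unit modulo \<open>q\<close>.\<close>

lemma linear_power_dvd_mod_of_euler_op:
  fixes q :: int
  assumes q: "prime q" and f: "\<not> q dvd poly f b" and l: "int l \<le> q"
    and van: "\<And>k. k < l \<Longrightarrow> q dvd poly ((euler_op f ^^ k) R) b"
  shows "\<exists>S. [:q:] dvd R - X_minus b ^ l * S"
proof -
  have "v \<le> l \<Longrightarrow> \<exists>S. [:q:] dvd R - X_minus b ^ v * S" for v
  proof (induction v)
    case 0
    then show ?case by (intro exI[of _ R]) simp
  next
    case (Suc v)
    then obtain S where S: "[:q:] dvd R - X_minus b ^ v * S" by auto
    have "q dvd poly ((euler_op f ^^ v) (R - X_minus b ^ v * S)) b"
      using const_dvd_euler_op_pow[OF S] const_dvd_poly by blast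
    then have "q dvd poly ((euler_op f ^^ v) R) b - fact v * poly f b ^ v * poly S b"
      by (simp add: euler_op_pow_diff euler_op_pow_linear_power)
    moreover have "q dvd poly ((euler_op f ^^ v) R) b" using van Suc by auto
    ultimately have "q dvd fact v * poly f b ^ v * poly S b"
      by (metis diff_diff_eq2 cancel_comm_monoid_add_class.diff_cancel add.commute add_0 diff_zero dvd_diff diff_add_cancel add_diff_cancel)
    moreover have "\<not> q dvd fact v"
    proof
      assume "q dvd fact v"
      moreover have "prime (nat q)" using q by simp
      moreover have "q = int (nat q)" using q by (simp add: prime_ge_0_int)
      ultimately have "nat q dvd fact v" by (metis int_dvd_int_iff of_nat_fact)
      then have "nat q \<le> v" using \<open>prime (nat q)\<close> prime_dvd_fact_iff by blast
      then show False using Suc.prems l by linarith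
    qed
    moreover have "\<not> q dvd poly f b ^ v" using f q prime_dvd_power by blast
    ultimately have "q dvd poly S b" using q by (simp add: prime_dvd_mult_iff)
    then obtain S1 where S1: "[:q:] dvd S - X_minus b * S1"
      using root_mod_imp_linear_factor by blast
    have "[:q:] dvd (R - X_minus b ^ v * S) + X_minus b ^ v * (S - X_minus b * S1)"
      using S S1 by (intro dvd_add dvd_mult)
    then show ?case by (intro exI[of _ S1]) (simp add: algebra_simps)
  qed
  then show ?thesis by blast
qed

text \<open>A homogeneous linear system over the residues modulo \<open>q\<close> with more unknowns than equations has a
nontrivial solution: two of the \<open>q^(card I)\<close> assignments agree in all \<open>card K\<close> values, and
their difference \<open>e\<close> is a solution.\<close>

lemma pigeonhole_mod:
  fixes q :: int and L :: "('i \<Rightarrow> int) \<Rightarrow> 'k \<Rightarrow> int"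
  assumes q: "q > 1" and fin: "finite I" "finite K" and card: "card K < card I"
    and L: "\<And>c d k. k \<in> K \<Longrightarrow> L (\<lambda>i. c i - d i) k = L c k - L d k"
  shows "\<exists>e. (\<exists>i\<in>I. \<not> q dvd e i) \<and> (\<forall>k\<in>K. q dvd L e k)"
proof -
  let ?V = "PiE I (\<lambda>_. {0..<q})" and ?W = "PiE K (\<lambda>_. {0..<q})"
  define F where "F c = restrict (\<lambda>k. L c k mod q) K" for c
  have FV: "F ` ?V \<subseteq> ?W" using q by (auto simp: F_def PiE_iff)
  have "card ?W < card ?V"
    using q fin card by (simp add: card_PiE)
  moreover have finW: "finite ?W" using fin by (auto intro!: finite_PiE)
  ultimately have "\<not> inj_on F ?V"
    using card_inj_on_le[of F ?V ?W] FV by fastforce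
  then obtain c d where cd: "c \<in> ?V" "d \<in> ?V" "c \<noteq> d" "F c = F d" by (auto simp: inj_on_def)
  define e where "e i = c i - d i" for i
  obtain i where "c i \<noteq> d i" using cd(3) by auto
  then have i: "i \<in> I" using cd by (metis PiE_arb)
  have "\<not> q dvd e i"
  proof
    assume "q dvd e i"
    then have "c i mod q = d i mod q" by (simp add: e_def mod_eq_dvd_iff)
    moreover have "c i \<in> {0..<q}" "d i \<in> {0..<q}" using cd i by (auto simp: PiE_iff)
    ultimately show False using \<open>c i \<noteq> d i\<close> by auto
  qed
  moreover have "q dvd L e k" if k: "k \<in> K" for k
  proof -
    have "L c k mod q = L d k mod q" using fun_cong[OF cd(4), of k] k by (simp add: F_def)
    then show ?thesis using L[OF k, of c d] by (simp add: e_def mod_eq_dvd_iff cong: if_cong flip: e_def)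
  qed
  ultimately show ?thesis using i by blast
qed

text \<open>Modulo \<open>q\<close>, the order of vanishing at \<open>b\<close> is odd for \<open>r^2 * (x - b) * f\<close> and even for \<open>c * s^2\<close>, so both
vanish identically. The proof is an infinite descent: \<open>x - b\<close> divides \<open>s\<close>, then \<open>r\<close>, and both can be
divided by it.\<close>

lemma not_square_class_mod:
  fixes q :: int
  assumes q: "prime q" and c: "\<not> q dvd c" and f: "\<not> q dvd poly f b"
    and "[:q:] dvd r\<^sup>2 * (X_minus b * f) - of_int c * s\<^sup>2"
  shows "[:q:] dvd s"
  using assms(4)
proof (induction "degree s" arbitrary: r s rule: less_induct)
  case less
  have "q dvd poly (r\<^sup>2 * (X_minus b * f) - of_int c * s\<^sup>2) b"
    using less.prems by (rule const_dvd_poly)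
  then have sb: "q dvd poly s b" using q c by (auto simp: prime_dvd_mult_iff prime_dvd_power_iff)
  define s1 where "s1 = synthetic_div s b"
  have s1: "[:q:] dvd s - X_minus b * s1"
    using root_mod_imp_linear_factor[OF sb] by (simp add: s1_def)
  show ?case
  proof (cases "degree s = 0")
    case True
    then obtain a where "s = [:a:]" using degree_0_id by metis
    then show ?thesis using sb by simp
  next
    case False
    have "[:q:] dvd (r\<^sup>2 * (X_minus b * f) - of_int c * s\<^sup>2)
        + of_int c * (s + X_minus b * s1) * (s - X_minus b * s1)"
      using less.prems s1 by (intro dvd_add dvd_mult)
    also have "\<dots> = X_minus b * (r\<^sup>2 * f - of_int c * (X_minus b * s1\<^sup>2))"
      by (simp add: algebra_simps power2_eq_square)
    finally have d1: "[:q:] dvd r\<^sup>2 * f - of_int c * (X_minus b * s1\<^sup>2)"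
      using const_dvd_cancel_linear q by blast
    then have "q dvd poly (r\<^sup>2 * f - of_int c * (X_minus b * s1\<^sup>2)) b" by (rule const_dvd_poly)
    then have "q dvd poly r b" using q f by (auto simp: prime_dvd_mult_iff prime_dvd_power_iff)
    then obtain r1 where r1: "[:q:] dvd r - X_minus b * r1"
      using root_mod_imp_linear_factor by blast
    have "[:q:] dvd (r\<^sup>2 * f - of_int c * (X_minus b * s1\<^sup>2))
        - (f * (r + X_minus b * r1)) * (r - X_minus b * r1)"
      using dvd_diff[OF d1 dvd_mult[OF r1]] .
    also have "\<dots> = X_minus b * (r1\<^sup>2 * (X_minus b * f) - of_int c * s1\<^sup>2)"
      by (simp add: algebra_simps power2_eq_square)
    finally have "[:q:] dvd r1\<^sup>2 * (X_minus b * f) - of_int c * s1\<^sup>2"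
      using const_dvd_cancel_linear q by blast
    moreover have "degree s1 < degree s" using False by (simp add: s1_def degree_synthetic_div)
    ultimately have "[:q:] dvd s1" using less.hyps by blast
    then have "[:q:] dvd (s - X_minus b * s1) + X_minus b * s1"
      using s1 by (intro dvd_add dvd_mult)
    then show ?thesis by simp
  qed
qed

text \<open>Membership in the ideal generated by \<open>q\<close> and \<open>x^n\<close>.\<close>

definition low_dvd :: "int \<Rightarrow> nat \<Rightarrow> int poly \<Rightarrow> bool" where
  "low_dvd q n P \<longleftrightarrow> (\<forall>i<n. q dvd poly.coeff P i)"

lemma low_dvd_mult: "low_dvd q n P \<Longrightarrow> low_dvd q n (P * Q)"
  by (auto simp: low_dvd_def coeff_mult intro!: dvd_sum dvd_mult2)

lemma low_dvd_add: "low_dvd q n P \<Longrightarrow> low_dvd q n Q \<Longrightarrow> low_dvd q n (P + Q)"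
  by (auto simp: low_dvd_def)

lemma low_dvd_imp_dvd: "low_dvd q n P \<Longrightarrow> degree P < n \<Longrightarrow> [:q:] dvd P"
  unfolding low_dvd_def const_poly_dvd_iff
  by (metis coeff_eq_0 dvd_0_right le_less_trans not_less)

lemma low_dvd_X_minus_power:
  assumes "prime p"
  shows "low_dvd (int p) p (X_minus b ^ p - of_int ((- b) ^ p))"
  unfolding low_dvd_def
proof (intro allI impI)
  fix i assume i: "i < p"
  show "int p dvd poly.coeff (X_minus b ^ p - of_int ((- b) ^ p)) i"
  proof (cases "i = 0")
    case True
    then show ?thesis
      by (simp add: X_minus_def coeff_linear_poly_power of_int_poly)
  next
    case False
    have "p dvd p choose i" using False i assms by (intro dvd_choose_prime) auto
    then have "int p dvd int (p choose i)" by simp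
    then have "int p dvd int (p choose i) * 1 ^ i * (- b) ^ (p - i)" by (intro dvd_mult2)
    then show ?thesis using False
      using coeff_linear_poly_power[where a = "- b" and b = 1 and n = p and i = i] i unfolding X_minus_def of_int_poly coeff_diff
      by (cases i) simp_all
  qed
qed

definition shift_poly :: "int set \<Rightarrow> int poly" where
  "shift_poly M = (\<Prod>m\<in>M. X_minus (- m))"

lemma degree_shift_poly: "degree (shift_poly M) = card M"
proof (cases "finite M")
  case True
  then show ?thesis
    unfolding shift_poly_def by (subst degree_prod_eq_sum_degree) (auto simp: X_minus_def)
qed (simp add: shift_poly_def)

text \<open>Modulo \<open>p\<close>, the \<open>p\<close>-th power of a polynomial is a polynomial in \<open>x^p\<close>, hence congruent modulo \<open>x^p\<close> to
its constant term.\<close>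

lemma low_dvd_shift_poly_power:
  assumes "prime p" "finite M"
  shows "low_dvd (int p) p (shift_poly M ^ p - of_int (\<Prod>m\<in>M. m ^ p))"
  using assms(2)
proof (induction M rule: finite_induct)
  case empty
  then show ?case by (simp add: shift_poly_def low_dvd_def)
next
  case (insert m M)
  let ?c = "\<Prod>m\<in>M. m ^ p"
  have "low_dvd (int p) p ((shift_poly M ^ p - of_int ?c) * X_minus (- m) ^ p
      + (X_minus (- m) ^ p - of_int ((- (- m)) ^ p)) * of_int ?c)"
    using insert low_dvd_X_minus_power[OF assms(1), of "- m"]
    by (intro low_dvd_add low_dvd_mult)
  then show ?case using insert by (simp add: shift_poly_def power_mult_distrib algebra_simps)
qed

text \<open>The action of \<open>euler_op f\<close> on the coefficient of \<open>f^h\<close>.\<close>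

definition twisted_op :: "int poly \<Rightarrow> nat \<Rightarrow> int poly \<Rightarrow> int poly" where
  "twisted_op f h P = f * pderiv P + of_nat h * pderiv f * P"

lemma twisted_op_pow_diff:
  "(twisted_op f h ^^ k) (P - Q) = (twisted_op f h ^^ k) P - (twisted_op f h ^^ k) Q"
proof (induction k)
  case (Suc k)
  have "twisted_op f h (U - V) = twisted_op f h U - twisted_op f h V" for U V
    by (simp add: twisted_op_def pderiv_diff algebra_simps)
  then show ?case using Suc by simp
qed simp

lemma euler_op_twisted:
  assumes "h > 0"
  shows "euler_op f (r + s * f ^ h) = euler_op f r + twisted_op f h s * f ^ h"
proof -
  obtain n where h: "h = Suc n" using assms gr0_implies_Suc by blast
  show ?thesis
    unfolding h euler_op_def twisted_op_def pderiv_add pderiv_mult pderiv_power_Suc smult_of_nat_eq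
    by (simp add: algebra_simps)
qed

lemma degree_euler_op_pow: "degree ((euler_op f ^^ k) P) \<le> degree P + k * degree f"
proof (induction k)
  case (Suc k)
  have "degree (euler_op f Q) \<le> degree f + degree Q" for Q
    unfolding euler_op_def
    by (rule order.trans[OF degree_mult_le]) (simp add: degree_pderiv)
  from this[of "(euler_op f ^^ k) P"] Suc show ?case by simp
qed simp

lemma degree_twisted_op_pow: "degree ((twisted_op f h ^^ k) P) \<le> degree P + k * degree f"
proof (induction k)
  case (Suc k)
  have "degree (twisted_op f h Q) \<le> degree f + degree Q" for Q
  proof -
    have "degree (f * pderiv Q) \<le> degree f + degree Q"
      by (rule order.trans[OF degree_mult_le]) (simp add: degree_pderiv)
    moreover have "degree (of_nat h * pderiv f * Q) \<le> degree f + degree Q"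
      unfolding mult.assoc
      by (rule order.trans[OF degree_mult_le], simp, rule order.trans[OF degree_mult_le])
        (simp add: degree_pderiv)
    ultimately show ?thesis unfolding twisted_op_def by (rule degree_add_le)
  qed
  from this[of "(twisted_op f h ^^ k) P"] Suc show ?case by simp
qed simp

text \<open>The shape of the auxiliary polynomial, to be used with \<open>h = (p - 1)/2\<close>, so that \<open>f^h\<close> is the Legendre
symbol of \<open>f\<close>. The powers \<open>x^(j*p)\<close> have derivative zero modulo \<open>p\<close> and the value of \<open>x^j\<close> on
integers: they raise the number of free coefficients, but not the degrees of the conditions.\<close>

definition stepanov_poly :: "int poly \<Rightarrow> nat \<Rightarrow> nat \<Rightarrow> nat \<Rightarrow> (nat \<Rightarrow> int poly) \<Rightarrow> (nat \<Rightarrow> int poly) \<Rightarrow> int poly" where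
  "stepanov_poly f h p J r s = (\<Sum>j<J. Polynomial.monom 1 (j * p) * (r j + s j * f ^ h))"

lemma euler_op_stepanov_poly:
  assumes "h > 0"
  shows "[:int p:] dvd euler_op f (stepanov_poly f h p J r s)
     - stepanov_poly f h p J (\<lambda>j. euler_op f (r j)) (\<lambda>j. twisted_op f h (s j))"
proof -
  have lin: "euler_op f (\<Sum>j<J. G j) = (\<Sum>j<J. euler_op f (G j))" for G
    by (induction J) (simp_all add: euler_op_def pderiv_add algebra_simps)
  have prod: "euler_op f (Polynomial.monom 1 n * P) = f * pderiv (Polynomial.monom 1 n) * P + Polynomial.monom 1 n * euler_op f P" for n P
    by (simp add: euler_op_def pderiv_mult algebra_simps)
  have "euler_op f (stepanov_poly f h p J r s)
     - stepanov_poly f h p J (\<lambda>j. euler_op f (r j)) (\<lambda>j. twisted_op f h (s j))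
     = (\<Sum>j<J. f * pderiv (Polynomial.monom 1 (j * p)) * (r j + s j * f ^ h))"
    unfolding stepanov_poly_def lin prod euler_op_twisted[OF assms]
    by (simp add: sum.distrib)
  also have "[:int p:] dvd \<dots>"
  proof (rule dvd_sum, rule dvd_mult2, rule dvd_mult)
    fix j
    show "[:int p:] dvd pderiv (Polynomial.monom 1 (j * p))"
      by (auto simp: const_poly_dvd_iff pderiv_monom coeff_monom)
  qed
  finally show ?thesis .
qed

lemma euler_op_pow_stepanov_poly:
  assumes "h > 0"
  shows "[:int p:] dvd (euler_op f ^^ k) (stepanov_poly f h p J r s)
     - stepanov_poly f h p J (\<lambda>j. (euler_op f ^^ k) (r j)) (\<lambda>j. (twisted_op f h ^^ k) (s j))"
proof (induction k)
  case 0
  then show ?case by simp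
next
  case (Suc k)
  let ?T = "\<lambda>k. stepanov_poly f h p J (\<lambda>j. (euler_op f ^^ k) (r j)) (\<lambda>j. (twisted_op f h ^^ k) (s j))"
  have "[:int p:] dvd euler_op f ((euler_op f ^^ k) (stepanov_poly f h p J r s) - ?T k)
       + (euler_op f (?T k) - ?T (Suc k))"
    using const_dvd_euler_op[OF Suc] euler_op_stepanov_poly[OF assms, of p f J
      "\<lambda>j. (euler_op f ^^ k) (r j)" "\<lambda>j. (twisted_op f h ^^ k) (s j)"]
    by (intro dvd_add) simp_all
  then show ?case by (simp add: euler_op_diff)
qed

lemma int_power_prime_cong:
  assumes "prime p"
  shows "[(x::int) ^ (j * p) = x ^ j] (mod int p)"
proof -
  define n where "n = nat (x mod int p)"
  have n: "[x = int n] (mod int p)"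
    using prime_gt_0_nat[OF assms] by (simp add: n_def cong_def)
  have "[n ^ p = n] (mod p)"
  proof (cases "p dvd n")
    case True
    moreover have "p dvd n ^ p" using True prime_gt_0_nat[OF assms]
      by (cases p) auto
    ultimately show ?thesis by (simp add: cong_def mod_0_imp_dvd dvd_eq_mod_eq_0)
  next
    case False
    have "[n ^ (p - 1) * n = 1 * n] (mod p)"
      using fermat_theorem[OF assms False] by (rule cong_scalar_right)
    moreover have "n ^ (p - 1) * n = n ^ p"
      using prime_gt_0_nat[OF assms] by (simp flip: power_Suc2)
    ultimately show ?thesis by simp
  qed
  then have "[int n ^ p = int n] (mod int p)" by (simp flip: cong_int_iff)
  then have "[x ^ p = x] (mod int p)"
    using cong_trans[OF cong_pow[OF n] cong_trans[OF _ cong_sym[OF n]]] by blast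
  then have "[(x ^ p) ^ j = x ^ j] (mod int p)" by (rule cong_pow)
  then show ?thesis by (simp flip: power_mult add: mult.commute)
qed

text \<open>The coefficients below \<open>x^p\<close> in the lowest nonzero block \<open>r + s * f^h\<close> cannot cancel against later blocks.
If the block were \<open>0\<close> modulo \<open>x^p\<close>, multiplication by \<open>(r - s * f^h) * f\<close> would give
\<open>r^2 * f - s^2 * f^p\<close>, where \<open>f^p\<close> is a constant modulo \<open>x^p\<close>. By the degree bounds this would be a true
identity \<open>r^2 * f = c * s^2\<close>, which is impossible because \<open>f\<close> has a simple root.\<close>

lemma stepanov_poly_nonzero_mod:
  fixes M :: "int set"
  assumes p: "prime p" "odd p" and M: "finite M" "M \<noteq> {}"
    and nz: "\<And>m. m \<in> M \<Longrightarrow> \<not> int p dvd m"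
    and dist: "\<And>m n. m \<in> M \<Longrightarrow> n \<in> M \<Longrightarrow> m \<noteq> n \<Longrightarrow> \<not> int p dvd m - n"
    and deg: "\<And>j. degree (r j) < m" "\<And>j. degree (s j) < m" "2 * m + card M \<le> p"
    and ne: "j < J" "\<not> ([:int p:] dvd r j \<and> [:int p:] dvd s j)"
  shows "\<not> [:int p:] dvd stepanov_poly (shift_poly M) ((p - 1) div 2) p J r s"
proof
  let ?f = "shift_poly M" and ?h = "(p - 1) div 2" and ?q = "int p"
  assume R: "[:int p:] dvd stepanov_poly ?f ?h p J r s"
  have q: "prime ?q" using p by simp
  \<comment> \<open>the lowest nonzero block\<close>
  define i where "i = (LEAST j. j < J \<and> \<not> ([:?q:] dvd r j \<and> [:?q:] dvd s j))"
  have i: "i < J" "\<not> ([:?q:] dvd r i \<and> [:?q:] dvd s i)"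
    using LeastI[of "\<lambda>j. j < J \<and> \<not> ([:?q:] dvd r j \<and> [:?q:] dvd s j)" j] ne unfolding i_def by auto
  have less: "[:?q:] dvd r j \<and> [:?q:] dvd s j" if "j < i" for j
    using not_less_Least[of j "\<lambda>j. j < J \<and> \<not> ([:?q:] dvd r j \<and> [:?q:] dvd s j)"] that i
    unfolding i_def by auto
  define G where "G j = r j + s j * ?f ^ ?h" for j
  \<comment> \<open>the earlier blocks vanish modulo \<open>p\<close>, and the later ones only reach the coefficients from \<open>(i + 1) * p\<close> on\<close>
  have "low_dvd ?q p (G i)"
    unfolding low_dvd_def
  proof (intro allI impI)
    fix n assume n: "n < p"
    have "poly.coeff (stepanov_poly ?f ?h p J r s) (i * p + n)
        = (\<Sum>j<J. poly.coeff (Polynomial.monom 1 (j * p) * G j) (i * p + n))"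
      by (simp add: stepanov_poly_def coeff_sum G_def)
    also have "\<dots> = poly.coeff (G i) n + (\<Sum>j\<in>{..<J} - {i}. poly.coeff (Polynomial.monom 1 (j * p) * G j) (i * p + n))"
      using i by (subst sum.remove[of _ i]) (auto simp: coeff_monom_mult)
    finally have eq: "poly.coeff (stepanov_poly ?f ?h p J r s) (i * p + n) = \<dots>" .
    have "?q dvd (\<Sum>j\<in>{..<J} - {i}. poly.coeff (Polynomial.monom 1 (j * p) * G j) (i * p + n))"
    proof (rule dvd_sum)
      fix j assume j: "j \<in> {..<J} - {i}"
      show "?q dvd poly.coeff (Polynomial.monom 1 (j * p) * G j) (i * p + n)"
      proof (cases "j < i")
        case True
        then have "[:?q:] dvd G j" using less unfolding G_def by (intro dvd_add dvd_mult2) auto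
        then have "[:?q:] dvd Polynomial.monom 1 (j * p) * G j" by (rule dvd_mult)
        then show ?thesis unfolding const_poly_dvd_iff by blast
      next
        case False
        then have "Suc i \<le> j" using j by auto
        then have "Suc i * p \<le> j * p" by (rule mult_le_mono1)
        then have "i * p + n < j * p" using n by simp
        then show ?thesis by (simp add: coeff_monom_mult)
      qed
    qed
    moreover have "?q dvd poly.coeff (stepanov_poly ?f ?h p J r s) (i * p + n)"
      using R unfolding const_poly_dvd_iff by blast
    ultimately show "?q dvd poly.coeff (G i) n" using eq by (simp add: dvd_add_left_iff)
  qed
  then have "low_dvd ?q p (G i * ((r i - s i * ?f ^ ?h) * ?f))" by (rule low_dvd_mult)
  also have "G i * ((r i - s i * ?f ^ ?h) * ?f) = (r i)\<^sup>2 * ?f - (s i)\<^sup>2 * (?f ^ (?h + ?h + 1))"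
    by (simp add: G_def algebra_simps power2_eq_square power_add)
  also have "?h + ?h + 1 = p" using p(2) by presburger
  finally have 1: "low_dvd ?q p ((r i)\<^sup>2 * ?f - (s i)\<^sup>2 * ?f ^ p)" .
  \<comment> \<open>the constant term of \<open>f^p\<close>\<close>
  define c where "c = (\<Prod>m\<in>M. m ^ p)"
  have "low_dvd ?q p ((?f ^ p - of_int c) * (s i)\<^sup>2)"
    unfolding c_def by (intro low_dvd_mult low_dvd_shift_poly_power p M)
  with 1 have "low_dvd ?q p (((r i)\<^sup>2 * ?f - (s i)\<^sup>2 * ?f ^ p) + (?f ^ p - of_int c) * (s i)\<^sup>2)"
    by (rule low_dvd_add)
  then have 2: "low_dvd ?q p ((r i)\<^sup>2 * ?f - of_int c * (s i)\<^sup>2)" by (simp add: algebra_simps)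
  have sq: "degree (P\<^sup>2) + 2 \<le> 2 * m" if "degree P < m" for P :: "int poly"
    using degree_power_le[of P 2] that by linarith
  have "degree ((r i)\<^sup>2 * ?f) < p"
    using degree_mult_le[of "(r i)\<^sup>2" ?f] sq[OF deg(1)[of i]] deg(3) by (simp add: degree_shift_poly)
  moreover have "degree (of_int c * (s i)\<^sup>2) < p"
    using degree_mult_le[of "of_int c" "(s i)\<^sup>2"] sq[OF deg(2)[of i]] deg(3) by simp
  ultimately have "degree ((r i)\<^sup>2 * ?f - of_int c * (s i)\<^sup>2) < p" by (rule degree_diff_less)
  with 2 have 3: "[:?q:] dvd (r i)\<^sup>2 * ?f - of_int c * (s i)\<^sup>2" by (rule low_dvd_imp_dvd)
  obtain m1 where m1: "m1 \<in> M" using M by auto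
  have f: "?f = X_minus (- m1) * shift_poly (M - {m1})"
    unfolding shift_poly_def using M m1 by (simp add: prod.remove)
  have "\<not> ?q dvd m - m1" if "m \<in> M - {m1}" for m using dist m1 that by auto
  then have "\<not> ?q dvd poly (shift_poly (M - {m1})) (- m1)"
    using q M by (simp add: shift_poly_def poly_prod prime_dvd_prod_iff)
  moreover have "\<not> ?q dvd c"
    unfolding c_def
  proof
    assume "?q dvd (\<Prod>m\<in>M. m ^ p)"
    then obtain m where "m \<in> M" "?q dvd m ^ p" using q M(1) by (auto simp: prime_dvd_prod_iff)
    then show False using nz prime_dvd_power[OF q] by blast
  qed
  ultimately have s: "[:?q:] dvd s i"
    using not_square_class_mod[OF q] 3 unfolding f by blast
  then have "[:?q:] dvd of_int c * (s i)\<^sup>2" by (simp add: dvd_mult power2_eq_square)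
  with 3 have "[:?q:] dvd ((r i)\<^sup>2 * ?f - of_int c * (s i)\<^sup>2) + of_int c * (s i)\<^sup>2" by (rule dvd_add)
  then have "[:?q:] dvd (r i)\<^sup>2 * ?f" by simp
  moreover have "\<not> [:?q:] dvd ?f"
  proof
    assume "[:?q:] dvd ?f"
    then have "?q dvd poly ?f 0" by (rule const_dvd_poly)
    then show False using q M nz by (auto simp: shift_poly_def poly_prod prime_dvd_prod_iff)
  qed
  ultimately have "[:?q:] dvd r i"
    using prime_const_poly[OF q] prime_elem_dvd_mult_iff prime_elem_dvd_power by metis
  then show False using i s by blast
qed


text \<open>Stepanov's bound. The \<open>2 * J * m\<close> coefficients of the polynomials \<open>r j\<close>, \<open>s j\<close> are chosen such that the
first \<open>l\<close> iterates of the derivation vanish at all points where \<open>f^h\<close> has the value \<open>a\<close>. At such a point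
the \<open>k\<close>-th iterate agrees with a polynomial \<open>W e k\<close> in which \<open>f^h\<close> is replaced by \<open>a\<close> and \<open>x^(j*p)\<close>
by \<open>x^j\<close>; requiring \<open>W e k\<close> to vanish identically costs \<open>m + l * card M + J\<close> equations.\<close>

lemma card_power_residues_le:
  fixes M :: "int set"
  assumes p: "prime p" "odd p" and M: "finite M" "M \<noteq> {}"
    and nz: "\<And>m. m \<in> M \<Longrightarrow> \<not> int p dvd m"
    and dist: "\<And>m n. m \<in> M \<Longrightarrow> n \<in> M \<Longrightarrow> m \<noteq> n \<Longrightarrow> \<not> int p dvd m - n"
    and a: "\<not> int p dvd a"
    and l: "l \<le> p" and m: "2 * m + card M \<le> p"
    and count: "l * (m + l * card M + J) < 2 * J * m"
  shows "l * card {x \<in> {0..<int p}. int p dvd poly (shift_poly M) x ^ ((p - 1) div 2) - a}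
     \<le> m + (p - 1) div 2 * card M + J * p"
proof -
  let ?f = "shift_poly M" and ?h = "(p - 1) div 2" and ?q = "int p"
  have q: "prime ?q" using p by simp
  have h: "?h > 0" using p prime_ge_2_nat[OF p(1)] by (auto elim!: oddE)
  \<comment> \<open>the unknowns \<open>e (b, j, i)\<close> are the coefficients of \<open>r j\<close> (for \<open>b = True\<close>) and \<open>s j\<close> (for \<open>b = False\<close>)\<close>
  define r where "r e j = (\<Sum>i<m. Polynomial.monom (e (True, j, i)) i)" for e :: "bool \<times> nat \<times> nat \<Rightarrow> int" and j
  define s where "s e j = (\<Sum>i<m. Polynomial.monom (e (False, j, i)) i)" for e :: "bool \<times> nat \<times> nat \<Rightarrow> int" and j
  have rc: "poly.coeff (r e j) i = (if i < m then e (True, j, i) else 0)" for e j i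
    by (simp add: r_def coeff_sum coeff_monom if_distrib sum.delta' cong: if_cong)
  have sc: "poly.coeff (s e j) i = (if i < m then e (False, j, i) else 0)" for e j i
    by (simp add: s_def coeff_sum coeff_monom if_distrib sum.delta' cong: if_cong)
  have mpos: "m > 0" using count by (cases m) auto
  have rd: "degree (r e j) < m" for e j using mpos by (intro degree_lessI) (auto simp: rc)
  have sd: "degree (s e j) < m" for e j using mpos by (intro degree_lessI) (auto simp: sc)
  have rdiff: "r (\<lambda>i. c i - d i) j = r c j - r d j" for c d j by (intro poly_eqI) (simp add: rc)
  have sdiff: "s (\<lambda>i. c i - d i) j = s c j - s d j" for c d j by (intro poly_eqI) (simp add: sc)
  define W where "W e k = (\<Sum>j<J. ((euler_op ?f ^^ k) (r e j) + of_int a * (twisted_op ?f ?h ^^ k) (s e j)) * Polynomial.monom 1 j)" for e k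
  define D where "D = m + l * card M + J"
  have Wdiff: "W (\<lambda>i. c i - d i) k = W c k - W d k" for c d k
    unfolding W_def rdiff sdiff euler_op_pow_diff twisted_op_pow_diff
    by (simp add: sum_subtractf[symmetric] algebra_simps)
  have Wdeg: "degree (W e k) < D" if "k < l" for e k
  proof -
    have "k * degree ?f \<le> l * card M" using that by (simp add: degree_shift_poly)
    then have 1: "degree ((euler_op ?f ^^ k) (r e j)) < m + l * card M"
        "degree ((twisted_op ?f ?h ^^ k) (s e j)) < m + l * card M" for j
      using degree_euler_op_pow[of k ?f "r e j"] degree_twisted_op_pow[of k ?f ?h "s e j"] rd[of e j] sd[of e j]
      by linarith+
    have 2: "degree ((euler_op ?f ^^ k) (r e j) + of_int a * (twisted_op ?f ?h ^^ k) (s e j)) < m + l * card M" for j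
      using 1[of j] degree_mult_le[of "of_int a" "(twisted_op ?f ?h ^^ k) (s e j)"]
      by (intro degree_add_less) auto
    have "degree (((euler_op ?f ^^ k) (r e j) + of_int a * (twisted_op ?f ?h ^^ k) (s e j)) * Polynomial.monom 1 j) < D"
      if "j < J" for j
      using 2[of j] that degree_mult_le[of "(euler_op ?f ^^ k) (r e j) + of_int a * (twisted_op ?f ?h ^^ k) (s e j)" "Polynomial.monom 1 j"]
        degree_monom_le[of "1::int" j] unfolding D_def by linarith
    then show ?thesis unfolding W_def using mpos
      by (intro degree_sum_less) (auto simp: D_def)
  qed
  define I where "I = (UNIV :: bool set) \<times> {..<J} \<times> {..<m}"
  define K where "K = {..<l} \<times> {..<D}"
  have "\<exists>e. (\<exists>i\<in>I. \<not> ?q dvd e i) \<and> (\<forall>k\<in>K. ?q dvd (\<lambda>e (k, i). poly.coeff (W e k) i) e k)"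
  proof (rule pigeonhole_mod)
    show "1 < ?q" using prime_gt_1_nat[OF p(1)] by simp
    show "card K < card I" using count by (simp add: I_def K_def D_def card_cartesian_product)
  qed (auto simp: I_def K_def Wdiff)
  then obtain e where e: "\<exists>i\<in>I. \<not> ?q dvd e i" "\<forall>(k, i)\<in>K. ?q dvd poly.coeff (W e k) i"
    by (fastforce simp: case_prod_unfold)
  have Wq: "[:?q:] dvd W e k" if "k < l" for k
    unfolding const_poly_dvd_iff
  proof
    fix i show "?q dvd poly.coeff (W e k) i"
      using e(2) that Wdeg[OF that, of e] by (cases "i < D") (auto simp: K_def coeff_eq_0)
  qed
  define R where "R = stepanov_poly ?f ?h p J (r e) (s e)"
  obtain b j i where bji: "j < J" "i < m" "\<not> ?q dvd e (b, j, i)" using e(1) by (auto simp: I_def)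
  have "\<not> ([:?q:] dvd r e j \<and> [:?q:] dvd s e j)"
  proof
    assume "[:?q:] dvd r e j \<and> [:?q:] dvd s e j"
    then have "?q dvd poly.coeff (r e j) i" "?q dvd poly.coeff (s e j) i" by (auto simp: const_poly_dvd_iff)
    then show False using bji by (cases b) (auto simp: rc sc)
  qed
  then have Rnz: "\<not> [:?q:] dvd R"
    unfolding R_def using stepanov_poly_nonzero_mod[where r = "r e" and s = "s e", OF p M nz dist rd sd m bji(1)] by blast
  define A where "A = {x \<in> {0..<?q}. ?q dvd poly ?f x ^ ?h - a}"
  have "l * card A \<le> degree R"
  proof (rule card_multiple_roots_mod_le_degree[OF q _ Rnz])
    show "A \<subseteq> {0..<?q}" by (auto simp: A_def)
    fix x assume "x \<in> A"
    then have g: "?q dvd poly ?f x ^ ?h - a" by (simp add: A_def)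
    show "\<exists>S. [:?q:] dvd R - X_minus x ^ l * S"
    proof (rule linear_power_dvd_mod_of_euler_op[OF q])
      show "\<not> ?q dvd poly ?f x"
      proof
        assume "?q dvd poly ?f x"
        then have "?q dvd poly ?f x ^ ?h" using h by (auto intro: dvd_trans[OF _ dvd_power])
        from dvd_diff[OF this g] show False using a by simp
      qed
      show "int l \<le> ?q" using l by simp
      fix k assume k: "k < l"
      let ?r = "\<lambda>j. (euler_op ?f ^^ k) (r e j)" and ?s = "\<lambda>j. (twisted_op ?f ?h ^^ k) (s e j)"
      have "[poly ((euler_op ?f ^^ k) R) x = poly (stepanov_poly ?f ?h p J ?r ?s) x] (mod ?q)"
        using const_dvd_poly[OF euler_op_pow_stepanov_poly[OF h, where p = p and f = ?f and k = k and J = J and r = "r e" and s = "s e"], of x]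
        by (simp add: R_def cong_iff_dvd_diff)
      also have "poly (stepanov_poly ?f ?h p J ?r ?s) x
          = (\<Sum>j<J. x ^ (j * p) * (poly (?r j) x + poly (?s j) x * poly ?f x ^ ?h))"
        by (simp add: stepanov_poly_def poly_sum poly_monom)
      also have "[\<dots> = (\<Sum>j<J. x ^ j * (poly (?r j) x + poly (?s j) x * a))] (mod ?q)"
        using g by (intro cong_sum cong_mult cong_add cong_refl int_power_prime_cong p(1))
          (simp add: cong_iff_dvd_diff)
      also have "(\<Sum>j<J. x ^ j * (poly (?r j) x + poly (?s j) x * a)) = poly (W e k) x"
        by (simp add: W_def poly_sum poly_monom algebra_simps)
      also have "[\<dots> = 0] (mod ?q)" using const_dvd_poly[OF Wq[OF k]] by (simp add: cong_0_iff)
      finally show "?q dvd poly ((euler_op ?f ^^ k) R) x" by (simp add: cong_0_iff)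
    qed
  qed
  also have "degree R \<le> m + ?h * card M + J * p"
    unfolding R_def stepanov_poly_def
  proof (rule degree_sum_le)
    fix j assume "j \<in> {..<J}"
    then have "j * p \<le> J * p" by simp
    have "degree (?f ^ ?h) \<le> ?h * card M"
      using degree_power_le[of ?f ?h] by (simp add: degree_shift_poly mult.commute)
    then have "degree (s e j * ?f ^ ?h) \<le> m + ?h * card M"
      using degree_mult_le[of "s e j" "?f ^ ?h"] sd[of e j] by linarith
    then have "degree (r e j + s e j * ?f ^ ?h) \<le> m + ?h * card M"
      using rd[of e j] by (intro degree_add_le) auto
    then show "degree (Polynomial.monom 1 (j * p) * (r e j + s e j * ?f ^ ?h)) \<le> m + ?h * card M + J * p"
      using degree_mult_le[of "Polynomial.monom 1 (j * p)" "r e j + s e j * ?f ^ ?h"]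
        degree_monom_le[of "1::int" "j * p"] \<open>j * p \<le> J * p\<close> by linarith
  qed simp
  finally show ?thesis unfolding A_def .
qed

section \<open>Sums of products of shifted Legendre symbols\<close>

lemma sum_periodic_int:
  fixes f :: "int \<Rightarrow> 'a::comm_monoid_add"
  assumes n: "n > 0" and f: "\<And>x. f (x mod n) = f x"
  shows "(\<Sum>k\<in>{a..<a + n}. f k) = (\<Sum>k\<in>{0..<n}. f k)"
proof (rule sum.reindex_bij_witness[where i = "\<lambda>k. a + (k - a) mod n" and j = "\<lambda>k. k mod n"])
  fix k assume k: "k \<in> {a..<a + n}"
  have "(k mod n - a) mod n = (k - a) mod n" by (rule mod_diff_left_eq)
  also have "\<dots> = k - a" using k by (intro mod_pos_pos_trivial) auto
  finally show "a + (k mod n - a) mod n = k" by simp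
next
  fix k assume k: "k \<in> {0..<n}"
  have "(a + (k - a) mod n) mod n = (a + (k - a)) mod n" by (rule mod_add_right_eq)
  then show "(a + (k - a) mod n) mod n = k" using k by simp
  show "a + (k - a) mod n \<in> {a..<a + n}" using n by simp
qed (use n f in auto)

text \<open>The Legendre symbol as a real number, with the modulus as first argument.\<close>

definition chi :: "nat \<Rightarrow> int \<Rightarrow> real" where
  "chi p k = real_of_int (Legendre k (int p))"

lemma Legendre_cong:
  assumes "[a = b] (mod q)" shows "Legendre a q = Legendre b q"
proof -
  have "[a = 0] (mod q) \<longleftrightarrow> [b = 0] (mod q)" using assms cong_sym cong_trans by blast
  moreover have "QuadRes q a \<longleftrightarrow> QuadRes q b"
    unfolding QuadRes_def using assms cong_sym cong_trans by blast
  ultimately show ?thesis by (simp add: Legendre_def)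
qed

lemma chi_cong: "[a = b] (mod int p) \<Longrightarrow> chi p a = chi p b"
  unfolding chi_def by (drule Legendre_cong) simp

lemma chi_mod [simp]: "chi p (k mod int p) = chi p k"
  by (rule chi_cong) (simp add: cong_def)

lemma Legendre_cases: "Legendre a q = 0 \<or> Legendre a q = 1 \<or> Legendre a q = - 1"
  by (simp add: Legendre_def)

lemma chi_cases: "chi p k = 0 \<or> chi p k = 1 \<or> chi p k = - 1"
  using Legendre_cases[of k "int p"] by (auto simp: chi_def)

lemma abs_chi_le: "\<bar>chi p k\<bar> \<le> 1"
  using chi_cases[of p k] by auto

lemma chi_eq_0_iff: "chi p k = 0 \<longleftrightarrow> int p dvd k"
  by (auto simp: chi_def Legendre_def cong_0_iff)

lemma Legendre_mult:
  assumes p: "prime p" "p > 2"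
  shows "Legendre (a * b) (int p) = Legendre a (int p) * Legendre b (int p)"
proof -
  let ?h = "(p - 1) div 2"
  have "[Legendre (a * b) (int p) = (a * b) ^ ?h] (mod int p)" by (rule euler_criterion[OF p])
  also have "(a * b) ^ ?h = a ^ ?h * b ^ ?h" by (rule power_mult_distrib)
  also have "[a ^ ?h * b ^ ?h = Legendre a (int p) * Legendre b (int p)] (mod int p)"
    by (intro cong_mult cong_sym[OF euler_criterion[OF p]])
  finally have "int p dvd Legendre (a * b) (int p) - Legendre a (int p) * Legendre b (int p)"
    by (simp add: cong_iff_dvd_diff)
  moreover have "\<bar>Legendre (a * b) (int p) - Legendre a (int p) * Legendre b (int p)\<bar> \<le> 2"
    using Legendre_cases[of a "int p"] Legendre_cases[of b "int p"] Legendre_cases[of "a * b" "int p"] by auto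
  ultimately show ?thesis
    using p(2) zdvd_not_zless[of "\<bar>Legendre (a * b) (int p) - Legendre a (int p) * Legendre b (int p)\<bar>" "int p"]
    by fastforce
qed

lemma chi_mult:
  assumes "prime p" "p > 2" shows "chi p (a * b) = chi p a * chi p b"
  unfolding chi_def Legendre_mult[OF assms] by (rule of_int_mult)

lemma chi_1: "p > 1 \<Longrightarrow> chi p 1 = 1"
  by (auto simp: chi_def Legendre_def QuadRes_def cong_def intro!: exI[of _ 1])

lemma chi_prod:
  assumes "prime p" "p > 2" shows "chi p (\<Prod>m\<in>M. f m) = (\<Prod>m\<in>M. chi p (f m))"
  by (induction M rule: infinite_finite_induct) (simp_all add: chi_mult[OF assms] chi_1[OF prime_gt_1_nat[OF assms(1)]])

text \<open>The points where some factor \<open>chi(k + m)\<close> vanishes. Everywhere else products of symbols are products of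
signs, so these boundedly many exceptions are the price of treating them as such.\<close>

lemma card_chi_zero_le:
  assumes "p > 0" "finite M"
  shows "card {k \<in> {a..<a + int p}. \<exists>m\<in>M. chi p (k + m) = 0} \<le> card M"
proof -
  have "card {k \<in> {a..<a + int p}. \<exists>m\<in>M. chi p (k + m) = 0}
      \<le> card (\<Union>m\<in>M. {k \<in> {a..<a + int p}. int p dvd k + m})"
    by (rule card_mono, rule finite_UN_I[OF assms(2)], rule finite_subset[of _ "{a..<a + int p}"])
      (auto simp: chi_eq_0_iff)
  also have "\<dots> \<le> (\<Sum>m\<in>M. card {k \<in> {a..<a + int p}. int p dvd k + m})"
    by (rule card_UN_le[OF assms(2)])
  also have "\<dots> \<le> (\<Sum>m\<in>M. 1)"
  proof (rule sum_mono)
    fix m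
    have "{k \<in> {a..<a + int p}. int p dvd k + m} \<subseteq> {a + (- m - a) mod int p}"
    proof safe
      fix k assume k: "k \<in> {a..<a + int p}" "int p dvd k + m"
      then have "(k - a) mod int p = (- m - a) mod int p" by (subst mod_eq_dvd_iff) simp
      moreover have "(k - a) mod int p = k - a" using k by (intro mod_pos_pos_trivial) auto
      ultimately show "k = a + (- m - a) mod int p" by linarith
    qed
    then show "card {k \<in> {a..<a + int p}. int p dvd k + m} \<le> 1"
      using card_mono[of "{a + (- m - a) mod int p}"] by fastforce
  qed
  finally show ?thesis by simp
qed

text \<open>Stepanov's bound with \<open>l = 2*L\<close>, \<open>J = L + 1\<close> and \<open>m\<close> near \<open>(p - card M)/2\<close>: the degree is about
\<open>p * (L + 1 + card M/2 + 1/2)\<close>, and division by \<open>2*L\<close> leaves the main term \<open>p/2\<close>.\<close>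

lemma card_Legendre_eq_le:
  fixes M :: "int set"
  assumes p: "prime p" and M: "finite M" "M \<noteq> {}" "M \<subseteq> {0<..<int p}"
    and a: "a = 1 \<or> a = -1" and L: "L > 0" "2 * L \<le> p"
    and large: "2 * (L * (2 * L * card M + L + 1)) + card M + 2 \<le> p"
  shows "real (card {x \<in> {0..<int p}. Legendre (\<Prod>m\<in>M. x + m) (int p) = a})
     \<le> p / 2 + real p * (real (card M) + 3) / (4 * real L)"
proof -
  let ?d = "card M" and ?h = "(p - 1) div 2"
  define m where "m = (p - ?d) div 2"
  have p2: "p > 2" using large L(1) by (cases L) auto
  then have odd: "odd p" using p prime_odd_nat by blast
  have d: "?d \<le> p" using large by simp
  have mL: "L * (2 * L * card M + L + 1) < m"
    using large unfolding m_def by linarith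
  have sub: "{x \<in> {0..<int p}. Legendre (\<Prod>m\<in>M. x + m) (int p) = a}
     \<subseteq> {x \<in> {0..<int p}. int p dvd poly (shift_poly M) x ^ ?h - a}"
  proof safe
    fix x
    have "[Legendre (\<Prod>m\<in>M. x + m) (int p) = (\<Prod>m\<in>M. x + m) ^ ?h] (mod int p)"
      by (rule euler_criterion[OF p p2])
    then show "int p dvd poly (shift_poly M) x ^ ?h - Legendre (\<Prod>m\<in>M. x + m) (int p)"
      by (simp add: shift_poly_def poly_prod cong_iff_dvd_diff dvd_diff_commute)
  qed
  have "2 * L * card {x \<in> {0..<int p}. int p dvd poly (shift_poly M) x ^ ?h - a}
      \<le> m + ?h * ?d + (L + 1) * p"
  proof (rule card_power_residues_le[OF p odd M(1,2)])
    show "\<not> int p dvd m" if "m \<in> M" for m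
      using that M(3) zdvd_not_zless by fastforce
    show "\<not> int p dvd m - n" if "m \<in> M" "n \<in> M" "m \<noteq> n" for m n
    proof
      assume "int p dvd m - n"
      then have "m mod int p = n mod int p" by (simp add: mod_eq_dvd_iff)
      moreover have "m mod int p = m" "n mod int p = n" using that M(3) by (auto simp: subset_eq)
      ultimately show False using that by simp
    qed
    show "\<not> int p dvd a" using a p2 by auto
    show "2 * L \<le> p" by fact
    show "2 * m + ?d \<le> p" using d by (simp add: m_def)
    \<comment> \<open>there are more unknowns than equations as soon as \<open>m\<close> exceeds a constant depending on \<open>L\<close> and \<open>card M\<close>\<close>
    have "2 * L * (m + 2 * L * ?d + (L + 1)) = 2 * L * m + 2 * (L * (2 * L * ?d + L + 1))"
      by (simp add: algebra_simps)
    also have "\<dots> < 2 * L * m + 2 * m" using mL by simp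
    finally show "2 * L * (m + 2 * L * ?d + (L + 1)) < 2 * (L + 1) * m" by (simp add: algebra_simps)
  qed
  also have "2 * L * card {x \<in> {0..<int p}. Legendre (\<Prod>m\<in>M. x + m) (int p) = a}
     \<le> 2 * L * card {x \<in> {0..<int p}. int p dvd poly (shift_poly M) x ^ ?h - a}"
    by (rule mult_le_mono2, rule card_mono[OF _ sub], rule finite_subset[of _ "{0..<int p}"]) auto
  ultimately have "2 * L * card {x \<in> {0..<int p}. Legendre (\<Prod>m\<in>M. x + m) (int p) = a}
      \<le> m + ?h * ?d + (L + 1) * p" by linarith
  then have "real (2 * L * card {x \<in> {0..<int p}. Legendre (\<Prod>m\<in>M. x + m) (int p) = a})
      \<le> real (m + ?h * ?d + (L + 1) * p)" by (rule of_nat_mono)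
  also have "\<dots> \<le> p / 2 + p / 2 * ?d + (L + 1) * p"
  proof -
    have "real m \<le> p / 2" unfolding m_def by linarith
    moreover have "real ?h \<le> p / 2" by linarith
    then have "real ?h * ?d \<le> p / 2 * ?d" by (rule mult_right_mono) simp
    ultimately show ?thesis by simp
  qed
  also have "\<dots> = 2 * L * (p / 2 + real p * (real (card M) + 3) / (4 * real L))"
    using L(1) by (simp add: field_simps)
  finally show ?thesis using L(1) by simp
qed

text \<open>Upper bounds for the numbers of values \<open>1\<close> and \<open>-1\<close> suffice, because these numbers add up to almost \<open>p\<close>:
neither can then be much smaller than \<open>p/2\<close>.\<close>

lemma complete_sum_bound:
  fixes M :: "int set"
  assumes p: "prime p" and M: "finite M" "M \<noteq> {}" "M \<subseteq> {0<..<int p}"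
    and L: "L > 0" "2 * L \<le> p"
    and large: "2 * (L * (2 * L * card M + L + 1)) + card M + 2 \<le> p"
  shows "\<bar>\<Sum>x = 0..<int p. \<Prod>m\<in>M. chi p (x + m)\<bar> \<le> real p * (real (card M) + 3) / (2 * real L) + card M"
proof -
  have p2: "p > 2" using large L(1) by (cases L) auto
  let ?X = "\<lambda>x. Legendre (\<Prod>m\<in>M. x + m) (int p)"
  define N where "N a = card {x \<in> {0..<int p}. ?X x = a}" for a
  have "card {x \<in> {0..<int p}. ?X x = 0} \<le> card {x \<in> {0..<0 + int p}. \<exists>m\<in>M. chi p (x + m) = 0}"
  proof (rule card_mono)
    show "finite {k \<in> {0..<0 + int p}. \<exists>m\<in>M. chi p (k + m) = 0}"
      by (rule finite_subset[of _ "{0..<int p}"]) auto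
    show "{x \<in> {0..<int p}. ?X x = 0} \<subseteq> {k \<in> {0..<0 + int p}. \<exists>m\<in>M. chi p (k + m) = 0}"
    proof safe
      fix x assume "?X x = 0" "x \<in> {0..<int p}"
      then have "chi p (\<Prod>m\<in>M. x + m) = 0" by (simp add: chi_def)
      then have "(\<Prod>m\<in>M. chi p (x + m)) = 0" by (simp add: chi_prod[OF p p2])
      then show "\<exists>m\<in>M. chi p (x + m) = 0" using M(1) by (simp add: prod_zero_iff)
    qed auto
  qed
  also have "\<dots> \<le> card M" using p2 M by (intro card_chi_zero_le) auto
  finally have N0: "N 0 \<le> card M" by (simp add: N_def)
  have ind: "real (N a) = (\<Sum>x = 0..<int p. if ?X x = a then 1 else 0)" for a
    by (simp add: N_def sum.If_cases Int_def)
  have "real (N 1) + real (N (-1)) + real (N 0) = (\<Sum>x = 0..<int p. 1)"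
    unfolding ind sum.distrib[symmetric]
  proof (rule sum.cong)
    fix x
    show "(if ?X x = 1 then 1 else 0) + (if ?X x = - 1 then 1 else 0) + (if ?X x = 0 then 1 else 0) = (1::real)"
      using Legendre_cases[of "\<Prod>m\<in>M. x + m" "int p"] by auto
  qed simp
  then have tot: "real (N 1) + real (N (-1)) + real (N 0) = p" by simp
  have "(\<Sum>x = 0..<int p. \<Prod>m\<in>M. chi p (x + m)) = (\<Sum>x = 0..<int p. real_of_int (?X x))"
    by (simp add: chi_prod[OF p p2, symmetric]) (simp add: chi_def)
  also have "\<dots> = real (N 1) - real (N (-1))"
    unfolding ind sum_subtractf[symmetric]
  proof (rule sum.cong)
    fix x
    show "real_of_int (?X x) = (if ?X x = 1 then 1 else 0) - (if ?X x = - 1 then 1 else 0)"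
      using Legendre_cases[of "\<Prod>m\<in>M. x + m" "int p"] by auto
  qed simp
  finally have S: "(\<Sum>x = 0..<int p. \<Prod>m\<in>M. chi p (x + m)) = real (N 1) - real (N (-1))" .
  have "real (N a) \<le> p / 2 + real p * (real (card M) + 3) / (4 * real L)" if "a = 1 \<or> a = -1" for a
    unfolding N_def by (rule card_Legendre_eq_le[OF p M that L large])
  from this[of 1] this[of "-1"]
  have "real (N 1) \<le> p / 2 + real p * (real (card M) + 3) / (4 * real L)" "real (N (-1)) \<le> p / 2 + real p * (real (card M) + 3) / (4 * real L)" by auto
  moreover have "real p * (real (card M) + 3) / (2 * real L) = 2 * (real p * (real (card M) + 3) / (4 * real L))" by simp
  moreover have "real (N 0) \<le> card M" using N0 by simp
  ultimately show ?thesis unfolding S using tot by linarith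
qed

text \<open>The sum runs over a full period, so \<open>M\<close> may be translated to positive integers; for large \<open>p\<close> these are
smaller than \<open>p\<close>, hence nonzero and distinct modulo \<open>p\<close>.\<close>

lemma complete_sum_small:
  fixes M :: "int set" and e :: real
  assumes M: "finite M" "M \<noteq> {}" and e: "e > 0"
  shows "\<forall>\<^sub>F p in sequentially. prime p \<longrightarrow> \<bar>\<Sum>x = 1..int p. \<Prod>m\<in>M. chi p (x + m)\<bar> \<le> e * p"
proof -
  define c where "c = 1 - Min M"
  define M' where "M' = (\<lambda>m. m + c) ` M"
  have M': "finite M'" "M' \<noteq> {}" "card M' = card M"
    using M by (auto simp: M'_def card_image)
  have pos: "m > 0" if "m \<in> M'" for m
    using that Min_le[OF M(1)] by (fastforce simp: M'_def c_def)
  define L where "L = nat \<lceil>(card M + 3) / e\<rceil>"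
  have "real L \<ge> (card M + 3) / e" unfolding L_def by linarith
  then have Le: "real (card M) + 3 \<le> e * real L" using e by (simp add: field_simps)
  then have L: "L > 0" using e by (cases L) auto
  define B where "B = Max {2 * L, 2 * (L * (2 * L * card M + L + 1)) + card M + 2, nat (Max M') + 1, nat \<lceil>2 * card M / e\<rceil>}"
  have "\<forall>\<^sub>F p in sequentially. p \<ge> B" by (rule eventually_ge_at_top)
  then show ?thesis
  proof eventually_elim
    case (elim p)
    show ?case
    proof
      assume p: "prime p"
      have B: "2 * L \<le> p" "2 * (L * (2 * L * card M + L + 1)) + card M + 2 \<le> p" "nat (Max M') + 1 \<le> p"
          "nat \<lceil>2 * card M / e\<rceil> \<le> p"
        using elim by (auto simp: B_def)
      have "M' \<subseteq> {0<..<int p}" using pos Max_ge[OF M'(1)] B(3) by fastforce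
      note bound = complete_sum_bound[OF p M'(1,2) this L B(1)]
      have "(\<Sum>x = 1..int p. \<Prod>m\<in>M. chi p (x + m)) = (\<Sum>x\<in>{1 - c..<1 - c + int p}. \<Prod>m\<in>M'. chi p (x + m))"
        by (rule sum.reindex_bij_witness[where i = "\<lambda>x. x + c" and j = "\<lambda>x. x - c"])
          (auto simp: M'_def prod.reindex algebra_simps)
      also have "\<dots> = (\<Sum>x = 0..<int p. \<Prod>m\<in>M'. chi p (x + m))"
        using prime_gt_0_nat[OF p]
        by (intro sum_periodic_int prod.cong refl chi_cong) (auto simp: cong_def mod_simps)
      finally have "\<bar>\<Sum>x = 1..int p. \<Prod>m\<in>M. chi p (x + m)\<bar> \<le> real p * (real (card M) + 3) / (2 * real L) + card M"
        using bound B(2) by (simp add: M')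
      also have "real p * (real (card M) + 3) / (2 * real L) \<le> real p * (e * real L) / (2 * real L)"
        using Le by (intro divide_right_mono mult_left_mono) auto
      also have "\<dots> = e * p / 2" using L by simp
      also have "card M \<le> e * p / 2"
      proof -
        have "2 * card M / e \<le> p" using B(4) by linarith
        then show ?thesis using e by (simp add: field_simps)
      qed
      finally show "\<bar>\<Sum>x = 1..int p. \<Prod>m\<in>M. chi p (x + m)\<bar> \<le> e * p" by simp
    qed
  qed
qed

lemma sum_shift_diff_le:
  fixes G :: "int \<Rightarrow> real"
  assumes "\<And>k. \<bar>G k\<bar> \<le> 1"
  shows "\<bar>(\<Sum>k = 1..int p. G (k + int h)) - (\<Sum>k = 1..int p. G k)\<bar> \<le> 2 * real h"
proof (induction h)
  case 0
  then show ?case by simp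
next
  case (Suc h)
  have "(\<Sum>k = 1..int p. F (k + 1)) - (\<Sum>k = 1..int p. F k) = F (int p + 1) - F 1" for F :: "int \<Rightarrow> real"
  proof (induction p)
    case (Suc p)
    have "{1..int (Suc p)} = insert (int p + 1) {1..int p}" by auto
    then show ?case using Suc by (simp add: add.commute)
  qed simp
  from this[of "\<lambda>k. G (k + int h)"]
  have "\<bar>(\<Sum>k = 1..int p. G (k + int (Suc h))) - (\<Sum>k = 1..int p. G (k + int h))\<bar> \<le> 2"
    using assms[of "int p + 1 + int h"] assms[of "1 + int h"] by (simp add: algebra_simps)
  moreover have "\<bar>x - y\<bar> \<le> 2 \<Longrightarrow> \<bar>y - z\<bar> \<le> b \<Longrightarrow> \<bar>x - z\<bar> \<le> b + 2" for x y z b :: real by linarith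
  ultimately show ?case using Suc.IH by fastforce
qed

lemma abs_powi_unit: "a = 1 \<or> a = -1 \<Longrightarrow> \<bar>a powi k\<bar> = (1::real)"
  by (auto simp: power_int_minus_left)

text \<open>The sum changes little when \<open>k\<close> is shifted by \<open>h < H\<close>; averaging over \<open>h\<close> and applying the Cauchy-Schwarz
inequality leads to the correlations of \<open>g\<close> with its own shifts. There the factors \<open>a powi k\<close> cancel,
as \<open>(a powi k)^2 = 1\<close>.\<close>

lemma van_der_corput_bound:
  fixes g :: "int \<Rightarrow> real" and H :: nat and d :: real
  assumes g: "\<And>k. \<bar>g k\<bar> \<le> 1" and a: "a = 1 \<or> a = (-1::real)" and H: "H > 0"
    and corr: "\<And>h h'. h < H \<Longrightarrow> h' < H \<Longrightarrow> h \<noteq> h' \<Longrightarrow> \<bar>\<Sum>k = 1..int p. g (k + int h) * g (k + int h')\<bar> \<le> d * p"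
    and d: "d \<ge> 0"
  shows "\<bar>\<Sum>k = 1..int p. a powi k * g k\<bar> \<le> p * sqrt (1 / H + d) + 2 * H"
proof -
  define G where "G k = a powi k * g k" for k
  have G: "\<bar>G k\<bar> \<le> 1" for k using g abs_powi_unit[OF a] by (simp add: G_def abs_mult)
  let ?S = "\<Sum>k = 1..int p. G k" and ?T = "\<Sum>k = 1..int p. \<Sum>h<H. G (k + int h)"
  have "\<bar>?T - H * ?S\<bar> = \<bar>\<Sum>h<H. ((\<Sum>k = 1..int p. G (k + int h)) - ?S)\<bar>"
    by (subst sum.swap) (simp add: sum_subtractf)
  also have "\<dots> \<le> (\<Sum>h<H. \<bar>(\<Sum>k = 1..int p. G (k + int h)) - ?S\<bar>)" by (rule sum_abs)
  also have "\<dots> \<le> (\<Sum>h<H. 2 * real H)"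
  proof (rule sum_mono)
    fix h assume "h \<in> {..<H}"
    then show "\<bar>(\<Sum>k = 1..int p. G (k + int h)) - ?S\<bar> \<le> 2 * real H"
      using sum_shift_diff_le[where G = G and p = p and h = h, OF G] by simp
  qed
  finally have 1: "\<bar>?T - H * ?S\<bar> \<le> H * (2 * real H)" by simp
  have "(\<Sum>k = 1..int p. (\<Sum>h<H. G (k + int h))\<^sup>2)
     = (\<Sum>k = 1..int p. \<Sum>h<H. \<Sum>h'<H. G (k + int h) * G (k + int h'))"
    by (simp add: power2_eq_square sum_product)
  also have "\<dots> = (\<Sum>h<H. \<Sum>h'<H. \<Sum>k = 1..int p. G (k + int h) * G (k + int h'))"
    by (subst sum.swap, rule sum.cong[OF refl], rule sum.swap)
  also have "\<dots> \<le> (\<Sum>h<H. \<Sum>h'<H. if h = h' then real p else d * p)"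
  proof (intro sum_mono)
    fix h h' assume hh: "h \<in> {..<H}" "h' \<in> {..<H}"
    show "(\<Sum>k = 1..int p. G (k + int h) * G (k + int h')) \<le> (if h = h' then real p else d * p)"
    proof (cases "h = h'")
      case True
      have "(\<Sum>k = 1..int p. G (k + int h) * G (k + int h')) \<le> (\<Sum>k = 1..int p. 1)"
      proof (rule sum_mono)
        fix k show "G (k + int h) * G (k + int h') \<le> 1"
          using G[of "k + int h"] G[of "k + int h'"]
          by (metis abs_ge_self abs_ge_zero abs_mult mult_le_one order.trans)
      qed
      then show ?thesis using True by simp
    next
      case False
      have "G (k + int h) * G (k + int h') = a powi (int h + int h') * (g (k + int h) * g (k + int h'))" for k
      proof -
        have "a powi (k + int h) * a powi (k + int h') = (a powi k * a powi k) * a powi (int h + int h')"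
          using a by (auto simp: power_int_add algebra_simps)
        also have "a powi k * a powi k = 1" using abs_powi_unit[OF a, of k] by (metis abs_mult_self_eq mult.right_neutral)
        finally show ?thesis by (simp add: G_def algebra_simps)
      qed
      then have "(\<Sum>k = 1..int p. G (k + int h) * G (k + int h'))
          = a powi (int h + int h') * (\<Sum>k = 1..int p. g (k + int h) * g (k + int h'))"
        by (simp add: sum_distrib_left)
      also have "\<dots> \<le> \<bar>\<dots>\<bar>" by (rule abs_ge_self)
      also have "\<dots> \<le> d * p" using corr[of h h'] hh False by (simp add: abs_mult abs_powi_unit[OF a])
      finally show ?thesis using False by simp
    qed
  qed
  also have "\<dots> \<le> (\<Sum>h<H. real p + H * (d * p))"
  proof (rule sum_mono)
    fix h assume h: "h \<in> {..<H}"
    have "(\<Sum>h'<H. if h = h' then real p else d * p) \<le> (\<Sum>h'<H. (if h = h' then real p else 0) + d * p)"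
      using d by (intro sum_mono) auto
    also have "\<dots> = real p + H * (d * p)" using h by (simp add: sum.distrib)
    finally show "(\<Sum>h'<H. if h = h' then real p else d * p) \<le> real p + H * (d * p)" .
  qed
  also have "\<dots> = H\<^sup>2 * p * (1 / H + d)" using H by (simp add: field_simps power2_eq_square)
  finally have 2: "(\<Sum>k = 1..int p. (\<Sum>h<H. G (k + int h))\<^sup>2) \<le> H\<^sup>2 * p * (1 / H + d)" .
  have "?T\<^sup>2 \<le> (\<Sum>k = 1..int p. 1\<^sup>2) * (\<Sum>k = 1..int p. (\<Sum>h<H. G (k + int h))\<^sup>2)"
    using Cauchy_Schwarz_ineq_sum[of "\<lambda>_. 1" "\<lambda>k. \<Sum>h<H. G (k + int h)" "{1..int p}"] by simp
  also have "\<dots> \<le> p * (H\<^sup>2 * p * (1 / H + d))" using 2 by (simp add: mult_left_mono)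
  also have "\<dots> = (H * (p * sqrt (1 / H + d)))\<^sup>2"
    using d by (simp add: power_mult_distrib power2_eq_square)
  finally have "\<bar>?T\<bar> \<le> H * (p * sqrt (1 / H + d))"
    using d by (intro power2_le_imp_le[of "\<bar>?T\<bar>"]) auto
  with 1 have "\<bar>H * ?S\<bar> \<le> H * (p * sqrt (1 / H + d) + 2 * H)" by (simp add: algebra_simps)
  then have "H * \<bar>?S\<bar> \<le> H * (p * sqrt (1 / H + d) + 2 * H)" by (simp add: abs_mult)
  then show ?thesis using H by (simp add: G_def)
qed

text \<open>The product over two different translates of \<open>S\<close> is, up to squares, the product over their symmetric
difference \<open>D\<close>. Two different translates of a finite set have different maxima, so \<open>D\<close> is nonempty.\<close>

lemma chi_correlation_small:
  fixes S :: "int set" and e :: real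
  assumes S: "finite S" "S \<noteq> {}" and hh: "h \<noteq> h'" and e: "e > 0"
  shows "\<forall>\<^sub>F p in sequentially. prime p \<longrightarrow>
    \<bar>\<Sum>k = 1..int p. (\<Prod>m\<in>S. chi p (k + int h + m)) * (\<Prod>m\<in>S. chi p (k + int h' + m))\<bar> \<le> e * p"
proof -
  define A where "A h = (\<lambda>m. int h + m) ` S" for h
  have A: "finite (A h)" for h using S by (simp add: A_def)
  define D where "D = (A h - A h') \<union> (A h' - A h)"
  have "D \<noteq> {}"
  proof
    assume "D = {}"
    then have "A h = A h'" by (auto simp: D_def)
    moreover have "Max (A h) = int h + Max S" for h
      using Max_add_commute[OF S, of "\<lambda>m. m" "int h"] by (simp add: A_def add.commute)
    ultimately show False using hh by (metis add_right_cancel of_nat_eq_iff)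
  qed
  moreover have fD: "finite D" using A by (simp add: D_def)
  ultimately have "\<forall>\<^sub>F p in sequentially. prime p \<longrightarrow> \<bar>\<Sum>x = 1..int p. \<Prod>m\<in>D. chi p (x + m)\<bar> \<le> e / 2 * p"
    using e by (intro complete_sum_small) auto
  moreover have "\<forall>\<^sub>F p in sequentially. p \<ge> nat \<lceil>2 * card (A h \<inter> A h') / e\<rceil>" by (rule eventually_ge_at_top)
  ultimately show ?thesis
  proof eventually_elim
    case (elim p)
    show ?case
    proof
      assume p: "prime p"
      let ?I = "A h \<inter> A h'"
      have fI: "finite ?I" using A by simp
      have prodA: "(\<Prod>m\<in>S. chi p (k + int h + m)) = (\<Prod>m\<in>A h. chi p (k + m))" for k h
        unfolding A_def by (subst prod.reindex) (auto simp: add.assoc)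
      let ?Z = "{k \<in> {1..<1 + int p}. \<exists>m\<in>?I. chi p (k + m) = 0}"
      have split: "(\<Prod>m\<in>A h. chi p (k + m)) * (\<Prod>m\<in>A h'. chi p (k + m))
          = (\<Prod>m\<in>D. chi p (k + m)) * (\<Prod>m\<in>?I. (chi p (k + m))\<^sup>2)" for k
      proof -
        have 1: "(\<Prod>m\<in>A h. chi p (k + m)) = (\<Prod>m\<in>A h - A h'. chi p (k + m)) * (\<Prod>m\<in>?I. chi p (k + m))"
          using prod.Int_Diff[OF A, of "\<lambda>m. chi p (k + m)" h "A h'"] by (simp add: mult.commute)
        have 2: "(\<Prod>m\<in>A h'. chi p (k + m)) = (\<Prod>m\<in>A h' - A h. chi p (k + m)) * (\<Prod>m\<in>?I. chi p (k + m))"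
          using prod.Int_Diff[OF A, of "\<lambda>m. chi p (k + m)" h' "A h"] by (simp add: mult.commute Int_commute)
        have 3: "(\<Prod>m\<in>D. chi p (k + m)) = (\<Prod>m\<in>A h - A h'. chi p (k + m)) * (\<Prod>m\<in>A h' - A h. chi p (k + m))"
          unfolding D_def using A by (intro prod.union_disjoint) auto
        show ?thesis unfolding 1 2 3 by (simp add: power2_eq_square prod.distrib)
      qed
      have absD: "\<bar>\<Prod>m\<in>D. chi p (k + m)\<bar> \<le> 1" for k
        unfolding abs_prod by (intro prod_le_1) (auto simp: abs_chi_le)
      have "\<bar>(\<Sum>k = 1..int p. (\<Prod>m\<in>A h. chi p (k + m)) * (\<Prod>m\<in>A h'. chi p (k + m))) - (\<Sum>k = 1..int p. \<Prod>m\<in>D. chi p (k + m))\<bar>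
          \<le> (\<Sum>k = 1..int p. \<bar>(\<Prod>m\<in>D. chi p (k + m)) * (\<Prod>m\<in>?I. (chi p (k + m))\<^sup>2) - (\<Prod>m\<in>D. chi p (k + m))\<bar>)"
        unfolding split sum_subtractf[symmetric] by (rule sum_abs)
      also have "\<dots> \<le> (\<Sum>k = 1..int p. if k \<in> ?Z then 1 else 0)"
      proof (rule sum_mono)
        fix k assume k: "k \<in> {1..int p}"
        show "\<bar>(\<Prod>m\<in>D. chi p (k + m)) * (\<Prod>m\<in>?I. (chi p (k + m))\<^sup>2) - (\<Prod>m\<in>D. chi p (k + m))\<bar> \<le> (if k \<in> ?Z then 1 else 0)"
        proof (cases "k \<in> ?Z")
          case True
          then have "(\<Prod>m\<in>?I. (chi p (k + m))\<^sup>2) = 0" using fI by (auto intro!: prod_zero)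
          then show ?thesis using True absD[of k] by simp
        next
          case False
          then have "chi p (k + m) \<noteq> 0" if "m \<in> ?I" for m using k that by auto
          then have "(chi p (k + m))\<^sup>2 = 1" if "m \<in> ?I" for m using that chi_cases[of p "k + m"] by fastforce
          then have "(\<Prod>m\<in>?I. (chi p (k + m))\<^sup>2) = 1" by (intro prod.neutral) blast
          then show ?thesis using False by simp
        qed
      qed
      also have "\<dots> = card ({1..int p} \<inter> ?Z)" by (subst sum.If_cases) (auto intro!: arg_cong[where f = card])
      also have "{1..int p} \<inter> ?Z = ?Z" by auto
      also have "real (card ?Z) \<le> card ?I"
        using card_chi_zero_le[OF prime_gt_0_nat[OF p] fI, of 1] by simp
      also have "real (card ?I) \<le> e / 2 * p"
      proof -
        have "2 * card ?I / e \<le> p" using elim by linarith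
        then show ?thesis using e by (simp add: field_simps)
      qed
      finally have diff: "\<bar>(\<Sum>k = 1..int p. (\<Prod>m\<in>A h. chi p (k + m)) * (\<Prod>m\<in>A h'. chi p (k + m))) - (\<Sum>k = 1..int p. \<Prod>m\<in>D. chi p (k + m))\<bar> \<le> e / 2 * p" .
      have "\<bar>\<Sum>k = 1..int p. \<Prod>m\<in>D. chi p (k + m)\<bar> \<le> e / 2 * p" using elim p by blast
      moreover have "\<bar>x - y\<bar> \<le> e / 2 * p \<Longrightarrow> \<bar>y\<bar> \<le> e / 2 * p \<Longrightarrow> \<bar>x\<bar> \<le> e * p" for x y by linarith
      ultimately show "\<bar>\<Sum>k = 1..int p. (\<Prod>m\<in>S. chi p (k + int h + m)) * (\<Prod>m\<in>S. chi p (k + int h' + m))\<bar> \<le> e * p"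
        using diff unfolding prodA by blast
    qed
  qed
qed

text \<open>With \<open>a = -1\<close> this contains the alternating sums \<open>(-1)^k\<close> that come from the half-integer points.\<close>

lemma alternating_sum_small:
  fixes S :: "int set" and e :: real
  assumes S: "finite S" "S \<noteq> {}" and a: "a = 1 \<or> a = (-1::real)" and e: "e > 0"
  shows "\<forall>\<^sub>F p in sequentially. prime p \<longrightarrow> \<bar>\<Sum>k = 1..int p. a powi k * (\<Prod>m\<in>S. chi p (k + m))\<bar> \<le> e * p"
proof -
  \<comment> \<open>chosen such that \<open>sqrt (1 / H + d) \<le> e / 2\<close> for \<open>d = e^2 / 8\<close>\<close>
  define H where "H = nat \<lceil>8 / e\<^sup>2\<rceil>"
  have "real H \<ge> 8 / e\<^sup>2" unfolding H_def by linarith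
  moreover have "8 / e\<^sup>2 > 0" using e by simp
  ultimately have "real H > 0" by linarith
  with \<open>real H \<ge> 8 / e\<^sup>2\<close> have H: "H > 0" "1 / H \<le> e\<^sup>2 / 8" using e by (auto simp: field_simps)
  define d where "d = e\<^sup>2 / 8"
  have d: "d > 0" using e by (simp add: d_def)
  have "\<forall>\<^sub>F p in sequentially. \<forall>hh\<in>{..<H} \<times> {..<H} - Id. prime p \<longrightarrow>
      \<bar>\<Sum>k = 1..int p. (\<Prod>m\<in>S. chi p (k + int (fst hh) + m)) * (\<Prod>m\<in>S. chi p (k + int (snd hh) + m))\<bar> \<le> d * p"
    by (intro eventually_ball_finite ballI chi_correlation_small S d) auto
  moreover have "\<forall>\<^sub>F p in sequentially. p \<ge> nat \<lceil>4 * H / e\<rceil>" by (rule eventually_ge_at_top)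
  ultimately show ?thesis
  proof eventually_elim
    case (elim p)
    show ?case
    proof
      assume p: "prime p"
      have A: "\<bar>\<Sum>k = 1..int p. a powi k * (\<Prod>m\<in>S. chi p (k + m))\<bar> \<le> p * sqrt (1 / H + d) + 2 * H"
      proof (rule van_der_corput_bound[OF _ a H(1)])
        show "\<bar>\<Prod>m\<in>S. chi p (k + m)\<bar> \<le> 1" for k
          unfolding abs_prod by (intro prod_le_1) (auto simp: abs_chi_le)
        show "\<bar>\<Sum>k = 1..int p. (\<Prod>m\<in>S. chi p (k + int h + m)) * (\<Prod>m\<in>S. chi p (k + int h' + m))\<bar> \<le> d * p"
          if "h < H" "h' < H" "h \<noteq> h'" for h h'
          using elim(1)[rule_format, of "(h, h')"] that p by auto
      qed (use d in simp)
      have B: "sqrt (1 / H + d) \<le> e / 2"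
      proof (rule real_le_lsqrt)
        show "1 / H + d \<le> (e / 2)\<^sup>2" using H by (simp add: d_def power_divide)
      qed (use e d in auto)
      have C: "2 * H \<le> e / 2 * p"
      proof -
        have "4 * H / e \<le> p" using elim(2) by linarith
        then show ?thesis using e by (simp add: field_simps)
      qed
      have "p * sqrt (1 / H + d) \<le> p * (e / 2)" using B by (intro mult_left_mono) auto
      then have "p * sqrt (1 / H + d) \<le> e / 2 * p" by (simp only: mult.commute)
      with A C show "\<bar>\<Sum>k = 1..int p. a powi k * (\<Prod>m\<in>S. chi p (k + m))\<bar> \<le> e * p"
        by linarith
    qed
  qed
qed

section \<open>Gauss sums and the values at half-integer points\<close>

lemma sum_periodic_mult_invariant:
  fixes f :: "int \<Rightarrow> 'a::comm_monoid_add"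
  assumes p: "prime p" and a: "\<not> int p dvd a" and f: "\<And>x. f (x mod int p) = f x"
  shows "(\<Sum>j = 0..<int p. f (a * j)) = (\<Sum>j = 0..<int p. f j)"
proof -
  have p0: "int p > 0" using prime_gt_0_nat[OF p] by simp
  have inj: "inj_on (\<lambda>j. (a * j) mod int p) {0..<int p}"
  proof (rule inj_onI)
    fix x y assume xy: "x \<in> {0..<int p}" "y \<in> {0..<int p}" "(a * x) mod int p = (a * y) mod int p"
    then have "int p dvd a * (x - y)" by (simp add: mod_eq_dvd_iff right_diff_distrib)
    then have "int p dvd x - y" using p a by (simp add: prime_dvd_mult_iff)
    then have "x mod int p = y mod int p" by (simp add: mod_eq_dvd_iff)
    then show "x = y" using xy by simp
  qed
  have "(\<lambda>j. (a * j) mod int p) ` {0..<int p} \<subseteq> {0..<int p}" using p0 by auto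
  then have im: "(\<lambda>j. (a * j) mod int p) ` {0..<int p} = {0..<int p}"
    using inj by (intro endo_inj_surj) auto
  have "(\<Sum>j = 0..<int p. f j) = (\<Sum>j\<in>(\<lambda>j. (a * j) mod int p) ` {0..<int p}. f j)" using im by simp
  also have "\<dots> = (\<Sum>j = 0..<int p. f (a * j))" using inj by (simp add: sum.reindex f)
  finally show ?thesis by simp
qed

text \<open>Otherwise \<open>x^((p - 1)/2) - 1\<close> would have \<open>p - 1\<close> roots modulo \<open>p\<close>.\<close>

lemma exists_nonresidue:
  assumes p: "prime p" "p > 2"
  shows "\<exists>a. chi p a = - 1"
proof (rule ccontr)
  assume no: "\<nexists>a. chi p a = - 1"
  let ?h = "(p - 1) div 2" and ?q = "int p"
  define R where "R = Polynomial.monom 1 ?h - (1 :: int poly)"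
  have q: "prime ?q" using p by simp
  have h: "?h > 0" "?h < p - 1" using p by auto
  have lead: "poly.coeff R ?h = 1" using h by (simp add: R_def)
  have "\<not> [:?q:] dvd R"
  proof
    assume "[:?q:] dvd R"
    then have "?q dvd poly.coeff R ?h" unfolding const_poly_dvd_iff by blast
    then show False using lead p by simp
  qed
  moreover have "\<exists>S. [:?q:] dvd R - X_minus a ^ 1 * S" if "a \<in> {1..<?q}" for a
  proof -
    have "\<not> ?q dvd a" using that zdvd_not_zless by auto
    then have "chi p a = 1" using no chi_cases[of p a] chi_eq_0_iff[of p a] by auto
    then have "Legendre a ?q = 1" by (simp add: chi_def)
    then have "[1 = a ^ ?h] (mod ?q)" using euler_criterion[OF p, of a] by simp
    then have "?q dvd poly R a" by (simp add: R_def poly_monom cong_iff_dvd_diff dvd_diff_commute)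
    then show ?thesis using root_mod_imp_linear_factor by auto
  qed
  ultimately have "1 * card {1..<?q} \<le> degree R"
    by (intro card_multiple_roots_mod_le_degree[OF q]) auto
  also have "degree R \<le> ?h" unfolding R_def
    by (intro degree_diff_le degree_monom_le) auto
  finally show False using h by simp
qed

lemma sum_chi_eq_0:
  assumes p: "prime p" "p > 2"
  shows "(\<Sum>j = 0..<int p. chi p j) = 0"
proof -
  obtain a where a: "chi p a = - 1" using exists_nonresidue[OF p] by blast
  then have "\<not> int p dvd a" using chi_eq_0_iff[of p a] by auto
  then have "(\<Sum>j = 0..<int p. chi p (a * j)) = (\<Sum>j = 0..<int p. chi p j)"
    by (intro sum_periodic_mult_invariant p) auto
  then show ?thesis by (simp add: chi_mult[OF p] a sum_negf)
qed

lemma sum_chi_square: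
  assumes p: "prime p"
  shows "(\<Sum>j = 0..<int p. (chi p j)\<^sup>2) = real p - 1"
proof -
  have p0: "p > 0" using prime_gt_0_nat[OF p] .
  have "(\<Sum>j = 0..<int p. (chi p j)\<^sup>2) = (\<Sum>j\<in>{0..<int p} - {0}. (chi p j)\<^sup>2) + (chi p 0)\<^sup>2"
    using p0 by (subst sum.remove[of _ 0]) auto
  also have "chi p 0 = 0" by (simp add: chi_eq_0_iff)
  also have "(\<Sum>j\<in>{0..<int p} - {0}. (chi p j)\<^sup>2) = (\<Sum>j\<in>{0..<int p} - {0}. 1)"
  proof (rule sum.cong[OF refl])
    fix j assume "j \<in> {0..<int p} - {0}"
    then have "\<not> int p dvd j" using zdvd_not_zless by auto
    then show "(chi p j)\<^sup>2 = 1" using chi_cases[of p j] chi_eq_0_iff[of p j] by auto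
  qed
  finally show ?thesis using p0 by (simp add: of_nat_diff)
qed

definition zeta :: "nat \<Rightarrow> int \<Rightarrow> complex" where
  "zeta p j = cis (2 * pi * real_of_int j / real p)"

lemma zeta_mod: "p > 0 \<Longrightarrow> zeta p (j mod int p) = zeta p j"
proof -
  assume p: "p > 0"
  have "real_of_int j = real_of_int (j mod int p) + real p * real_of_int (j div int p)"
    by (metis mod_mult_div_eq of_int_add of_int_mult of_int_of_nat_eq)
  then have "2 * pi * real_of_int j / real p
      = 2 * pi * real_of_int (j mod int p) / real p + 2 * pi * real_of_int (j div int p)"
    using p by (simp add: field_simps)
  then have "zeta p j = zeta p (j mod int p) * cis (2 * pi * real_of_int (j div int p))"
    unfolding zeta_def by (simp only: cis_mult)
  then show ?thesis by (simp add: cis_multiple_2pi)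
qed

lemma zeta_add: "zeta p (a + b) = zeta p a * zeta p b"
  by (simp add: zeta_def cis_mult add_divide_distrib distrib_left)

lemma cnj_zeta: "cnj (zeta p a) = zeta p (- a)"
  by (simp add: zeta_def cis_cnj)

lemma sum_cis_geometric:
  assumes "p > 0"
  shows "(\<Sum>a = 0..<int p. cis (real_of_int a * x)) = (\<Sum>a<p. cis x ^ a)"
proof -
  have "(\<Sum>a = 0..<int p. cis (real_of_int a * x)) = (\<Sum>a<p. cis (real a * x))"
    by (rule sum.reindex_bij_witness[where i = int and j = nat]) auto
  then show ?thesis by (simp add: Complex.DeMoivre)
qed

lemma sum_zeta:
  assumes p: "p > 0"
  shows "(\<Sum>a = 0..<int p. zeta p (a * j)) = (if int p dvd j then of_nat p else 0)"
proof (cases "int p dvd j")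
  case True
  then have "zeta p (a * j) = 1" for a
    using zeta_mod[OF p, of "a * j"] by (simp add: zeta_def)
  then show ?thesis using True by simp
next
  case False
  define x where "x = 2 * pi * real_of_int j / real p"
  have "(\<Sum>a = 0..<int p. zeta p (a * j)) = (\<Sum>a = 0..<int p. cis (real_of_int a * x))"
    by (simp add: zeta_def x_def field_simps)
  also have "\<dots> = (\<Sum>a<p. cis x ^ a)" by (rule sum_cis_geometric[OF p])
  also have "\<dots> = 0"
  proof -
    have ne: "cis x \<noteq> 1"
    proof
      assume "cis x = 1"
      then have "cos x = 1" by (simp add: complex_eq_iff)
      then obtain n :: int where "x = of_int n * 2 * pi" using cos_one_2pi_int by auto
      then have "real_of_int j = real_of_int (n * int p)" using p by (simp add: x_def field_simps)
      then have "j = n * int p" by (simp only: of_int_eq_iff)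
      then show False using False by simp
    qed
    have "cis x ^ p = cis (real p * x)" by (rule Complex.DeMoivre)
    also have "real p * x = 2 * pi * real_of_int j" using p by (simp add: x_def)
    also have "cis \<dots> = 1" by (rule cis_multiple_2pi) simp
    finally show ?thesis using ne by (simp add: geometric_sum)
  qed
  finally show ?thesis using False by simp
qed

definition gauss_sum :: "nat \<Rightarrow> int \<Rightarrow> complex" where
  "gauss_sum p a = (\<Sum>j = 0..<int p. complex_of_real (chi p j) * zeta p (a * j))"

lemma gauss_sum_eq:
  assumes p: "prime p" "p > 2"
  shows "gauss_sum p a = chi p a * gauss_sum p 1"
proof (cases "int p dvd a")
  case True
  then have "zeta p (a * j) = 1" for j
    using zeta_mod[of p "a * j"] p by (simp add: zeta_def)
  then have "gauss_sum p a = complex_of_real (\<Sum>j = 0..<int p. chi p j)" by (simp add: gauss_sum_def)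
  then show ?thesis using True chi_eq_0_iff[of p a] sum_chi_eq_0[OF p] by simp
next
  case False
  have "gauss_sum p 1 = (\<Sum>j = 0..<int p. complex_of_real (chi p j) * zeta p j)" by (simp add: gauss_sum_def)
  also have "\<dots> = (\<Sum>j = 0..<int p. complex_of_real (chi p (a * j)) * zeta p (a * j))"
    using zeta_mod[of p] p
    by (intro sum_periodic_mult_invariant[OF p(1) False, symmetric]) auto
  also have "\<dots> = chi p a * gauss_sum p a"
    by (simp add: chi_mult[OF p] gauss_sum_def sum_distrib_left mult.assoc)
  finally have "chi p a * gauss_sum p 1 = (chi p a * chi p a) * gauss_sum p a" by simp
  moreover have "chi p a * chi p a = 1" using False chi_eq_0_iff[of p a] chi_cases[of p a] by auto
  ultimately show ?thesis by (simp flip: of_real_mult)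
qed

lemma cnj_gauss_sum:
  assumes p: "prime p" "p > 2"
  shows "cnj (gauss_sum p 1) = chi p (- 1) * gauss_sum p 1"
  using gauss_sum_eq[OF p, of "- 1"] by (simp add: gauss_sum_def cnj_zeta)

text \<open>Parseval's identity: the squared absolute values of all \<open>gauss_sum p a\<close> add up to \<open>p * (p - 1)\<close>, and those
with \<open>p\<close> not dividing \<open>a\<close> are equal. This determines the Gauss sum up to its sign.\<close>

lemma gauss_sum_mult_cnj:
  assumes p: "prime p" "p > 2"
  shows "gauss_sum p 1 * cnj (gauss_sum p 1) = of_nat p"
proof -
  have p0: "p > 0" using p by simp
  let ?I = "{0..<int p}"
  have "(\<Sum>a\<in>?I. gauss_sum p a * cnj (gauss_sum p a))
     = (\<Sum>a\<in>?I. \<Sum>j\<in>?I. \<Sum>i\<in>?I. (chi p j * chi p i) * zeta p (a * (j - i)))"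
    by (simp add: gauss_sum_def sum_product cnj_zeta zeta_add[symmetric] algebra_simps)
  also have "\<dots> = (\<Sum>j\<in>?I. \<Sum>i\<in>?I. \<Sum>a\<in>?I. (chi p j * chi p i) * zeta p (a * (j - i)))"
    by (subst sum.swap, rule sum.cong[OF refl], rule sum.swap)
  also have "\<dots> = (\<Sum>j\<in>?I. \<Sum>i\<in>?I. if i = j then complex_of_real ((chi p j)\<^sup>2 * p) else 0)"
  proof (intro sum.cong refl)
    fix i j assume ij: "i \<in> ?I" "j \<in> ?I"
    have "int p dvd j - i \<longleftrightarrow> i = j"
    proof
      assume "int p dvd j - i"
      then have "j mod int p = i mod int p" by (simp add: mod_eq_dvd_iff)
      then show "i = j" using ij by simp
    qed simp
    then show "(\<Sum>a\<in>?I. (chi p j * chi p i) * zeta p (a * (j - i))) = (if i = j then complex_of_real ((chi p j)\<^sup>2 * p) else 0)"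
      by (simp add: sum_distrib_left[symmetric] sum_zeta[OF p0] power2_eq_square)
  qed
  also have "\<dots> = complex_of_real ((\<Sum>j\<in>?I. (chi p j)\<^sup>2) * p)"
    by (simp add: sum_distrib_right)
  also have "\<dots> = complex_of_real ((real p - 1) * p)" by (simp only: sum_chi_square[OF p(1)])
  finally have 1: "(\<Sum>a\<in>?I. gauss_sum p a * cnj (gauss_sum p a)) = complex_of_real ((real p - 1) * p)" .
  have "(\<Sum>a\<in>?I. gauss_sum p a * cnj (gauss_sum p a))
      = (\<Sum>a\<in>?I. complex_of_real ((chi p a)\<^sup>2) * (gauss_sum p 1 * cnj (gauss_sum p 1)))"
    by (subst (1 2) gauss_sum_eq[OF p]) (simp add: power2_eq_square algebra_simps)
  also have "\<dots> = complex_of_real (\<Sum>a\<in>?I. (chi p a)\<^sup>2) * (gauss_sum p 1 * cnj (gauss_sum p 1))"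
    by (simp add: sum_distrib_right)
  also have "\<dots> = complex_of_real (real p - 1) * (gauss_sum p 1 * cnj (gauss_sum p 1))"
    by (simp only: sum_chi_square[OF p(1)])
  finally have 2: "(\<Sum>a\<in>?I. gauss_sum p a * cnj (gauss_sum p a)) = complex_of_real (real p - 1) * (gauss_sum p 1 * cnj (gauss_sum p 1))" .
  have "complex_of_real (real p - 1) * (gauss_sum p 1 * cnj (gauss_sum p 1)) = complex_of_real (real p - 1) * of_nat p"
    using trans[OF sym[OF 2] 1] by (simp only: of_real_mult of_real_of_nat_eq)
  moreover have "complex_of_real (real p - 1) \<noteq> 0" using p by (simp only: of_real_eq_0_iff)
  ultimately show ?thesis by (metis mult_cancel_left)
qed

lemma chi_minus_one:
  assumes p: "prime p" "p > 2"
  shows "chi p (- 1) = (if p mod 4 = 1 then 1 else - 1)"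
proof -
  have "odd p" using p prime_odd_nat by blast
  have "[Legendre (- 1) (int p) = (- 1) ^ ((p - 1) div 2)] (mod int p)" by (rule euler_criterion[OF p])
  moreover have "(- 1 :: int) ^ ((p - 1) div 2) = (if p mod 4 = 1 then 1 else - 1)"
  proof -
    have "even ((p - 1) div 2) \<longleftrightarrow> p mod 4 = 1" using \<open>odd p\<close> by presburger
    then show ?thesis by simp
  qed
  ultimately have d: "int p dvd Legendre (- 1) (int p) - (if p mod 4 = 1 then 1 else - 1)"
    by (simp add: cong_iff_dvd_diff)
  have "\<bar>Legendre (- 1) (int p) - (if p mod 4 = 1 then 1 else - 1)\<bar> < int p"
    using Legendre_cases[of "- 1" "int p"] p by auto
  with d have "Legendre (- 1) (int p) - (if p mod 4 = 1 then 1 else - 1) = 0"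
    using dvd_imp_le_int[OF _ d] by (rule_tac ccontr) simp
  then show ?thesis by (auto simp: chi_def split: if_splits)
qed

text \<open>The terms for \<open>a\<close> and \<open>p - a\<close> combine to a cosine or to a sine, according to the parity of \<open>chi\<close>.\<close>

lemma fekete_eq_Hp:
  assumes p: "prime p" "p > 2"
  shows "(\<Sum>a = 0..<int p. complex_of_real (chi p a) * cis ((2 * real_of_int a - real p) * pi * t))
    = (if p mod 4 = 1 then 1 else \<i>) * complex_of_real (Hp p t)"
proof -
  define h where "h = (p - 1) div 2"
  have "odd p" using p prime_odd_nat by blast
  then have ph: "p = 2 * h + 1" by (auto simp: h_def elim: oddE)
  define F where "F a = complex_of_real (chi p a) * cis ((2 * real_of_int a - real p) * pi * t)" for a
  have eq: "{0..<int p} = insert 0 ({1..int h} \<union> {int h + 1..<int p})" by (auto simp: ph)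
  have "(\<Sum>a = 0..<int p. F a) = F 0 + ((\<Sum>a\<in>{1..int h}. F a) + (\<Sum>a\<in>{int h + 1..<int p}. F a))"
  proof -
    have "(\<Sum>a\<in>{1..int h} \<union> {int h + 1..<int p}. F a) = (\<Sum>a\<in>{1..int h}. F a) + (\<Sum>a\<in>{int h + 1..<int p}. F a)"
      by (rule sum.union_disjoint) auto
    then show ?thesis unfolding eq by simp
  qed
  also have "F 0 = 0" using chi_eq_0_iff[of p 0] by (simp add: F_def)
  also have "(\<Sum>a\<in>{int h + 1..<int p}. F a) = (\<Sum>a\<in>{1..int h}. F (int p - a))"
    by (rule sum.reindex_bij_witness[where i = "\<lambda>a. int p - a" and j = "\<lambda>a. int p - a"]) (auto simp: ph)
  also have "0 + ((\<Sum>a\<in>{1..int h}. F a) + (\<Sum>a\<in>{1..int h}. F (int p - a)))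
      = (\<Sum>a\<in>{1..int h}. F a + F (int p - a))" by (simp add: sum.distrib)
  also have "\<dots> = (\<Sum>a = 1..h. F (int a) + F (int p - int a))"
    by (rule sum.reindex_bij_witness[where i = int and j = nat]) auto
  also have "\<dots> = (\<Sum>a = 1..h. (if p mod 4 = 1 then 1 else \<i>) * complex_of_real (2 * (chi p (int a) *
      (if p mod 4 = 1 then cos ((2 * real a - real p) * pi * t) else sin ((2 * real a - real p) * pi * t)))))"
  proof (rule sum.cong[OF refl])
    fix a
    define x where "x = (2 * real a - real p) * pi * t"
    have "chi p (int p - int a) = chi p (- 1 * int a)" by (rule chi_cong) (simp add: cong_iff_dvd_diff)
    also have "\<dots> = (if p mod 4 = 1 then 1 else - 1) * chi p (int a)"
      by (simp only: chi_mult[OF p] chi_minus_one[OF p])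
    finally have c: "chi p (int p - int a) = \<dots>" .
    have "(2 * real_of_int (int p - int a) - real p) * pi * t = - x" by (simp add: x_def algebra_simps)
    then have "F (int p - int a) = complex_of_real ((if p mod 4 = 1 then 1 else - 1) * chi p (int a)) * cis (- x)"
      unfolding F_def c by (simp only:)
    moreover have "F (int a) = complex_of_real (chi p (int a)) * cis x" by (simp add: F_def x_def)
    ultimately show "F (int a) + F (int p - int a) = (if p mod 4 = 1 then 1 else \<i>) * complex_of_real (2 * (chi p (int a) *
      (if p mod 4 = 1 then cos ((2 * real a - real p) * pi * t) else sin ((2 * real a - real p) * pi * t))))"
      unfolding x_def[symmetric] by (simp add: complex_eq_iff)
  qed
  also have "\<dots> = (if p mod 4 = 1 then 1 else \<i>) * complex_of_real (Hp p t)"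
    by (simp add: Hp_def h_def chi_def sum_distrib_left)
  finally show ?thesis by (simp add: F_def)
qed

text \<open>Half-integer points are special because the \<open>p\<close>-th power of the ratio is \<open>-1\<close>, independently of \<open>u\<close>.\<close>

lemma geometric_cis_half:
  assumes p: "p > 0"
  shows "(\<Sum>a<p. cis (2 * pi * (real_of_int u + 1 / 2) / p) ^ a)
    = 1 + \<i> * complex_of_real (cot (pi * (real_of_int u + 1 / 2) / p))"
proof -
  define x where "x = pi * (real_of_int u + 1 / 2) / p"
  have sx: "sin x \<noteq> 0"
  proof
    assume "sin x = 0"
    then obtain i :: int where "x = of_int i * pi" using sin_zero_iff_int2 by blast
    then have "pi * (real_of_int u + 1 / 2) = pi * (of_int i * p)" using p by (simp add: x_def field_simps)
    then have "real_of_int u + 1 / 2 = of_int i * p" by simp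
    then have "real_of_int (2 * u + 1) = real_of_int (2 * i * int p)" by simp
    then have "2 * u + 1 = 2 * i * int p" by (simp only: of_int_eq_iff)
    then have "even (2 * u + 1)" by (metis dvd_triv_left mult.assoc)
    then show False by simp
  qed
  have "cis (2 * x) - 1 = 2 * \<i> * sin x * cis x"
    by (simp add: complex_eq_iff cos_double_sin sin_double power2_eq_square)
  have "cis (2 * x) ^ p = cis (real p * (2 * x))" by (rule Complex.DeMoivre)
  also have "real p * (2 * x) = 2 * pi * real_of_int u + pi" using p by (simp add: x_def field_simps)
  also have "cis (2 * pi * real_of_int u + pi) = - 1" by (simp add: cis_mult[symmetric] cis_multiple_2pi)
  finally have wp: "cis (2 * x) ^ p = - 1" .
  have D: "cis (2 * x) - 1 = 2 * \<i> * sin x * cis x" by fact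
  have ne: "cis (2 * x) \<noteq> 1"
    using D sx by (metis cis_neq_zero complex_i_not_zero eq_iff_diff_eq_0 mult_eq_0_iff of_real_eq_0_iff zero_neq_numeral)
  have "(\<Sum>a<p. cis (2 * x) ^ a) = (cis (2 * x) ^ p - 1) / (cis (2 * x) - 1)"
    by (rule geometric_sum[OF ne])
  also have "\<dots> = - 2 / (2 * \<i> * sin x * cis x)" unfolding wp D by simp
  also have "\<dots> = \<i> * cis (- x) / sin x"
    using sx by (simp add: field_simps cis_mult)
  also have "\<dots> = 1 + \<i> * complex_of_real (cot x)"
    using sx by (simp add: complex_eq_iff cot_def)
  finally have "(\<Sum>a<p. cis (2 * x) ^ a) = 1 + \<i> * complex_of_real (cot x)" .
  moreover have "2 * pi * (real_of_int u + 1 / 2) / p = 2 * x" by (simp add: x_def)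
  ultimately show ?thesis unfolding x_def[symmetric] by (simp only:)
qed

text \<open>The factor \<open>pi\<close> scales the values such that their limiting characteristic function has the arguments
\<open>2*x/n\<close> that occur in \<open>c_rho\<close>.\<close>

definition cot_weight :: "nat \<Rightarrow> int \<Rightarrow> real" where
  "cot_weight p m = pi * (cot (pi * (1 / 2 - real_of_int m) / p) / p)"

definition cot_sum :: "nat \<Rightarrow> real \<Rightarrow> int \<Rightarrow> real" where
  "cot_sum p s k = s * (-1) powi k * (\<Sum>m\<in>{- int ((p - 1) div 2)..int ((p - 1) div 2)}. chi p (k + m) * cot_weight p m)"

text \<open>Multiply \<open>H_p\<close> by the Gauss sum, replace \<open>chi(a)\<close> times the Gauss sum by a sum over additive characters,
and sum over \<open>a\<close> first. The constant \<open>s\<close> is the sign of the Gauss sum up to a factor depending on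
\<open>p mod 4\<close>.\<close>

theorem Hp_eq_cot_sum:
  assumes p: "prime p" "p > 2"
  shows "\<exists>s. (s = 1 \<or> s = -1) \<and> (\<forall>k::int.
    - (pi * Hp p ((real_of_int k + 1 / 2) / real p) / sqrt p) = cot_sum p s k)"
proof -
  have p0: "p > 0" using p by simp
  have "odd p" using p prime_odd_nat by blast
  let ?I = "{0..<int p}" and ?h = "(p - 1) div 2"
  \<comment> \<open>\<open>kap\<close> makes \<open>kap * G\<close> a real number of square \<open>p\<close>\<close>
  define kap where "kap = (if p mod 4 = 1 then 1 else \<i>)"
  define G where "G = gauss_sum p 1"
  have kap2: "kap * kap = chi p (- 1)" by (simp add: kap_def chi_minus_one[OF p])
  have "(kap * G) * (kap * G) = G * (chi p (- 1) * G)"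
    using kap2 by (metis (no_types, lifting) mult.assoc mult.commute)
  also have "\<dots> = of_nat p" using gauss_sum_mult_cnj[OF p] cnj_gauss_sum[OF p] by (simp add: G_def)
  also have "\<dots> = complex_of_real (sqrt p) * complex_of_real (sqrt p)"
    by (simp flip: of_real_mult)
  finally have "(kap * G - sqrt p) * (kap * G + sqrt p) = 0" by (simp add: algebra_simps)
  then obtain s0 :: real where s0: "s0 = 1 \<or> s0 = -1" "kap * G = complex_of_real (s0 * sqrt p)"
    by (auto simp: eq_neg_iff_add_eq_0 intro: that[of 1] that[of "- 1"])
  define s where "s = - s0 * chi p (- 1)"
  have s: "s = 1 \<or> s = -1" using s0(1) chi_minus_one[OF p] by (auto simp: s_def)
  have ss: "s0 * s0 = 1" using s0(1) by auto
  have "- (pi * Hp p ((real_of_int k + 1 / 2) / real p) / sqrt p) = cot_sum p s k" for k :: int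
  proof -
    define t where "t = (real_of_int k + 1 / 2) / real p"
    have pt: "pi * (real p * t) = pi * real_of_int k + pi / 2" using p0 by (simp add: t_def field_simps)
    have cisk: "cis (- (pi * (real p * t))) = (-1) powi k * (- \<i>)"
    proof -
      have "cis (- (pi * (real p * t))) = cis (- (pi * real_of_int k)) * cis (- (pi / 2))"
        unfolding pt cis_mult by (simp only: minus_add_distrib)
      also have "cis (- (pi * real_of_int k)) = (-1) powi k"
      proof -
        have "cis (- pi) powi k = cis (real_of_int k * - pi)" by (rule cis_power_int)
        moreover have "cis (- pi) = - 1" by (simp add: complex_eq_iff)
        ultimately show ?thesis by (simp add: mult.commute)
      qed
      also have "cis (- (pi / 2)) = - \<i>" by (simp add: complex_eq_iff)
      finally show ?thesis .
    qed
    have "(kap * complex_of_real (Hp p t)) * G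
      = (\<Sum>a\<in>?I. cis ((2 * real_of_int a - real p) * pi * t) * gauss_sum p a)"
      unfolding kap_def fekete_eq_Hp[OF p, symmetric] sum_distrib_right
    proof (rule sum.cong[OF refl])
      fix a
      show "complex_of_real (chi p a) * cis ((2 * real_of_int a - real p) * pi * t) * G
          = cis ((2 * real_of_int a - real p) * pi * t) * gauss_sum p a"
        unfolding G_def gauss_sum_eq[OF p, of a] by (simp only: mult_ac)
    qed
    also have "\<dots> = (\<Sum>j\<in>?I. \<Sum>a\<in>?I. cis ((2 * real_of_int a - real p) * pi * t) * (chi p j * zeta p (a * j)))"
      unfolding gauss_sum_def sum_distrib_left by (rule sum.swap)
    also have "\<dots> = (\<Sum>j\<in>?I. cis (- (pi * (real p * t))) * chi p j * (\<Sum>a<p. cis (2 * pi * (real_of_int (k + j) + 1 / 2) / p) ^ a))"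
    proof (rule sum.cong[OF refl])
      fix j
      have "cis ((2 * real_of_int a - real p) * pi * t) * (chi p j * zeta p (a * j))
         = cis (- (pi * (real p * t))) * chi p j * cis (real_of_int a * (2 * pi * (real_of_int (k + j) + 1 / 2) / p))" for a
      proof -
        have "(2 * real_of_int a - real p) * pi * t + 2 * pi * real_of_int (a * j) / real p
          = - (pi * (real p * t)) + real_of_int a * (2 * pi * (real_of_int (k + j) + 1 / 2) / p)"
          using p0 by (simp add: t_def field_simps)
        then have "cis ((2 * real_of_int a - real p) * pi * t) * zeta p (a * j)
          = cis (- (pi * (real p * t))) * cis (real_of_int a * (2 * pi * (real_of_int (k + j) + 1 / 2) / p))"
          unfolding zeta_def cis_mult by (simp only:)
        then show ?thesis by (simp add: algebra_simps)
      qed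
      then show "(\<Sum>a\<in>?I. cis ((2 * real_of_int a - real p) * pi * t) * (chi p j * zeta p (a * j)))
        = cis (- (pi * (real p * t))) * chi p j * (\<Sum>a<p. cis (2 * pi * (real_of_int (k + j) + 1 / 2) / p) ^ a)"
        unfolding sum_cis_geometric[OF p0, symmetric] sum_distrib_left by (simp only:)
    qed
    also have "\<dots> = (\<Sum>j\<in>?I. (-1) powi k * (- \<i>) * chi p j * (1 + \<i> * cot (pi * (real_of_int (k + j) + 1 / 2) / p)))"
      unfolding geometric_cis_half[OF p0] cisk ..
    also have "\<dots> = (-1) powi k * (- \<i>) * complex_of_real (\<Sum>j\<in>?I. chi p j)
        + (-1) powi k * complex_of_real (\<Sum>j\<in>?I. chi p j * cot (pi * (real_of_int (k + j) + 1 / 2) / p))"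
      by (simp add: sum_distrib_left sum.distrib[symmetric] algebra_simps)
    also have "\<dots> = complex_of_real ((-1) powi k * (\<Sum>j\<in>?I. chi p j * cot (pi * (real_of_int (k + j) + 1 / 2) / p)))"
      unfolding sum_chi_eq_0[OF p] by (simp add: of_real_power_int)
    also have "(kap * complex_of_real (Hp p t)) * G = complex_of_real (Hp p t * (s0 * sqrt p))"
      using s0(2) by (simp add: mult_ac)
    finally have 1: "Hp p t * (s0 * sqrt p) = (-1) powi k * (\<Sum>j\<in>?I. chi p j * cot (pi * (real_of_int (k + j) + 1 / 2) / p))"
      by (simp only: of_real_eq_iff)
    define f where "f j = chi p j * cot (pi * (real_of_int (k + j) + 1 / 2) / p)" for j
    have cot_per: "cot (y + pi * of_int n) = cot y" for y and n :: int
      by (simp add: cot_def sin_add cos_add)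
    have fper: "f (x mod int p) = f x" for x
    proof -
      have "real_of_int x = real_of_int (x mod int p) + real p * real_of_int (x div int p)"
        by (metis mod_mult_div_eq of_int_add of_int_mult of_int_of_nat_eq)
      then have "pi * (real_of_int (k + x) + 1 / 2) / p
          = pi * (real_of_int (k + x mod int p) + 1 / 2) / p + pi * real_of_int (x div int p)"
        using p0 by (simp add: field_simps)
      then show ?thesis by (simp only: f_def cot_per chi_mod)
    qed
    \<comment> \<open>by periodicity the sum may be centred at \<open>j = -k\<close>; then \<open>j = -k - m\<close> turns \<open>chi(j)\<close> into \<open>chi(-1) * chi(k + m)\<close>\<close>
    have "(\<Sum>j\<in>?I. f j) = (\<Sum>j\<in>{- k - int ?h..<- k - int ?h + int p}. f j)"
      using sum_periodic_int[of "int p" f, OF _ fper] p0 by simp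
    also have "\<dots> = (\<Sum>m\<in>{- int ?h..int ?h}. f (- k - m))"
      using \<open>odd p\<close>
      by (intro sum.reindex_bij_witness[where i = "\<lambda>m. - k - m" and j = "\<lambda>m. - k - m"]) (auto elim!: oddE)
    also have "\<dots> = (\<Sum>m\<in>{- int ?h..int ?h}. chi p (- 1) * (chi p (k + m) * cot (pi * (1 / 2 - real_of_int m) / p)))"
    proof (rule sum.cong[OF refl])
      fix m
      have "chi p (- k - m) = chi p (- 1 * (k + m))" by simp
      also have "\<dots> = chi p (- 1) * chi p (k + m)" by (rule chi_mult[OF p])
      finally show "f (- k - m) = chi p (- 1) * (chi p (k + m) * cot (pi * (1 / 2 - real_of_int m) / p))"
        by (simp add: f_def)
    qed
    finally have 2: "(\<Sum>j\<in>?I. f j) = chi p (- 1) * (\<Sum>m\<in>{- int ?h..int ?h}. chi p (k + m) * cot (pi * (1 / 2 - real_of_int m) / p))"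
      by (simp add: sum_distrib_left)
    have "(s0 * sqrt p) * (s0 * sqrt p) = (s0 * s0) * (sqrt p * sqrt p)" by (simp only: mult_ac)
    also have "\<dots> = p" by (simp add: ss)
    finally have "Hp p t * p = (Hp p t * (s0 * sqrt p)) * (s0 * sqrt p)" by (simp only: mult.assoc)
    define T where "T = (\<Sum>m\<in>{- int ?h..int ?h}. chi p (k + m) * cot (pi * (1 / 2 - real_of_int m) / p))"
    have "Hp p t * p = sqrt p * (- s * (-1) powi k * T)"
      unfolding \<open>Hp p t * p = _\<close> 1 f_def[symmetric] 2 s_def T_def by (simp add: algebra_simps)
    then have H: "Hp p t = sqrt p * (- s * (-1) powi k * (T / p))" using p0 by (simp add: field_simps)
    have "(\<Sum>m\<in>{- int ?h..int ?h}. chi p (k + m) * cot_weight p m) = pi * (T / p)"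
      unfolding cot_weight_def T_def sum_divide_distrib sum_distrib_left by (simp add: mult_ac)
    then show ?thesis using p0 unfolding cot_sum_def t_def[symmetric] H by simp
  qed
  with s show ?thesis by blast
qed

section \<open>The characteristic function of the values\<close>

lemma norm_cis_diff_le: "cmod (cis a - cis b) \<le> \<bar>a - b\<bar>"
proof -
  have "cmod (iexp (a - b) - (\<Sum>k\<le>0. (\<i> * (a - b)) ^ k / fact k)) \<le> \<bar>a - b\<bar> ^ Suc 0 / fact (Suc 0)"
    by (rule iexp_approx1)
  then have 1: "cmod (cis (a - b) - 1) \<le> \<bar>a - b\<bar>" by (simp add: cis_conv_exp)
  have "cis a - cis b = cis b * (cis (a - b) - 1)" by (simp add: right_diff_distrib cis_mult)
  then have "cmod (cis a - cis b) = cmod (cis (a - b) - 1)" by (simp add: norm_mult)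
  with 1 show ?thesis by simp
qed

text \<open>The sum depends on \<open>d\<close> only through \<open>p dvd d\<close>, by substituting \<open>d * k\<close> for \<open>k\<close>, and the sum over all \<open>d\<close>
is zero.\<close>

lemma chi_autocorrelation:
  assumes p: "prime p" "p > 2" and d: "\<not> int p dvd d"
  shows "(\<Sum>k = 0..<int p. chi p k * chi p (k + d)) = - 1"
proof -
  define S where "S d = (\<Sum>k = 0..<int p. chi p k * chi p (k + d))" for d
  have p0: "int p > 0" using p by simp
  have S1: "S d = S 1" if "\<not> int p dvd d" for d
  proof -
    have "S d = (\<Sum>k = 0..<int p. chi p (d * k) * chi p (d * k + d))"
      unfolding S_def
      by (rule sum_periodic_mult_invariant[OF p(1) that, symmetric])
        (intro arg_cong2[where f = "(*)"] chi_cong, simp_all add: cong_def mod_simps)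
    also have "\<dots> = (\<Sum>k = 0..<int p. (chi p d * chi p d) * (chi p k * chi p (k + 1)))"
    proof (rule sum.cong[OF refl])
      fix k
      have "chi p (d * k + d) = chi p (d * (k + 1))" by (simp add: algebra_simps)
      then show "chi p (d * k) * chi p (d * k + d) = (chi p d * chi p d) * (chi p k * chi p (k + 1))"
        by (simp only: chi_mult[OF p] mult_ac)
    qed
    also have "chi p d * chi p d = 1" using that chi_eq_0_iff[of p d] chi_cases[of p d] by auto
    finally show ?thesis by (simp add: S_def)
  qed
  have "(\<Sum>d = 0..<int p. S d) = (\<Sum>k = 0..<int p. \<Sum>d = 0..<int p. chi p k * chi p (k + d))"
    unfolding S_def by (rule sum.swap)
  also have "\<dots> = (\<Sum>k = 0..<int p. 0)"
  proof (rule sum.cong[OF refl])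
    fix k
    have "(\<Sum>d = 0..<int p. chi p (k + d)) = (\<Sum>d\<in>{k..<k + int p}. chi p d)"
      by (rule sum.reindex_bij_witness[where i = "\<lambda>x. x - k" and j = "\<lambda>x. k + x"]) auto
    also have "\<dots> = (\<Sum>d = 0..<int p. chi p d)" by (rule sum_periodic_int[OF p0]) simp
    also have "\<dots> = 0" by (rule sum_chi_eq_0[OF p])
    finally show "(\<Sum>d = 0..<int p. chi p k * chi p (k + d)) = 0" by (simp flip: sum_distrib_left)
  qed
  finally have "(\<Sum>d = 0..<int p. S d) = 0" by simp
  moreover have "(\<Sum>d = 0..<int p. S d) = S 0 + (\<Sum>d\<in>{0..<int p} - {0}. S d)"
    using p0 by (intro sum.remove) auto
  moreover have "(\<Sum>d\<in>{0..<int p} - {0}. S d) = (\<Sum>d\<in>{0..<int p} - {0}. S 1)"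
  proof (rule sum.cong[OF refl])
    fix d assume "d \<in> {0..<int p} - {0}"
    then have "\<not> int p dvd d" using zdvd_not_zless by auto
    then show "S d = S 1" by (rule S1)
  qed
  moreover have "S 0 = real p - 1" using sum_chi_square[OF p(1)] by (simp add: S_def power2_eq_square)
  ultimately have "(real p - 1) * (1 + S 1) = 0" using p by (simp add: of_nat_diff algebra_simps)
  then have "S 1 = - 1" using p by auto
  then show ?thesis using S1[OF d] by (simp add: S_def)
qed

text \<open>Orthogonality of the shifts of \<open>chi\<close>. The correlations \<open>-1\<close> are not negligible for large \<open>E\<close>, but together they
contribute \<open>-((\<Sum>m\<in>E. w m)^2) \<le> 0\<close>.\<close>

lemma mean_square_chi_le:
  assumes p: "prime p" "p > 2" and E: "E \<subseteq> {a..<a + int p}"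
  shows "(\<Sum>k = 1..int p. (\<Sum>m\<in>E. chi p (k + m) * w m)\<^sup>2) \<le> p * (\<Sum>m\<in>E. (w m)\<^sup>2)"
proof -
  have p0: "int p > 0" using p by simp
  have fE: "finite E" using E finite_subset by blast
  have corr: "(\<Sum>k = 1..int p. chi p (k + m) * chi p (k + n)) = (if n = m then real p - 1 else - 1)"
    if mn: "m \<in> E" "n \<in> E" for m n
  proof -
    have "(\<Sum>k = 1..int p. chi p (k + m) * chi p (k + n)) = (\<Sum>k\<in>{m + 1..<(m + 1) + int p}. chi p k * chi p (k + (n - m)))"
      by (rule sum.reindex_bij_witness[where i = "\<lambda>x. x - m" and j = "\<lambda>x. x + m"]) (auto simp: algebra_simps)
    also have "\<dots> = (\<Sum>k = 0..<int p. chi p k * chi p (k + (n - m)))"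
      by (rule sum_periodic_int[OF p0])
        (intro arg_cong2[where f = "(*)"] chi_cong, simp_all add: cong_def mod_simps)
    also have "\<dots> = (if n = m then real p - 1 else - 1)"
    proof (cases "n = m")
      case True
      then show ?thesis using sum_chi_square[OF p(1)] by (simp add: power2_eq_square)
    next
      case False
      have "\<not> int p dvd n - m"
      proof
        assume "int p dvd n - m"
        then have "int p \<le> \<bar>n - m\<bar>" using False dvd_imp_le_int[of "n - m" "int p"] by simp
        moreover have "a \<le> m" "m < a + int p" "a \<le> n" "n < a + int p" using mn E by auto
        ultimately show False by linarith
      qed
      then show ?thesis using False chi_autocorrelation[OF p] by simp
    qed
    finally show ?thesis .
  qed
  have "(\<Sum>k = 1..int p. (\<Sum>m\<in>E. chi p (k + m) * w m)\<^sup>2)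
      = (\<Sum>k = 1..int p. \<Sum>m\<in>E. \<Sum>n\<in>E. w m * w n * (chi p (k + m) * chi p (k + n)))"
    by (simp add: power2_eq_square sum_product mult_ac)
  also have "\<dots> = (\<Sum>m\<in>E. \<Sum>n\<in>E. \<Sum>k = 1..int p. w m * w n * (chi p (k + m) * chi p (k + n)))"
    by (subst sum.swap, rule sum.cong[OF refl], rule sum.swap)
  also have "\<dots> = (\<Sum>m\<in>E. \<Sum>n\<in>E. w m * w n * (if n = m then real p - 1 else - 1))"
    by (intro sum.cong refl) (simp add: sum_distrib_left[symmetric] corr)
  also have "\<dots> = (\<Sum>m\<in>E. \<Sum>n\<in>E. (if n = m then real p * (w m)\<^sup>2 else 0) - w m * w n)"
    by (intro sum.cong refl) (auto simp: power2_eq_square algebra_simps)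
  also have "\<dots> = (\<Sum>m\<in>E. real p * (w m)\<^sup>2) - (\<Sum>m\<in>E. w m)\<^sup>2"
    using fE by (simp add: sum_subtractf sum_product power2_eq_square)
  also have "\<dots> \<le> p * (\<Sum>m\<in>E. (w m)\<^sup>2)" by (simp add: sum_distrib_left)
  finally show ?thesis .
qed

definition limit_weight :: "int \<Rightarrow> real" where
  "limit_weight m = 2 / (1 - 2 * real_of_int m)"

text \<open>The set of all \<open>m\<close> with \<open>\<bar>1 - 2*m\<bar> < 2*T\<close>: it is symmetric under \<open>m \<mapsto> 1 - m\<close>, which changes the sign of \<open>limit_weight\<close>.\<close>

definition block :: "nat \<Rightarrow> int set" where
  "block T = {1 - int T..int T}"

lemma finite_block [simp]: "finite (block T)"
  by (simp add: block_def)

lemma block_mono: "S \<le> T \<Longrightarrow> block S \<subseteq> block T"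
  by (auto simp: block_def)

lemma half_minus_int_nonzero: "1 / 2 - real_of_int m \<noteq> 0"
proof
  assume "1 / 2 - real_of_int m = 0"
  then have "real_of_int (2 * m) = real_of_int 1" by simp
  then have "2 * m = 1" by (simp only: of_int_eq_iff)
  then show False by presburger
qed

lemma limit_weight_altdef: "limit_weight m = 1 / (1 / 2 - real_of_int m)"
  using half_minus_int_nonzero[of m] by (simp add: limit_weight_def field_simps)

lemma cot_weight_tendsto: "(\<lambda>p. cot_weight p m) \<longlonglongrightarrow> limit_weight m"
proof -
  define c where "c = pi * (1 / 2 - real_of_int m)"
  have c: "c \<noteq> 0" using half_minus_int_nonzero[of m] by (simp add: c_def)
  have "(\<lambda>p::nat. pi * (cot (c / real p) / real p)) \<longlonglongrightarrow> pi / c"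
  proof -
    have y: "filterlim (\<lambda>p::nat. c / real p) (at 0) sequentially"
    proof (rule filterlim_atI)
      show "(\<lambda>p::nat. c / real p) \<longlonglongrightarrow> 0"
        by (rule tendsto_divide_0[OF tendsto_const]) (rule filterlim_compose[OF filterlim_at_top_imp_at_infinity filterlim_real_sequentially], rule filterlim_ident)
      show "\<forall>\<^sub>F p::nat in sequentially. c / real p \<noteq> 0"
        using eventually_gt_at_top[of 0] by eventually_elim (use c in simp)
    qed
    have "((\<lambda>y::real. sin y / y) \<longlongrightarrow> 1) (at 0)"
      using DERIV_sin[of "0::real"] by (simp add: has_field_derivative_iff)
    then have "((\<lambda>y::real. (1 / (sin y / y)) * cos y) \<longlongrightarrow> (1 / 1) * cos 0) (at 0)"
      by (intro tendsto_mult tendsto_divide tendsto_const isCont_tendsto_compose[OF isCont_cos] tendsto_ident_at) auto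
    then have "(\<lambda>p::nat. (1 / (sin (c / real p) / (c / real p))) * cos (c / real p)) \<longlonglongrightarrow> 1"
      using filterlim_compose[OF _ y] by fastforce
    then have "(\<lambda>p::nat. (pi / c) * ((1 / (sin (c / real p) / (c / real p))) * cos (c / real p))) \<longlonglongrightarrow> (pi / c) * 1"
      by (intro tendsto_mult tendsto_const)
    then show ?thesis using c by (simp add: cot_def field_simps)
  qed
  moreover have "pi / c = limit_weight m"
    using half_minus_int_nonzero[of m] by (simp add: c_def limit_weight_altdef)
  ultimately show ?thesis by (simp add: cot_weight_def c_def)
qed

text \<open>This is \<open>x * cos x \<le> sin x\<close> on \<open>[0, pi/2]\<close>; the difference has derivative \<open>x * sin x\<close>.\<close>

lemma abs_cot_le:
  assumes "x \<noteq> 0" "\<bar>x\<bar> \<le> pi / 2"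
  shows "\<bar>cot x\<bar> \<le> 1 / \<bar>x\<bar>"
proof -
  have pos: "\<bar>cot x\<bar> \<le> 1 / x" if x: "0 < x" "x \<le> pi / 2" for x :: real
  proof -
    have "sin 0 - 0 * cos 0 \<le> sin x - x * cos x"
    proof (rule DERIV_nonneg_imp_nondecreasing[of 0 x "\<lambda>y. sin y - y * cos y"])
      fix y :: real assume y: "0 \<le> y" "y \<le> x"
      have "((\<lambda>y. sin y - y * cos y) has_real_derivative y * sin y) (at y)"
        by (auto intro!: derivative_eq_intros)
      moreover have "y * sin y \<ge> 0" using y x by (intro mult_nonneg_nonneg sin_ge_zero) auto
      ultimately show "\<exists>z. ((\<lambda>y. sin y - y * cos y) has_real_derivative z) (at y) \<and> 0 \<le> z" by blast
    qed (use x in simp)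
    moreover have "sin x > 0" using x by (intro sin_gt_zero) auto
    moreover have "cos x \<ge> 0" using x by (intro cos_ge_zero) auto
    ultimately show ?thesis using x by (simp add: cot_def field_simps)
  qed
  show ?thesis
  proof (cases "x > 0")
    case True
    then show ?thesis using pos[of x] assms by simp
  next
    case False
    moreover have "cot (- x) = - cot x" by (simp add: cot_def)
    ultimately show ?thesis using pos[of "- x"] assms by simp
  qed
qed

lemma abs_cot_weight_le:
  assumes "odd p" "m \<in> {- int ((p - 1) div 2)..int ((p - 1) div 2)}"
  shows "\<bar>cot_weight p m\<bar> \<le> \<bar>limit_weight m\<bar>"
proof -
  define y where "y = 1 / 2 - real_of_int m"
  have p0: "p > 0" using assms(1) by (cases p) auto
  have y0: "y \<noteq> 0" unfolding y_def by (rule half_minus_int_nonzero)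
  have "real p = 2 * real_of_int (int ((p - 1) div 2)) + 1" using assms(1) by (auto elim!: oddE)
  moreover have "real_of_int m \<le> real_of_int (int ((p - 1) div 2))" "- real_of_int (int ((p - 1) div 2)) \<le> real_of_int m"
    using assms(2) by (simp_all only: of_int_le_iff of_int_minus[symmetric] atLeastAtMost_iff)
  ultimately have y: "\<bar>y\<bar> \<le> p / 2" unfolding y_def by linarith
  have "\<bar>pi * y / p\<bar> = pi * \<bar>y\<bar> / p" by (simp add: abs_mult)
  also have "\<dots> \<le> pi * (p / 2) / p" using y by (intro divide_right_mono mult_left_mono) auto
  also have "\<dots> = pi / 2" using p0 by simp
  finally have "\<bar>cot (pi * y / p)\<bar> \<le> 1 / \<bar>pi * y / p\<bar>" using y0 p0 by (intro abs_cot_le) auto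
  then have "(pi / p) * \<bar>cot (pi * y / p)\<bar> \<le> (pi / p) * (1 / \<bar>pi * y / p\<bar>)" by (intro mult_left_mono) auto
  also have "\<dots> = 1 / \<bar>y\<bar>" using y0 p0 by (simp add: abs_mult field_simps)
  finally show ?thesis by (simp add: cot_weight_def limit_weight_altdef abs_mult y_def field_simps)
qed

lemma sum_block_Suc:
  fixes f :: "int \<Rightarrow> 'a :: comm_monoid_add"
  shows "(\<Sum>m\<in>block (Suc T). f m) = (\<Sum>m\<in>block T. f m) + f (- int T) + f (int T + 1)"
proof -
  have "block (Suc T) = insert (- int T) (insert (int T + 1) (block T))" by (auto simp: block_def)
  then show ?thesis by (simp add: block_def add_ac)
qed

lemma prod_block_Suc:
  fixes f :: "int \<Rightarrow> 'a :: comm_monoid_mult"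
  shows "(\<Prod>m\<in>block (Suc T). f m) = (\<Prod>m\<in>block T. f m) * f (- int T) * f (int T + 1)"
proof -
  have "block (Suc T) = insert (- int T) (insert (int T + 1) (block T))" by (auto simp: block_def)
  then show ?thesis by (simp add: block_def mult_ac)
qed

lemma limit_weight_pair:
  "limit_weight (- int n) = 2 / real (2 * n + 1)" "limit_weight (int n + 1) = - (2 / real (2 * n + 1))"
  by (auto simp: limit_weight_def field_simps)

lemma prod_block_even:
  fixes g :: "real \<Rightarrow> 'a :: comm_semiring_1"
  assumes "\<And>x. g (- x) = g x"
  shows "(\<Prod>m\<in>block T. g (limit_weight m)) = (\<Prod>n<T. (g (2 / real (2 * n + 1)))\<^sup>2)"
proof (induction T)
  case 0
  then show ?case by (simp add: block_def)
next
  case (Suc T)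
  show ?case unfolding prod_block_Suc limit_weight_pair Suc assms by (simp add: power2_eq_square mult_ac)
qed

text \<open>Telescoping: \<open>1/(n + 1/2)^2 \<le> 1/(n*(n + 1)) = 1/n - 1/(n + 1)\<close>.\<close>

lemma tail_limit_weight_le:
  assumes T: "T > 0" and E: "finite E" "E \<inter> block T = {}"
  shows "(\<Sum>m\<in>E. (limit_weight m)\<^sup>2) \<le> 2 / T"
proof -
  have "\<exists>N. E \<subseteq> block N"
  proof -
    have "E \<subseteq> block (nat (Max ((\<lambda>m. \<bar>m\<bar>) ` E)) + 1)"
    proof
      fix m assume "m \<in> E"
      then have "\<bar>m\<bar> \<le> Max ((\<lambda>m. \<bar>m\<bar>) ` E)" using E by (intro Max_ge) auto
      then show "m \<in> block (nat (Max ((\<lambda>m. \<bar>m\<bar>) ` E)) + 1)" by (auto simp: block_def)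
    qed
    then show ?thesis by blast
  qed
  then obtain N0 where "E \<subseteq> block N0" by blast
  then obtain N where N: "E \<subseteq> block N" "N \<ge> T"
    using block_mono[of N0 "max N0 T"] by (intro that[of "max N0 T"]) auto
  have sub: "block T \<subseteq> block N" using N(2) by (rule block_mono)
  have "(\<Sum>m\<in>E. (limit_weight m)\<^sup>2) \<le> (\<Sum>m\<in>block N - block T. (limit_weight m)\<^sup>2)"
    using N E by (intro sum_mono2) auto
  also have "\<dots> = (\<Sum>m\<in>block N. (limit_weight m)\<^sup>2) - (\<Sum>m\<in>block T. (limit_weight m)\<^sup>2)"
    using sub by (intro sum_diff) auto
  also have "\<dots> \<le> 2 / T - 2 / N"
    using N(2)
  proof (induction N rule: dec_induct)
    case base
    then show ?case by simp
  next
    case (step N)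
    have N0: "N > 0" using step T by simp
    have "(2 / real (2 * N + 1))\<^sup>2 \<le> 1 / real N - 1 / real (Suc N)"
    proof -
      have "(2 / real (2 * N + 1))\<^sup>2 = 1 / (real N + 1 / 2)\<^sup>2" by (simp add: field_simps power2_eq_square)
      also have "\<dots> \<le> 1 / (real N * (real N + 1))"
        using N0 by (intro divide_left_mono mult_pos_pos) (auto simp: power2_eq_square algebra_simps intro!: add_pos_nonneg)
      also have "\<dots> = 1 / real N - 1 / real (Suc N)" using N0 by (simp add: field_simps)
      finally show ?thesis .
    qed
    moreover have "2 / real N = 2 * (1 / real N)" "2 / real (Suc N) = 2 * (1 / real (Suc N))" by simp_all
    ultimately show ?case using step.IH
      unfolding sum_block_Suc limit_weight_pair power2_minus by linarith
  qed
  also have "\<dots> \<le> 2 / T" by simp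
  finally show ?thesis .
qed


lemma norm_cos_sin_le: "\<bar>y\<bar> \<le> 1 \<Longrightarrow> cmod (complex_of_real (cos t) + \<i> * complex_of_real (y * sin t)) \<le> 1"
proof -
  assume y: "\<bar>y\<bar> \<le> 1"
  have "y\<^sup>2 \<le> 1" using y by (simp add: abs_square_le_1)
  then have "y\<^sup>2 * (sin t)\<^sup>2 \<le> 1 * (sin t)\<^sup>2" by (rule mult_right_mono) simp
  then have "(cos t)\<^sup>2 + (y * sin t)\<^sup>2 \<le> 1" 
    unfolding power_mult_distrib using sin_cos_squared_add[of t] by linarith
  then show ?thesis by (simp add: cmod_def)
qed

lemma cis_sign: "y = 1 \<or> y = -1 \<Longrightarrow> cis (y * t) = complex_of_real (cos t) + \<i> * complex_of_real (y * sin t)"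
  by (auto simp: complex_eq_iff)

text \<open>Only products of the symbols over subsets \<open>X\<close> remain, each with the sign \<open>(-1)^k\<close> raised to the power \<open>card X\<close>.\<close>

lemma sum_sign_product_expansion:
  fixes u :: "int \<Rightarrow> real"
  assumes B: "finite B" and s: "s = 1 \<or> s = (-1::real)"
  shows "(\<Sum>k\<in>K. \<Prod>m\<in>B. complex_of_real (cos (u m)) + \<i> * complex_of_real (s * (-1) powi k * chi p (k + m) * sin (u m)))
    = (\<Sum>X\<in>Pow B. (\<i> * s) ^ card X * (\<Prod>m\<in>X. complex_of_real (sin (u m))) * (\<Prod>m\<in>B - X. complex_of_real (cos (u m)))
        * complex_of_real (\<Sum>k\<in>K. ((-1) ^ card X) powi k * (\<Prod>m\<in>X. chi p (k + m))))"
proof -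
  have "(\<Sum>k\<in>K. \<Prod>m\<in>B. complex_of_real (cos (u m)) + \<i> * complex_of_real (s * (-1) powi k * chi p (k + m) * sin (u m)))
     = (\<Sum>k\<in>K. \<Sum>X\<in>Pow B. (\<Prod>m\<in>X. \<i> * complex_of_real (s * (-1) powi k * chi p (k + m) * sin (u m))) * (\<Prod>m\<in>B - X. complex_of_real (cos (u m))))"
    by (subst add.commute, subst prod_add[OF B]) simp
  also have "\<dots> = (\<Sum>X\<in>Pow B. \<Sum>k\<in>K. (\<Prod>m\<in>X. \<i> * complex_of_real (s * (-1) powi k * chi p (k + m) * sin (u m))) * (\<Prod>m\<in>B - X. complex_of_real (cos (u m))))"
    by (rule sum.swap)
  also have "\<dots> = (\<Sum>X\<in>Pow B. (\<i> * s) ^ card X * (\<Prod>m\<in>X. complex_of_real (sin (u m))) * (\<Prod>m\<in>B - X. complex_of_real (cos (u m)))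
        * complex_of_real (\<Sum>k\<in>K. ((-1) ^ card X) powi k * (\<Prod>m\<in>X. chi p (k + m))))"
  proof (rule sum.cong[OF refl])
    fix X assume "X \<in> Pow B"
    have "(\<Prod>m\<in>X. \<i> * complex_of_real (s * (-1) powi k * chi p (k + m) * sin (u m)))
       = (\<i> * s) ^ card X * (\<Prod>m\<in>X. complex_of_real (sin (u m))) * complex_of_real (((-1) ^ card X) powi k * (\<Prod>m\<in>X. chi p (k + m)))" for k
    proof -
      have "(\<Prod>m\<in>X. \<i> * complex_of_real (s * (-1) powi k * chi p (k + m) * sin (u m)))
        = (\<Prod>m\<in>X. (\<i> * s) * (complex_of_real (sin (u m)) * (complex_of_real ((-1) powi k) * complex_of_real (chi p (k + m)))))"
        by (rule prod.cong[OF refl]) (simp add: mult_ac)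
      also have "\<dots> = (\<i> * s) ^ card X * ((\<Prod>m\<in>X. complex_of_real (sin (u m))) * (complex_of_real ((-1) powi k) ^ card X * (\<Prod>m\<in>X. complex_of_real (chi p (k + m)))))"
        by (simp only: prod.distrib prod_constant power_mult_distrib)
      also have "complex_of_real ((-1) powi k) ^ card X = complex_of_real (((-1) ^ card X) powi k)"
        by (simp only: of_real_power[symmetric] power_int_power power_int_power' mult.commute)
      finally show ?thesis by (simp add: mult_ac)
    qed
    then show "(\<Sum>k\<in>K. (\<Prod>m\<in>X. \<i> * complex_of_real (s * (-1) powi k * chi p (k + m) * sin (u m))) * (\<Prod>m\<in>B - X. complex_of_real (cos (u m))))
      = (\<i> * s) ^ card X * (\<Prod>m\<in>X. complex_of_real (sin (u m))) * (\<Prod>m\<in>B - X. complex_of_real (cos (u m)))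
        * complex_of_real (\<Sum>k\<in>K. ((-1) ^ card X) powi k * (\<Prod>m\<in>X. chi p (k + m)))"
      by (simp only: of_real_sum sum_distrib_left mult_ac)
  qed
  finally show ?thesis .
qed

text \<open>If no \<open>chi(k + m)\<close> vanishes, the exponential is the product of \<open>cos (u m) + \<i> * \<eta> * chi(k + m) * sin (u m)\<close>
with a sign \<open>\<eta>\<close>. Expand this product: the empty subset yields the main term, all others are covered by
\<open>alternating_sum_small\<close>.\<close>

lemma truncated_char_small:
  fixes u :: "int \<Rightarrow> real" and e :: real
  assumes B: "finite B" and e: "e > 0"
  shows "\<forall>\<^sub>F p in sequentially. prime p \<longrightarrow> (\<forall>s. s = 1 \<or> s = -1 \<longrightarrow>
    cmod ((\<Sum>k = 1..int p. cis (s * (-1) powi k * (\<Sum>m\<in>B. chi p (k + m) * u m))) - p * complex_of_real (\<Prod>m\<in>B. cos (u m))) \<le> e * p)"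
    (is "\<forall>\<^sub>F p in _. prime p \<longrightarrow> (\<forall>s. ?P s \<longrightarrow> ?Q p s)")
proof -
  \<comment> \<open>half of the error is for the \<open>2 ^ card B\<close> subsets, the other half for the zeros of \<open>chi\<close>\<close>
  define d where "d = e / 2 / 2 ^ card B"
  have d: "d > 0" using e by (simp add: d_def)
  have "\<forall>\<^sub>F p in sequentially. \<forall>X\<in>Pow B - {{}}. prime p \<longrightarrow>
      \<bar>\<Sum>k = 1..int p. ((-1) ^ card X) powi k * (\<Prod>m\<in>X. chi p (k + m))\<bar> \<le> d * p"
  proof (intro eventually_ball_finite ballI)
    fix X assume "X \<in> Pow B - {{}}"
    then show "\<forall>\<^sub>F p in sequentially. prime p \<longrightarrow>
      \<bar>\<Sum>k = 1..int p. ((-1) ^ card X) powi k * (\<Prod>m\<in>X. chi p (k + m))\<bar> \<le> d * p"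
      using B by (intro alternating_sum_small d) (auto intro: finite_subset simp: minus_one_power_iff)
  qed (use B in auto)
  moreover have "\<forall>\<^sub>F p in sequentially. p \<ge> nat \<lceil>4 * card B / e\<rceil>" by (rule eventually_ge_at_top)
  ultimately show ?thesis
  proof eventually_elim
    case (elim p)
    show ?case
    proof (intro impI allI)
      fix s :: real assume p: "prime p" and s: "s = 1 \<or> s = -1"
      define \<eta> where "\<eta> k = s * (-1) powi k" for k :: int
      have \<eta>: "\<eta> k = 1 \<or> \<eta> k = -1" for k
        using s by (auto simp: \<eta>_def power_int_minus_left)
      define Q where "Q k = (\<Prod>m\<in>B. complex_of_real (cos (u m)) + \<i> * complex_of_real (\<eta> k * chi p (k + m) * sin (u m)))" for k
      define P where "P = complex_of_real (\<Prod>m\<in>B. cos (u m))"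
      let ?K = "{1..int p}" and ?Z = "{k \<in> {1..<1 + int p}. \<exists>m\<in>B. chi p (k + m) = 0}"
      have nQ: "cmod (Q k) \<le> 1" for k
        unfolding Q_def prod_norm[symmetric]
      proof (intro prod_le_1 conjI norm_ge_zero norm_cos_sin_le)
        fix m show "\<bar>\<eta> k * chi p (k + m)\<bar> \<le> 1"
          using \<eta>[of k] abs_chi_le[of p "k + m"] by (auto simp: abs_mult)
      qed
      have "cmod ((\<Sum>k\<in>?K. cis (\<eta> k * (\<Sum>m\<in>B. chi p (k + m) * u m))) - (\<Sum>k\<in>?K. Q k))
        \<le> (\<Sum>k\<in>?K. cmod (cis (\<eta> k * (\<Sum>m\<in>B. chi p (k + m) * u m)) - Q k))"
        unfolding sum_subtractf[symmetric] by (rule norm_sum)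
      also have "\<dots> \<le> (\<Sum>k\<in>?K. if k \<in> ?Z then 2 else 0)"
      proof (rule sum_mono)
        fix k assume k: "k \<in> ?K"
        show "cmod (cis (\<eta> k * (\<Sum>m\<in>B. chi p (k + m) * u m)) - Q k) \<le> (if k \<in> ?Z then 2 else 0)"
        proof (cases "k \<in> ?Z")
          case True
          have "cmod (cis (\<eta> k * (\<Sum>m\<in>B. chi p (k + m) * u m)) - Q k) \<le> 1 + 1"
            using norm_triangle_ineq4[of "cis (\<eta> k * (\<Sum>m\<in>B. chi p (k + m) * u m))" "Q k"] nQ[of k] by simp
          then show ?thesis using True by simp
        next
          case False
          have "cis (\<eta> k * (\<Sum>m\<in>B. chi p (k + m) * u m)) = (\<Prod>m\<in>B. cis (\<eta> k * chi p (k + m) * u m))"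
            using B by (simp add: sum_distrib_left mult.assoc cis_conv_exp exp_sum)
          also have "\<dots> = Q k"
            unfolding Q_def
          proof (rule prod.cong[OF refl])
            fix m assume "m \<in> B"
            then have "chi p (k + m) \<noteq> 0" using False k by auto
            then have "\<eta> k * chi p (k + m) = 1 \<or> \<eta> k * chi p (k + m) = -1"
              using chi_cases[of p "k + m"] \<eta>[of k] by auto
            then show "cis (\<eta> k * chi p (k + m) * u m) = complex_of_real (cos (u m)) + \<i> * complex_of_real (\<eta> k * chi p (k + m) * sin (u m))"
              by (rule cis_sign)
          qed
          finally show ?thesis using False by simp
        qed
      qed
      also have "\<dots> = 2 * card (?K \<inter> ?Z)" by (subst sum.If_cases) (auto intro!: arg_cong[where f = card])
      also have "?K \<inter> ?Z = ?Z" by auto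
      also have "2 * card ?Z \<le> 2 * card B"
        using card_chi_zero_le[OF prime_gt_0_nat[OF p] B, of 1] by simp
      also have "real (2 * card B) \<le> e / 2 * p"
      proof -
        have "4 * card B / e \<le> p" using elim(2) by linarith
        then show ?thesis using e by (simp add: field_simps)
      qed
      finally have 1: "cmod ((\<Sum>k\<in>?K. cis (\<eta> k * (\<Sum>m\<in>B. chi p (k + m) * u m))) - (\<Sum>k\<in>?K. Q k)) \<le> e / 2 * p"
        by simp
      define R where "R X = (\<i> * s) ^ card X * (\<Prod>m\<in>X. complex_of_real (sin (u m))) * (\<Prod>m\<in>B - X. complex_of_real (cos (u m)))
        * complex_of_real (\<Sum>k\<in>?K. ((-1) ^ card X) powi k * (\<Prod>m\<in>X. chi p (k + m)))" for X
      have "(\<Sum>k\<in>?K. Q k) = (\<Sum>X\<in>Pow B. R X)"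
        unfolding Q_def \<eta>_def R_def by (rule sum_sign_product_expansion[OF B s])
      also have "\<dots> = R {} + (\<Sum>X\<in>Pow B - {{}}. R X)" using B by (intro sum.remove) auto
      also have "R {} = p * P" by (simp add: R_def P_def mult.commute)
      finally have "cmod ((\<Sum>k\<in>?K. Q k) - p * P) = cmod (\<Sum>X\<in>Pow B - {{}}. R X)" by simp
      also have "\<dots> \<le> (\<Sum>X\<in>Pow B - {{}}. cmod (R X))" by (rule norm_sum)
      also have "\<dots> \<le> (\<Sum>X\<in>Pow B - {{}}. d * p)"
      proof (rule sum_mono)
        fix X assume X: "X \<in> Pow B - {{}}"
        have a: "cmod ((\<i> * s) ^ card X) = 1" using s by (auto simp: norm_power norm_mult)
        have b: "cmod (\<Prod>m\<in>X. complex_of_real (sin (u m))) \<le> 1"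
          unfolding prod_norm[symmetric] by (intro prod_le_1) auto
        have c: "cmod (\<Prod>m\<in>B - X. complex_of_real (cos (u m))) \<le> 1"
          unfolding prod_norm[symmetric] by (intro prod_le_1) auto
        have "cmod (R X) \<le> 1 * 1 * 1 * \<bar>\<Sum>k\<in>?K. ((-1) ^ card X) powi k * (\<Prod>m\<in>X. chi p (k + m))\<bar>"
          unfolding R_def norm_mult norm_of_real using a b c by (intro mult_mono) auto
        also have "\<dots> \<le> d * p" using elim(1) X p by simp
        finally show "cmod (R X) \<le> d * p" .
      qed
      also have "\<dots> \<le> (\<Sum>X\<in>Pow B. d * p)" using d B by (intro sum_mono2) auto
      also have "\<dots> = e / 2 * p" using B by (simp add: card_Pow d_def)
      finally have "cmod ((\<Sum>k\<in>?K. Q k) - p * P) \<le> e / 2 * p" .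
      with 1 have "cmod ((\<Sum>k\<in>?K. cis (\<eta> k * (\<Sum>m\<in>B. chi p (k + m) * u m))) - p * P) \<le> e / 2 * p + e / 2 * p"
        by (intro norm_diff_triangle_le)
      then show "?Q p s"
        by (simp add: \<eta>_def P_def)
    qed
  qed
qed

lemma sum_abs_le_sqrt:
  fixes f :: "int \<Rightarrow> real"
  assumes "(\<Sum>k = 1..int p. (f k)\<^sup>2) \<le> p * c"
  shows "(\<Sum>k = 1..int p. \<bar>f k\<bar>) \<le> p * sqrt c"
proof -
  have "(\<Sum>k = 1..int p. \<bar>f k\<bar>)\<^sup>2 \<le> (\<Sum>k = 1..int p. 1\<^sup>2) * (\<Sum>k = 1..int p. \<bar>f k\<bar>\<^sup>2)"
    using Cauchy_Schwarz_ineq_sum[of "\<lambda>_. 1" "\<lambda>k. \<bar>f k\<bar>" "{1..int p}"] by simp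
  also have "\<dots> \<le> p * (p * c)" using assms by (simp add: mult_left_mono)
  finally have "sqrt ((\<Sum>k = 1..int p. \<bar>f k\<bar>)\<^sup>2) \<le> sqrt (p * (p * c))" by (rule real_sqrt_le_mono)
  moreover have "sqrt ((\<Sum>k = 1..int p. \<bar>f k\<bar>)\<^sup>2) = (\<Sum>k = 1..int p. \<bar>f k\<bar>)" by (simp add: sum_nonneg)
  ultimately show ?thesis by (simp add: real_sqrt_mult mult.assoc[symmetric])
qed

text \<open>The first error comes from the discarded \<open>m\<close>, in mean square, the second from replacing the finitely
many other weights by their limits.\<close>

lemma cot_sum_truncation_le:
  assumes p: "prime p" "p > 2" and T: "T > 0" "T \<le> (p - 1) div 2" and s: "s = 1 \<or> s = -1"
  shows "(\<Sum>k = 1..int p. \<bar>cot_sum p s k - s * (-1) powi k * (\<Sum>m\<in>block T. chi p (k + m) * limit_weight m)\<bar>)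
    \<le> p * (sqrt (2 / T) + (\<Sum>m\<in>block T. \<bar>cot_weight p m - limit_weight m\<bar>))"
proof -
  let ?I = "{- int ((p - 1) div 2)..int ((p - 1) div 2)}"
  have odd: "odd p" using p prime_odd_nat by blast
  have sub: "block T \<subseteq> ?I" using T by (auto simp: block_def)
  have E: "?I - block T \<subseteq> {- int ((p - 1) div 2)..< - int ((p - 1) div 2) + int p}"
    using odd by (auto elim!: oddE)
  define A where "A k = (\<Sum>m\<in>?I - block T. chi p (k + m) * cot_weight p m)" for k
  define D where "D = (\<Sum>m\<in>block T. \<bar>cot_weight p m - limit_weight m\<bar>)"
  have pt: "\<bar>cot_sum p s k - s * (-1) powi k * (\<Sum>m\<in>block T. chi p (k + m) * limit_weight m)\<bar> \<le> \<bar>A k\<bar> + D" for k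
  proof -
    have split: "(\<Sum>m\<in>?I. chi p (k + m) * cot_weight p m) = A k + (\<Sum>m\<in>block T. chi p (k + m) * cot_weight p m)"
      unfolding A_def by (rule sum.subset_diff[OF sub]) simp
    have "cot_sum p s k - s * (-1) powi k * (\<Sum>m\<in>block T. chi p (k + m) * limit_weight m)
      = (s * (-1) powi k) * (A k + (\<Sum>m\<in>block T. chi p (k + m) * (cot_weight p m - limit_weight m)))"
      unfolding cot_sum_def split by (simp add: algebra_simps sum_subtractf)
    then have "\<bar>cot_sum p s k - s * (-1) powi k * (\<Sum>m\<in>block T. chi p (k + m) * limit_weight m)\<bar>
       = \<bar>s * (-1) powi k\<bar> * \<bar>A k + (\<Sum>m\<in>block T. chi p (k + m) * (cot_weight p m - limit_weight m))\<bar>"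
      by (simp only: abs_mult)
    also have "\<bar>s * (-1) powi k\<bar> = 1" using s abs_powi_unit[of "-1" k] by (auto simp: abs_mult)
    also have "1 * \<bar>A k + (\<Sum>m\<in>block T. chi p (k + m) * (cot_weight p m - limit_weight m))\<bar>
      \<le> \<bar>A k\<bar> + \<bar>\<Sum>m\<in>block T. chi p (k + m) * (cot_weight p m - limit_weight m)\<bar>" by (simp add: abs_triangle_ineq)
    also have "\<bar>\<Sum>m\<in>block T. chi p (k + m) * (cot_weight p m - limit_weight m)\<bar> \<le> (\<Sum>m\<in>block T. \<bar>chi p (k + m) * (cot_weight p m - limit_weight m)\<bar>)"
      by (rule sum_abs)
    also have "\<dots> \<le> D" unfolding D_def
    proof (rule sum_mono)
      fix m show "\<bar>chi p (k + m) * (cot_weight p m - limit_weight m)\<bar> \<le> \<bar>cot_weight p m - limit_weight m\<bar>"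
        using abs_chi_le[of p "k + m"] by (simp add: abs_mult mult_left_le_one_le)
    qed
    finally show ?thesis by simp
  qed
  have "(\<Sum>k = 1..int p. (A k)\<^sup>2) \<le> p * (\<Sum>m\<in>?I - block T. (cot_weight p m)\<^sup>2)"
    unfolding A_def by (rule mean_square_chi_le[OF p E])
  also have "(\<Sum>m\<in>?I - block T. (cot_weight p m)\<^sup>2) \<le> (\<Sum>m\<in>?I - block T. (limit_weight m)\<^sup>2)"
    by (intro sum_mono) (use abs_cot_weight_le[OF odd] in \<open>auto simp: abs_le_square_iff\<close>)
  also have "\<dots> \<le> 2 / T" by (rule tail_limit_weight_le[OF T(1)]) auto
  finally have "(\<Sum>k = 1..int p. (A k)\<^sup>2) \<le> p * (2 / T)" by (simp add: mult_left_mono)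
  then have "(\<Sum>k = 1..int p. \<bar>A k\<bar>) \<le> p * sqrt (2 / T)" by (rule sum_abs_le_sqrt)
  moreover have "(\<Sum>k = 1..int p. \<bar>cot_sum p s k - s * (-1) powi k * (\<Sum>m\<in>block T. chi p (k + m) * limit_weight m)\<bar>)
     \<le> (\<Sum>k = 1..int p. \<bar>A k\<bar> + D)" by (intro sum_mono pt)
  ultimately show ?thesis by (simp add: sum.distrib D_def algebra_simps)
qed

theorem char_cot_sum_tendsto:
  fixes x \<phi> e :: real
  assumes \<phi>: "(\<lambda>T. \<Prod>n<T. (cos (2 * x / real (2 * n + 1)))\<^sup>2) \<longlonglongrightarrow> \<phi>" and e: "e > 0"
  shows "\<forall>\<^sub>F p in sequentially. prime p \<longrightarrow> (\<forall>s. s = 1 \<or> s = -1 \<longrightarrow>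
    cmod ((\<Sum>k = 1..int p. cis (x * cot_sum p s k)) / p - complex_of_real \<phi>) \<le> e)"
proof -
  have "(\<lambda>T. \<bar>x\<bar> * sqrt (2 / real T)) \<longlonglongrightarrow> 0" by real_asymp
  then have "\<forall>\<^sub>F T in sequentially. \<bar>x\<bar> * sqrt (2 / real T) < e / 4"
    by (rule order_tendstoD) (use e in simp)
  moreover have "\<forall>\<^sub>F T in sequentially. dist (\<Prod>n<T. (cos (2 * x / real (2 * n + 1)))\<^sup>2) \<phi> < e / 4"
    using \<phi> e by (intro tendstoD) auto
  moreover have "\<forall>\<^sub>F T in sequentially. T > 0" by (rule eventually_gt_at_top)
  ultimately have "\<forall>\<^sub>F T in sequentially. \<bar>x\<bar> * sqrt (2 / real T) < e / 4 \<and> dist (\<Prod>n<T. (cos (2 * x / real (2 * n + 1)))\<^sup>2) \<phi> < e / 4 \<and> T > 0"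
    by eventually_elim auto
  then obtain T where T: "\<bar>x\<bar> * sqrt (2 / real T) < e / 4" "dist (\<Prod>n<T. (cos (2 * x / real (2 * n + 1)))\<^sup>2) \<phi> < e / 4" "T > 0"
    by (auto simp: eventually_sequentially)
  define \<phi>T where "\<phi>T = (\<Prod>n<T. (cos (2 * x / real (2 * n + 1)))\<^sup>2)"
  have \<phi>T: "\<phi>T = (\<Prod>m\<in>block T. cos (x * limit_weight m))"
    using prod_block_even[of "\<lambda>y. cos (x * y)" T] by (simp add: \<phi>T_def mult.commute)
  have "(\<lambda>p. \<bar>x\<bar> * (\<Sum>m\<in>block T. \<bar>cot_weight p m - limit_weight m\<bar>)) \<longlonglongrightarrow> \<bar>x\<bar> * (\<Sum>m\<in>block T. \<bar>limit_weight m - limit_weight m\<bar>)"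
    by (intro tendsto_intros cot_weight_tendsto)
  then have "\<forall>\<^sub>F p in sequentially. \<bar>x\<bar> * (\<Sum>m\<in>block T. \<bar>cot_weight p m - limit_weight m\<bar>) < e / 4"
    by (rule order_tendstoD) (use e in simp)
  moreover have "\<forall>\<^sub>F p in sequentially. prime p \<longrightarrow> (\<forall>s. s = 1 \<or> s = -1 \<longrightarrow>
    cmod ((\<Sum>k = 1..int p. cis (s * (-1) powi k * (\<Sum>m\<in>block T. chi p (k + m) * (x * limit_weight m)))) - p * complex_of_real (\<Prod>m\<in>block T. cos (x * limit_weight m))) \<le> e / 4 * p)"
    by (rule truncated_char_small) (use e in auto)
  moreover have "\<forall>\<^sub>F p in sequentially. p > 2 * T + 2" by (rule eventually_gt_at_top)
  ultimately show ?thesis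
  proof eventually_elim
    case (elim p)
    show ?case
    proof (intro impI allI)
      fix s :: real assume p: "prime p" and s: "s = 1 \<or> s = -1"
      have p2: "p > 2" and Tp: "T \<le> (p - 1) div 2" using elim(3) by auto
      let ?K = "{1..int p}"
      define Z where "Z k = s * (-1) powi k * (\<Sum>m\<in>block T. chi p (k + m) * limit_weight m)" for k
      define D where "D = (\<Sum>m\<in>block T. \<bar>cot_weight p m - limit_weight m\<bar>)"
      have "cmod ((\<Sum>k\<in>?K. cis (x * cot_sum p s k)) - (\<Sum>k\<in>?K. cis (x * Z k)))
         \<le> (\<Sum>k\<in>?K. cmod (cis (x * cot_sum p s k) - cis (x * Z k)))"
        unfolding sum_subtractf[symmetric] by (rule norm_sum)
      also have "\<dots> \<le> (\<Sum>k\<in>?K. \<bar>x\<bar> * \<bar>cot_sum p s k - Z k\<bar>)"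
      proof (rule sum_mono)
        fix k show "cmod (cis (x * cot_sum p s k) - cis (x * Z k)) \<le> \<bar>x\<bar> * \<bar>cot_sum p s k - Z k\<bar>"
          using norm_cis_diff_le[of "x * cot_sum p s k" "x * Z k"] by (simp add: right_diff_distrib[symmetric] abs_mult)
      qed
      also have "\<dots> = \<bar>x\<bar> * (\<Sum>k\<in>?K. \<bar>cot_sum p s k - Z k\<bar>)" by (simp add: sum_distrib_left)
      also have "\<dots> \<le> \<bar>x\<bar> * (p * (sqrt (2 / T) + D))"
        unfolding Z_def D_def by (intro mult_left_mono cot_sum_truncation_le p p2 T Tp s) simp
      also have "\<dots> = p * (\<bar>x\<bar> * sqrt (2 / T) + \<bar>x\<bar> * D)" by (simp add: algebra_simps)
      also have "\<dots> \<le> p * (e / 4 + e / 4)"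
        using T(1) elim(1) unfolding D_def by (intro mult_left_mono add_mono) auto
      finally have 1: "cmod ((\<Sum>k\<in>?K. cis (x * cot_sum p s k)) - (\<Sum>k\<in>?K. cis (x * Z k))) \<le> p * (e / 2)" by simp
      have xZ: "x * Z k = s * (-1) powi k * (\<Sum>m\<in>block T. chi p (k + m) * (x * limit_weight m))" for k
        by (simp add: Z_def sum_distrib_left mult_ac)
      have 2: "cmod ((\<Sum>k\<in>?K. cis (x * Z k)) - p * complex_of_real \<phi>T) \<le> p * (e / 4)"
        using elim(2)[rule_format, OF p s] unfolding \<phi>T xZ mult.commute[of "e / 4"] .
      have "cmod (p * complex_of_real \<phi>T - p * complex_of_real \<phi>) = p * \<bar>\<phi>T - \<phi>\<bar>"
        unfolding right_diff_distrib[symmetric] norm_mult of_real_diff[symmetric] norm_of_real by simp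
      also have "\<dots> \<le> p * (e / 4)" using T(2) unfolding \<phi>T_def dist_real_def by (intro mult_left_mono) auto
      finally have 3: "cmod (p * complex_of_real \<phi>T - p * complex_of_real \<phi>) \<le> p * (e / 4)" .
      have "cmod ((\<Sum>k\<in>?K. cis (x * cot_sum p s k)) - p * complex_of_real \<phi>) \<le> p * (e / 2) + (p * (e / 4) + p * (e / 4))"
        by (intro norm_diff_triangle_le[OF 1] norm_diff_triangle_le[OF 2 3])
      then have "cmod ((\<Sum>k\<in>?K. cis (x * cot_sum p s k)) - p * complex_of_real \<phi>) \<le> p * e" by (simp add: algebra_simps)
      moreover have "(\<Sum>k\<in>?K. cis (x * cot_sum p s k)) / p - complex_of_real \<phi> = ((\<Sum>k\<in>?K. cis (x * cot_sum p s k)) - p * complex_of_real \<phi>) / p"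
        using p2 by (simp add: diff_divide_distrib)
      ultimately show "cmod ((\<Sum>k\<in>?K. cis (x * cot_sum p s k)) / p - complex_of_real \<phi>) \<le> e"
        using p2 by (simp add: norm_divide pos_divide_le_eq mult.commute)
    qed
  qed
qed

section \<open>Finite sections of the random model\<close>

text \<open>The law of \<open>f\<close> at a uniformly random element of \<open>A\<close>.\<close>

definition empirical :: "'a set \<Rightarrow> ('a \<Rightarrow> real) \<Rightarrow> real measure" where
  "empirical A f = distr (measure_pmf (pmf_of_set A)) borel f"

context
  fixes A :: "'a set" and f :: "'a \<Rightarrow> real"
  assumes A: "finite A" "A \<noteq> {}"
begin

lemma real_distribution_empirical: "real_distribution (empirical A f)"
  unfolding empirical_def by (intro prob_space.real_distribution_distr[OF measure_pmf.prob_space_axioms]) simp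

lemma measure_empirical:
  assumes "S \<in> sets borel"
  shows "measure (empirical A f) S = card {a \<in> A. f a \<in> S} / card A"
proof -
  have "measure (empirical A f) S = measure (measure_pmf (pmf_of_set A)) (f -` S)"
    unfolding empirical_def using assms by (subst measure_distr) auto
  also have "\<dots> = card (A \<inter> f -` S) / card A" by (rule measure_pmf_of_set[OF A(2,1)])
  also have "A \<inter> f -` S = {a \<in> A. f a \<in> S}" by auto
  finally show ?thesis .
qed

lemma char_empirical: "char (empirical A f) t = (\<Sum>a\<in>A. cis (t * f a)) / card A"
proof -
  have "char (empirical A f) t = (CLINT a|measure_pmf (pmf_of_set A). iexp (t * f a))"
    unfolding char_def empirical_def by (subst integral_distr) auto
  also have "\<dots> = (\<Sum>a\<in>A. pmf (pmf_of_set A) a *\<^sub>R iexp (t * f a))"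
    by (rule integral_measure_pmf[OF A(1)]) (use A in \<open>auto simp: set_pmf_of_set\<close>)
  also have "\<dots> = (\<Sum>a\<in>A. cis (t * f a)) / card A"
    using A by (simp add: cis_conv_exp scaleR_conv_of_real sum_divide_distrib)
  finally show ?thesis .
qed

end

text \<open>Sign patterns on \<open>B\<close> are encoded by the set \<open>X\<close> of indices with sign \<open>+1\<close>.\<close>

definition signed_sum :: "(int \<Rightarrow> real) \<Rightarrow> int set \<Rightarrow> int set \<Rightarrow> real" where
  "signed_sum v B X = (\<Sum>m\<in>X. v m) - (\<Sum>m\<in>B - X. v m)"

lemma signed_sum_compl:
  assumes "X \<subseteq> B" shows "signed_sum v B (B - X) = - signed_sum v B X"
  using assms by (simp add: signed_sum_def double_diff)

text \<open>Independence of the signs, for exponentials \<open>h\<close>: real ones give moment generating functions, complex ones characteristic functions.\<close>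

lemma sum_hom_signed_sum:
  fixes h :: "real \<Rightarrow> 'c :: field"
  assumes B: "finite B" and h: "\<And>x y. h (x + y) = h x * h y" "h 0 = 1"
  shows "(\<Sum>X\<in>Pow B. h (signed_sum v B X)) = (\<Prod>m\<in>B. h (v m) + h (- v m))"
proof -
  have hs: "h (\<Sum>m\<in>X. g m) = (\<Prod>m\<in>X. h (g m))" if "finite X" for X :: "int set" and g
    using that by (induction X rule: finite_induct) (simp_all add: h)
  have "(\<Prod>m\<in>B. h (v m) + h (- v m)) = (\<Sum>X\<in>Pow B. (\<Prod>m\<in>X. h (v m)) * (\<Prod>m\<in>B - X. h (- v m)))"
    by (rule prod_add[OF B])
  also have "\<dots> = (\<Sum>X\<in>Pow B. h (signed_sum v B X))"
  proof (rule sum.cong[OF refl])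
    fix X assume "X \<in> Pow B"
    then have f: "finite X" "finite (B - X)" using B finite_subset by auto
    have "signed_sum v B X = (\<Sum>m\<in>X. v m) + (\<Sum>m\<in>B - X. - v m)" by (simp add: signed_sum_def sum_negf)
    then show "(\<Prod>m\<in>X. h (v m)) * (\<Prod>m\<in>B - X. h (- v m)) = h (signed_sum v B X)"
      by (simp add: h hs[OF f(1)] hs[OF f(2)])
  qed
  finally show ?thesis ..
qed

definition tail_count :: "(int \<Rightarrow> real) \<Rightarrow> int set \<Rightarrow> real \<Rightarrow> nat" where
  "tail_count v B r = card {X \<in> Pow B. signed_sum v B X \<ge> r}"

text \<open>The sign of a new index is chosen equal to that of its weight.\<close>

lemma tail_count_insert_ge:
  assumes B: "finite B" "m \<notin> B"
  shows "tail_count v B r \<le> tail_count v (insert m B) (r + \<bar>v m\<bar>)"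
proof -
  define g where "g X = (if v m \<ge> 0 then insert m X else X)" for X
  have "inj_on g {X \<in> Pow B. signed_sum v B X \<ge> r}"
    using B(2) by (auto simp: inj_on_def g_def split: if_splits)
  moreover have "g ` {X \<in> Pow B. signed_sum v B X \<ge> r} \<subseteq> {X \<in> Pow (insert m B). signed_sum v (insert m B) X \<ge> r + \<bar>v m\<bar>}"
  proof safe
    fix X assume X: "X \<subseteq> B" "signed_sum v B X \<ge> r"
    have fX: "finite X" "m \<notin> X" using X B finite_subset by auto
    show "signed_sum v (insert m B) (g X) \<ge> r + \<bar>v m\<bar>"
    proof (cases "v m \<ge> 0")
      case True
      have "insert m B - insert m X = B - X" using B by auto
      then show ?thesis using True X fX by (simp add: g_def signed_sum_def)
    next
      case False
      have "insert m B - X = insert m (B - X)" using fX by auto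
      then show ?thesis using False X B by (simp add: g_def signed_sum_def)
    qed
    fix x assume "x \<in> g X" "x \<notin> B"
    then show "x = m" using X by (auto simp: g_def split: if_splits)
  qed
  moreover have "finite {X \<in> Pow (insert m B). signed_sum v (insert m B) X \<ge> r + \<bar>v m\<bar>}" using B by simp
  ultimately show ?thesis unfolding tail_count_def by (rule card_inj_on_le)
qed

lemma tail_count_union_ge:
  assumes "finite C" "finite B" "B \<inter> C = {}"
  shows "tail_count v B r \<le> tail_count v (B \<union> C) (r + (\<Sum>m\<in>C. \<bar>v m\<bar>))"
  using assms
proof (induction C rule: finite_induct)
  case empty
  then show ?case by simp
next
  case (insert m C)
  have "tail_count v B r \<le> tail_count v (B \<union> C) (r + (\<Sum>m\<in>C. \<bar>v m\<bar>))" using insert by auto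
  also have "\<dots> \<le> tail_count v (insert m (B \<union> C)) (r + (\<Sum>m\<in>C. \<bar>v m\<bar>) + \<bar>v m\<bar>)"
    using insert by (intro tail_count_insert_ge) auto
  finally show ?case using insert by (simp add: add_ac)
qed

lemma card_Pow_reflect:
  assumes "finite B"
  shows "card {X \<in> Pow B. signed_sum v B X \<in> S} = card {X \<in> Pow B. - signed_sum v B X \<in> S}"
proof (rule bij_betw_same_card)
  show "bij_betw (\<lambda>X. B - X) {X \<in> Pow B. signed_sum v B X \<in> S} {X \<in> Pow B. - signed_sum v B X \<in> S}"
    by (rule bij_betwI[where g = "\<lambda>X. B - X"]) (auto simp: signed_sum_compl)
qed

text \<open>By symmetry, at least half of all sums are nonnegative.\<close>

lemma tail_count_0_ge:
  assumes "finite B"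
  shows "2 ^ card B \<le> 2 * tail_count v B 0"
proof -
  have "2 ^ card B = card (Pow B)" using assms by (simp add: card_Pow)
  also have "\<dots> \<le> card ({X \<in> Pow B. signed_sum v B X \<in> {0..}} \<union> {X \<in> Pow B. - signed_sum v B X \<in> {0..}})"
    using assms by (intro card_mono) auto
  also have "\<dots> \<le> card {X \<in> Pow B. signed_sum v B X \<in> {0..}} + card {X \<in> Pow B. - signed_sum v B X \<in> {0..}}"
    by (rule card_Un_le)
  also have "\<dots> = 2 * tail_count v B 0"
    using card_Pow_reflect[OF assms, of v "{0..}"] by (simp add: tail_count_def)
  finally show ?thesis .
qed

text \<open>Fix the signs on \<open>C\<close> in the favourable way and let the other terms have a nonnegative sum.\<close>

lemma tail_count_lower:
  assumes "finite B" "C \<subseteq> B" "r \<le> (\<Sum>m\<in>C. \<bar>v m\<bar>)"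
  shows "2 ^ card B \<le> 2 * 2 ^ card C * tail_count v B r"
proof -
  have fC: "finite C" using assms finite_subset by blast
  have "2 ^ card (B - C) \<le> 2 * tail_count v (B - C) 0" using assms by (intro tail_count_0_ge) auto
  also have "tail_count v (B - C) 0 \<le> tail_count v (B - C \<union> C) (0 + (\<Sum>m\<in>C. \<bar>v m\<bar>))"
    using assms fC by (intro tail_count_union_ge) auto
  also have "B - C \<union> C = B" using assms by auto
  also have "tail_count v B (0 + (\<Sum>m\<in>C. \<bar>v m\<bar>)) \<le> tail_count v B r"
    unfolding tail_count_def using assms by (intro card_mono) auto
  finally have "2 ^ card (B - C) \<le> 2 * tail_count v B r" by simp
  then have "2 ^ card C * 2 ^ card (B - C) \<le> 2 ^ card C * (2 * tail_count v B r)" by simp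
  also have "(2::nat) ^ card C * 2 ^ card (B - C) = 2 ^ card B"
    using card_Diff_subset[OF fC assms(2)] card_mono[OF assms(1,2)] by (simp flip: power_add)
  finally show ?thesis by (simp add: mult_ac)
qed

lemma cosh_le_exp_abs: "cosh y \<le> exp \<bar>y::real\<bar>"
proof -
  have "exp y \<le> exp \<bar>y\<bar>" "exp (- y) \<le> exp \<bar>y\<bar>" by simp_all
  moreover have "a \<le> c \<Longrightarrow> b \<le> c \<Longrightarrow> (a + b) / 2 \<le> c" for a b c :: real by (simp add: field_simps)
  ultimately show ?thesis unfolding cosh_field_def by blast
qed

text \<open>The logarithmic derivative of the left side is \<open>tanh y \<le> y\<close>.\<close>

lemma cosh_le_exp_square: "cosh y \<le> exp ((y::real)\<^sup>2 / 2)"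
proof -
  have mono: "cosh y \<le> exp (y\<^sup>2 / 2)" if "y \<ge> 0" for y :: real
  proof -
    have s: "sinh x \<le> x * cosh x" if "x \<ge> 0" for x :: real
    proof -
      have "0 * cosh 0 - sinh 0 \<le> x * cosh x - sinh x"
      proof (rule DERIV_nonneg_imp_nondecreasing[of 0 x "\<lambda>x. x * cosh x - sinh x"])
        fix z :: real assume z: "0 \<le> z" "z \<le> x"
        have "((\<lambda>x. x * cosh x - sinh x) has_real_derivative z * sinh z) (at z)"
          by (auto intro!: derivative_eq_intros)
        moreover have "z * sinh z \<ge> 0" using z by simp
        ultimately show "\<exists>d. ((\<lambda>x. x * cosh x - sinh x) has_real_derivative d) (at z) \<and> 0 \<le> d" by blast
      qed (use that in simp)
      then show ?thesis by simp
    qed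
    have "ln (cosh y) - y\<^sup>2 / 2 \<le> ln (cosh 0) - 0\<^sup>2 / 2"
    proof (rule DERIV_nonpos_imp_nonincreasing[of 0 y "\<lambda>y. ln (cosh y) - y\<^sup>2 / 2"])
      fix z :: real assume z: "0 \<le> z" "z \<le> y"
      have "((\<lambda>y. ln (cosh y) - y\<^sup>2 / 2) has_real_derivative (sinh z / cosh z - z)) (at z)"
        by (auto intro!: derivative_eq_intros simp: cosh_real_pos)
      moreover have "sinh z / cosh z - z \<le> 0" using s[of z] z cosh_real_pos[of z] by (simp add: field_simps)
      ultimately show "\<exists>d. ((\<lambda>y. ln (cosh y) - y\<^sup>2 / 2) has_real_derivative d) (at z) \<and> d \<le> 0" by blast
    qed (use that in simp)
    then have "ln (cosh y) \<le> y\<^sup>2 / 2" by simp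
    then have "exp (ln (cosh y)) \<le> exp (y\<^sup>2 / 2)" by (simp only: exp_le_cancel_iff)
    then show ?thesis unfolding exp_ln[OF cosh_real_pos] .
  qed
  show ?thesis using mono[of "\<bar>y\<bar>"] by simp
qed

text \<open>Markov's inequality for exponential moments.\<close>

lemma tail_count_chernoff:
  assumes B: "finite B" and s: "s \<ge> 0"
  shows "real (tail_count v B r) \<le> 2 ^ card B * exp (- s * r) * (\<Prod>m\<in>B. cosh (s * v m))"
proof -
  have "real (tail_count v B r) = (\<Sum>X\<in>{X \<in> Pow B. signed_sum v B X \<ge> r}. 1)" by (simp add: tail_count_def)
  also have "\<dots> \<le> (\<Sum>X\<in>{X \<in> Pow B. signed_sum v B X \<ge> r}. exp (- s * r) * exp (s * signed_sum v B X))"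
  proof (rule sum_mono)
    fix X assume "X \<in> {X \<in> Pow B. signed_sum v B X \<ge> r}"
    then have "s * r \<le> s * signed_sum v B X" using s by (intro mult_left_mono) auto
    then show "1 \<le> exp (- s * r) * exp (s * signed_sum v B X)" by (simp flip: exp_add)
  qed
  also have "\<dots> \<le> (\<Sum>X\<in>Pow B. exp (- s * r) * exp (s * signed_sum v B X))"
    using B by (intro sum_mono2) auto
  also have "\<dots> = exp (- s * r) * (\<Prod>m\<in>B. exp (s * v m) + exp (s * (- v m)))"
    using sum_hom_signed_sum[OF B, of "\<lambda>x. exp (s * x)" v]
    by (simp add: sum_distrib_left[symmetric] distrib_left exp_add)
  also have "(\<Prod>m\<in>B. exp (s * v m) + exp (s * (- v m))) = (\<Prod>m\<in>B. 2 * cosh (s * v m))"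
    by (rule prod.cong[OF refl]) (simp add: cosh_field_def)
  also have "\<dots> = 2 ^ card B * (\<Prod>m\<in>B. cosh (s * v m))" by (simp add: prod.distrib)
  finally show ?thesis by (simp add: mult_ac)
qed

definition odd_harm :: "nat \<Rightarrow> real" where
  "odd_harm N = (\<Sum>n<N. 1 / real (2 * n + 1))"

text \<open>Telescoping with \<open>1/(2*n + 1) \<le> 1/(2*n) \<le> (ln n - ln (n - 1))/2\<close>. The shifted form proved first
avoids the logarithm of zero.\<close>

lemma odd_harm_upper:
  assumes "N > 0" shows "odd_harm N \<le> 2 + ln N / 2"
proof -
  have *: "odd_harm (Suc N) \<le> 2 + ln N / 2" if "N > 0" for N
    using that
  proof (induction N rule: nat_induct_non_zero)
    case 1
    then show ?case by (simp add: odd_harm_def)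
  next
    case (Suc N)
    have "ln (N / Suc N) \<le> N / Suc N - 1" using Suc by (intro ln_le_minus_one) auto
    also have "\<dots> = - 1 / Suc N" by (simp add: field_simps)
    finally have "ln N - ln (Suc N) \<le> - (1 / Suc N)" using Suc by (simp add: ln_div)
    moreover have "1 / real (2 * Suc N + 1) \<le> (1 / Suc N) / 2" by (simp add: field_simps)
    moreover have "x - y \<le> - c \<Longrightarrow> d \<le> c / 2 \<Longrightarrow> h \<le> 2 + x / 2 \<Longrightarrow> h + d \<le> 2 + y / 2" for x y c d h :: real
      by linarith
    ultimately have "odd_harm (Suc N) + 1 / real (2 * Suc N + 1) \<le> 2 + ln (Suc N) / 2"
      using Suc.IH by blast
    then show ?case by (simp only: odd_harm_def sum.lessThan_Suc[of _ "Suc N"])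
  qed
  obtain n where n: "N = Suc n" using assms gr0_implies_Suc by blast
  show ?thesis
  proof (cases "n = 0")
    case True
    then show ?thesis by (simp add: n odd_harm_def)
  next
    case False
    then have "odd_harm N \<le> 2 + ln n / 2" using *[of n] n by simp
    also have "ln (real n) \<le> ln (real N)" using False n by simp
    finally show ?thesis by simp
  qed
qed

lemma odd_harm_lower: "ln (real N + 1) / 2 \<le> odd_harm N"
proof (induction N)
  case 0
  then show ?case by (simp add: odd_harm_def)
next
  case (Suc N)
  have "ln ((real N + 2) / (real N + 1)) \<le> (real N + 2) / (real N + 1) - 1"
    by (intro ln_le_minus_one) auto
  also have "\<dots> = 1 / (real N + 1)" by (simp add: field_simps)
  finally have "ln (real N + 2) - ln (real N + 1) \<le> 1 / (real N + 1)" by (simp add: ln_div)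
  moreover have "(1 / (real N + 1)) / 2 \<le> 1 / real (2 * N + 1)" by (simp add: field_simps)
  moreover have "y - x \<le> c \<Longrightarrow> c / 2 \<le> d \<Longrightarrow> x / 2 \<le> h \<Longrightarrow> y / 2 \<le> h + d" for x y c d h :: real
    by linarith
  ultimately have "ln (real N + 2) / 2 \<le> odd_harm N + 1 / real (2 * N + 1)" using Suc.IH by blast
  moreover have "real (Suc N) + 1 = real N + 2" by simp
  ultimately show ?case by (simp only: odd_harm_def sum.lessThan_Suc[of _ N])
qed

lemma sum_abs_limit_weight: "(\<Sum>m\<in>block N. \<bar>limit_weight m\<bar>) = 4 * odd_harm N"
proof (induction N)
  case 0
  then show ?case by (simp add: block_def odd_harm_def)
next
  case (Suc N)
  then show ?case unfolding sum_block_Suc limit_weight_pair by (simp add: odd_harm_def)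
qed

lemma card_block: "card (block T) = 2 * T"
  by (simp add: block_def)

text \<open>The parameter of the exponential moment is the integer \<open>N\<close>: the weights in \<open>block N\<close>, which exceed \<open>1/N\<close>
in absolute value, are estimated by \<open>exp \<bar>y\<bar>\<close> and produce the logarithm; the others are estimated
by \<open>exp (y^2/2)\<close>.\<close>

lemma prod_cosh_limit_weight_le:
  assumes N: "N > 0"
  shows "(\<Prod>m\<in>block T. cosh (real N * limit_weight m)) \<le> exp (N * (9 + 2 * ln N))"
proof -
  let ?c = "\<lambda>m. cosh (real N * limit_weight m)"
  have "(\<Prod>m\<in>block T. ?c m) = (\<Prod>m\<in>block T \<inter> block N. ?c m) * (\<Prod>m\<in>block T - block N. ?c m)"
    by (rule prod.Int_Diff) simp
  also have "\<dots> \<le> (\<Prod>m\<in>block T \<inter> block N. exp \<bar>real N * limit_weight m\<bar>) * (\<Prod>m\<in>block T - block N. exp ((real N * limit_weight m)\<^sup>2 / 2))"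
    by (intro mult_mono prod_mono prod_nonneg conjI cosh_le_exp_abs cosh_le_exp_square) auto
  also have "\<dots> = exp ((\<Sum>m\<in>block T \<inter> block N. \<bar>real N * limit_weight m\<bar>) + (\<Sum>m\<in>block T - block N. (real N * limit_weight m)\<^sup>2 / 2))"
    by (simp add: exp_add exp_sum)
  also have "\<dots> \<le> exp (N * (9 + 2 * ln N))"
  proof -
    have "(\<Sum>m\<in>block T \<inter> block N. \<bar>real N * limit_weight m\<bar>) \<le> (\<Sum>m\<in>block N. \<bar>real N * limit_weight m\<bar>)"
      by (intro sum_mono2) auto
    also have "\<dots> = N * (4 * odd_harm N)" by (simp add: abs_mult sum_distrib_left[symmetric] sum_abs_limit_weight)
    also have "\<dots> \<le> N * (4 * (2 + ln N / 2))" using odd_harm_upper[OF N] by (intro mult_left_mono) auto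
    finally have 1: "(\<Sum>m\<in>block T \<inter> block N. \<bar>real N * limit_weight m\<bar>) \<le> N * (4 * (2 + ln N / 2))" .
    have "(\<Sum>m\<in>block T - block N. (real N * limit_weight m)\<^sup>2 / 2) = N\<^sup>2 / 2 * (\<Sum>m\<in>block T - block N. (limit_weight m)\<^sup>2)"
      by (simp add: power_mult_distrib sum_distrib_left)
    also have "\<dots> \<le> N\<^sup>2 / 2 * (2 / N)"
      by (intro mult_left_mono tail_limit_weight_le N) auto
    also have "\<dots> = N" using N by (simp add: power2_eq_square)
    finally have "(\<Sum>m\<in>block T - block N. (real N * limit_weight m)\<^sup>2 / 2) \<le> N" .
    with 1 show ?thesis by (simp add: algebra_simps)
  qed
  finally show ?thesis .
qed

text \<open>The law of the random sum, restricted to the indices in a block.\<close>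

definition model :: "nat \<Rightarrow> real measure" where
  "model T = empirical (Pow (block T)) (signed_sum limit_weight (block T))"

lemma real_distribution_model: "real_distribution (model T)"
  unfolding model_def by (rule real_distribution_empirical) auto

lemma measure_model_tail: "measure (model T) {r..} = tail_count limit_weight (block T) r / 2 ^ (2 * T)"
  unfolding model_def tail_count_def by (subst measure_empirical) (auto simp: card_Pow card_block)

lemma measure_model_lower_tail: "measure (model T) {..- r} = measure (model T) {r..}"
proof -
  have "card {X \<in> Pow (block T). signed_sum limit_weight (block T) X \<in> {..- r}}
     = card {X \<in> Pow (block T). - signed_sum limit_weight (block T) X \<in> {..- r}}"
    by (rule card_Pow_reflect) simp
  then show ?thesis unfolding model_def by (subst (1 2) measure_empirical) auto
qed

lemma model_tail_upper:
  fixes N T :: nat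
  assumes "N > 0"
  shows "measure (model T) {r..} \<le> exp (- (N * (r - 9 - 2 * ln N)))"
proof -
  have "real (tail_count limit_weight (block T) r) \<le> 2 ^ card (block T) * exp (- real N * r) * (\<Prod>m\<in>block T. cosh (real N * limit_weight m))"
    by (rule tail_count_chernoff) auto
  also have "\<dots> \<le> 2 ^ card (block T) * exp (- real N * r) * exp (N * (9 + 2 * ln N))"
    by (intro mult_left_mono prod_cosh_limit_weight_le assms) auto
  also have "\<dots> = 2 ^ (2 * T) * exp (- (N * (r - 9 - 2 * ln N)))"
    by (simp add: card_block mult.assoc flip: exp_add) (simp add: algebra_simps)
  finally show ?thesis unfolding measure_model_tail by (simp add: field_simps)
qed

lemma model_tail_lower:
  assumes "T \<ge> N" "r \<le> 2 * ln (real N + 1)"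
  shows "measure (model T) {r..} \<ge> 1 / 2 ^ (2 * N + 1)"
proof -
  have "r \<le> (\<Sum>m\<in>block N. \<bar>limit_weight m\<bar>)"
    using assms(2) odd_harm_lower[of N] by (simp add: sum_abs_limit_weight)
  then have "2 ^ card (block T) \<le> 2 * 2 ^ card (block N) * tail_count limit_weight (block T) r"
    by (intro tail_count_lower block_mono assms) auto
  then have "real (2 ^ (2 * T)) \<le> real (2 * 2 ^ (2 * N) * tail_count limit_weight (block T) r)"
    unfolding card_block by (simp only: of_nat_le_iff)
  then show ?thesis unfolding measure_model_tail by (simp add: field_simps)
qed

lemma char_model: "char (model T) x = complex_of_real (\<Prod>n<T. (cos (2 * x / real (2 * n + 1)))\<^sup>2)"
proof -
  have "(\<Sum>X\<in>Pow (block T). cis (x * signed_sum limit_weight (block T) X))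
     = (\<Prod>m\<in>block T. cis (x * limit_weight m) + cis (x * (- limit_weight m)))"
    by (rule sum_hom_signed_sum[where h = "\<lambda>y. cis (x * y)"]) (auto simp: distrib_left cis_mult)
  also have "\<dots> = (\<Prod>m\<in>block T. complex_of_real (2 * cos (x * limit_weight m)))"
    by (rule prod.cong[OF refl]) (simp add: complex_eq_iff)
  also have "\<dots> = 2 ^ (2 * T) * complex_of_real (\<Prod>m\<in>block T. cos (x * limit_weight m))"
    by (simp add: prod.distrib card_block)
  also have "(\<Prod>m\<in>block T. cos (x * limit_weight m)) = (\<Prod>n<T. (cos (2 * x / real (2 * n + 1)))\<^sup>2)"
    using prod_block_even[of "\<lambda>y. cos (x * y)" T] by (simp add: mult.commute)
  finally show ?thesis
    unfolding model_def by (subst char_empirical) (auto simp: card_Pow card_block)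
qed

section \<open>The limit law\<close>

text \<open>The characteristic function of the limit law and the infinite product in \<open>c_rho\<close>.\<close>

definition phi :: "real \<Rightarrow> real" where
  "phi x = (\<Prod>m. (cos (2 * x / real (2 * m + 1)))\<^sup>2)"

lemma cos_prod_tendsto: "(\<lambda>T. \<Prod>n<T. (cos (2 * x / real (2 * n + 1)))\<^sup>2) \<longlonglongrightarrow> phi x"
proof -
  let ?f = "\<lambda>n. (cos (2 * x / real (2 * n + 1)))\<^sup>2"
  have "summable (\<lambda>n. inverse (real (Suc n) ^ 2))"
    using inverse_power_summable[of 2, where 'a = real] by (subst summable_Suc_iff) simp
  then have s: "summable (\<lambda>n. 4 * x\<^sup>2 * inverse (real (Suc n) ^ 2))" by (rule summable_mult)
  have "summable (\<lambda>n. norm (?f n - 1))"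
  proof (rule summable_comparison_test'[OF s])
    fix n :: nat
    let ?y = "2 * x / real (2 * n + 1)"
    have "?f n - 1 = - ((sin ?y)\<^sup>2)" using sin_cos_squared_add[of ?y] by linarith
    then have "norm (norm (?f n - 1)) = \<bar>sin ?y\<bar>\<^sup>2" by simp
    also have "\<dots> \<le> \<bar>?y\<bar>\<^sup>2" by (intro power_mono abs_sin_x_le_abs_x) auto
    also have "\<dots> = 4 * x\<^sup>2 * inverse (real (2 * n + 1) ^ 2)" by (simp add: power_divide power_mult_distrib field_simps)
    also have "\<dots> \<le> 4 * x\<^sup>2 * inverse (real (Suc n) ^ 2)"
      by (intro mult_left_mono le_imp_inverse_le power_mono) auto
    finally show "norm (norm (?f n - 1)) \<le> 4 * x\<^sup>2 * inverse (real (Suc n) ^ 2)" .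
  qed
  then have "convergent_prod ?f"
    by (intro abs_convergent_prod_imp_convergent_prod summable_imp_abs_convergent_prod)
  then have "(\<lambda>n. \<Prod>i\<le>n. ?f i) \<longlonglongrightarrow> phi x" unfolding phi_def by (rule convergent_prod_LIMSEQ)
  then have "(\<lambda>n. \<Prod>i<Suc n. ?f i) \<longlonglongrightarrow> phi x" by (simp only: lessThan_Suc_atMost)
  then show ?thesis by (rule LIMSEQ_imp_Suc)
qed

lemma char_model_tendsto: "(\<lambda>T. char (model T) x) \<longlonglongrightarrow> complex_of_real (phi x)"
  unfolding char_model by (intro tendsto_of_real cos_prod_tendsto)

text \<open>The case \<open>N = 1\<close> of the exponential tail bound, which is uniform in the block.\<close>

lemma tight_model: "tight model"
  unfolding tight_def
proof (intro conjI allI impI)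
  show "real_distribution (model n)" for n by (rule real_distribution_model)
  fix e :: real assume e: "e > 0"
  define r where "r = max 1 (10 + ln (2 / e))"
  have r: "r > 0" "r \<ge> 10 + ln (2 / e)" by (auto simp: r_def)
  have "measure (model n) {-r<..r} > 1 - e" for n
  proof -
    interpret real_distribution "model n" by (rule real_distribution_model)
    have "exp (- (r - 9)) < exp (- ln (2 / e))" using r by (subst exp_less_cancel_iff) linarith
    also have "\<dots> = e / 2" using e by (simp add: exp_minus)
    finally have small: "exp (- (r - 9)) < e / 2" .
    have up: "prob {r..} \<le> exp (- (r - 9))" using model_tail_upper[of 1 n r] by simp
    have "1 = prob UNIV" using prob_space by simp
    also have "\<dots> \<le> prob ({..-r} \<union> {r..} \<union> {-r<..r})" by (intro finite_measure_mono) auto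
    also have "\<dots> \<le> prob ({..-r} \<union> {r..}) + prob {-r<..r}" by (intro measure_Un_le) auto
    also have "prob ({..-r} \<union> {r..}) \<le> prob {..-r} + prob {r..}" by (intro measure_Un_le) auto
    finally show ?thesis using up small measure_model_lower_tail[of n r] by simp
  qed
  then show "\<exists>a b. a < b \<and> (\<forall>n. measure (model n) {a<..b} > 1 - e)"
    using r by (intro exI[of _ "-r"] exI[of _ r]) auto
qed

text \<open>Helly's theorem provides a limit along a subsequence. Its characteristic function is the pointwise limit
\<open>phi\<close>, and Levy's continuity theorem upgrades this to convergence of the whole sequence.\<close>

lemma exists_limit_law:
  "\<exists>M. real_distribution M \<and> weak_conv_m model M \<and> (\<forall>x. char M x = complex_of_real (phi x))"
proof -
  obtain s M where s: "strict_mono (s :: nat \<Rightarrow> nat)" and M: "real_distribution M" and "weak_conv_m (model \<circ> id \<circ> s) M"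
    using tight_imp_convergent_subsubsequence[OF tight_model, of id] by (auto simp: strict_mono_id)
  then have "weak_conv_m (\<lambda>n. model (s n)) M" by (simp add: o_def)
  then have "(\<lambda>n. char (model (s n)) x) \<longlonglongrightarrow> char M x" for x
    by (intro levy_continuity1 real_distribution_model M)
  moreover have "(\<lambda>n. char (model (s n)) x) \<longlonglongrightarrow> complex_of_real (phi x)" for x
    using LIMSEQ_subseq_LIMSEQ[OF char_model_tendsto[of x] s] by (simp add: o_def)
  ultimately have ch: "char M x = complex_of_real (phi x)" for x
    using LIMSEQ_unique by blast
  then have "weak_conv_m model M"
    using char_model_tendsto by (intro levy_continuity real_distribution_model M) auto
  then show ?thesis using M ch by blast
qed

definition limit_law :: "real measure" where
  "limit_law = (SOME M. real_distribution M \<and> weak_conv_m model M \<and> (\<forall>x. char M x = complex_of_real (phi x)))"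

lemma real_distribution_limit_law: "real_distribution limit_law"
  and weak_conv_limit_law: "weak_conv_m model limit_law"
  and char_limit_law: "char limit_law x = complex_of_real (phi x)"
  using someI_ex[OF exists_limit_law, folded limit_law_def] by auto

interpretation L: real_distribution limit_law by (rule real_distribution_limit_law)

lemma phi_measurable [measurable]: "phi \<in> borel_measurable borel"
proof -
  have "phi = (\<lambda>x. Re (char limit_law x))" by (simp add: char_limit_law)
  also have "\<dots> \<in> borel_measurable borel" by measurable
  finally show ?thesis .
qed

lemma phi_minus: "phi (- x) = phi x"
  by (simp add: phi_def)

lemma phi_nonneg: "phi x \<ge> 0"
  by (rule LIMSEQ_le_const[OF cos_prod_tendsto]) (auto intro!: prod_nonneg)

text \<open>For \<open>x \<ge> 1\<close>, the roughly \<open>x\<close> factors with index \<open>n\<close> between \<open>x\<close> and \<open>2*x\<close> have cosines of angles in \<open>[1/4, 1]\<close>, so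
each of them is at most \<open>cos(1/4)^2 < 1\<close>; the other factors are at most \<open>1\<close>.\<close>

lemma phi_decay: "\<exists>c K. c > 0 \<and> K > 0 \<and> (\<forall>x. \<bar>phi x\<bar> \<le> K * exp (- (c * \<bar>x\<bar>)))"
proof -
  define q where "q = (cos (1 / 4 :: real))\<^sup>2"
  have pq: "cos (1 / 4 :: real) > 0" using pi_gt3 by (intro cos_gt_zero) auto
  have "cos (1 / 4 :: real) < cos 0" using pi_gt3 by (intro cos_monotone_0_pi) auto
  then have q: "0 < q" "q < 1" using pq by (auto simp: q_def power_less_one_iff)
  define c where "c = - ln q"
  have c: "c > 0" using q by (simp add: c_def)
  have le1: "phi x \<le> 1" for x
    by (rule LIMSEQ_le_const2[OF cos_prod_tendsto]) (auto intro!: prod_le_1 simp: abs_square_le_1)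
  have le: "phi x \<le> exp c * exp (- (c * x))" if x: "x \<ge> 0" for x
  proof (cases "x < 1")
    case True
    have "c * x \<le> c" using True c by simp
    then have "1 \<le> exp c * exp (- (c * x))" by (simp flip: exp_add)
    then show ?thesis using le1[of x] by linarith
  next
    case False
    define N where "N = nat \<lceil>x\<rceil>"
    have N: "real N \<ge> x" "real N \<le> x + 1" "N > 0" using False unfolding N_def by linarith+
    let ?f = "\<lambda>n. (cos (2 * x / real (2 * n + 1)))\<^sup>2"
    have f: "?f n \<le> q" if n: "n \<in> {N..<2 * N}" for n
    proof -
      define y where "y = 2 * x / real (2 * n + 1)"
      have "real n \<ge> real N" "real n + 1 \<le> 2 * real N" using n by auto
      then have "1 / 4 \<le> y" "y \<le> 1" using N False by (auto simp: y_def field_simps)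
      then have y: "1 / 4 \<le> y" "y \<le> pi" "y \<le> pi / 2" using pi_gt3 by linarith+
      have "cos y \<le> cos (1 / 4)" using y by (intro cos_monotone_0_pi_le) auto
      moreover have "cos y \<ge> 0" using y by (intro cos_ge_zero) auto
      ultimately show ?thesis unfolding q_def y_def[symmetric] by (intro power_mono) auto
    qed
    have "(\<Prod>n<T. ?f n) \<le> q ^ N" if T: "T \<ge> 2 * N" for T
    proof -
      have "(\<Prod>n<T. ?f n) = (\<Prod>n\<in>{..<T} - {N..<2 * N}. ?f n) * (\<Prod>n\<in>{N..<2 * N}. ?f n)"
        using T by (intro prod.subset_diff) auto
      also have "\<dots> \<le> 1 * (\<Prod>n\<in>{N..<2 * N}. q)"
        using f by (intro mult_mono prod_mono prod_le_1 prod_nonneg) (auto simp: abs_square_le_1)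
      finally show ?thesis by simp
    qed
    then have "phi x \<le> q ^ N" by (intro LIMSEQ_le_const2[OF cos_prod_tendsto]) blast
    also have "q ^ N = exp (- (c * N))" using q by (simp add: c_def exp_of_nat_mult mult.commute[of _ "real N"])
    also have "\<dots> \<le> exp (- (c * x))" using c N by simp
    also have "\<dots> \<le> exp c * exp (- (c * x))" using c by simp
    finally show ?thesis .
  qed
  have "\<bar>phi x\<bar> \<le> exp c * exp (- (c * \<bar>x\<bar>))" for x
    using phi_nonneg[of x] phi_minus[of x] le[of x] le[of "- x"] by (cases "x \<ge> 0") auto
  then show ?thesis using c by (intro exI[of _ c] exI[of _ "exp c"]) auto
qed

lemma integrable_exp_abs: "c > 0 \<Longrightarrow> integrable lborel (\<lambda>x::real. exp (- (c * \<bar>x\<bar>)))"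
proof -
  assume c: "c > (0::real)"
  define g where "g x = indicator {0<..} x *\<^sub>R exp (- (x * c))" for x :: real
  have g: "integrable lborel g" using integrable_I0i_exp_mscale[OF c] by (simp add: set_integrable_def g_def[abs_def])
  have "integrable lborel (\<lambda>x. g (0 + (- 1) * x))" by (rule lborel_integrable_real_affine[OF g]) simp
  with g have i: "integrable lborel (\<lambda>x. g x + g (- x))" by (intro Bochner_Integration.integrable_add) auto
  show ?thesis
  proof (rule integrableI_bounded)
    have "AE x in lborel. x \<noteq> (0::real)" by (rule AE_lborel_singleton)
    then have ae: "AE x in lborel. exp (- (c * \<bar>x\<bar>)) = g x + g (- x)"
      by eventually_elim (auto simp: g_def mult.commute split: split_indicator)
    have "(\<integral>\<^sup>+ x. ennreal (norm (exp (- (c * \<bar>x\<bar>)))) \<partial>lborel) = (\<integral>\<^sup>+ x. ennreal (norm (g x + g (- x))) \<partial>lborel)"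
      using ae by (intro nn_integral_cong_AE) (erule eventually_mono, simp only:)
    also have "\<dots> < \<infinity>" using i by (simp add: integrable_iff_bounded)
    finally show "(\<integral>\<^sup>+ x. ennreal (norm (exp (- (c * \<bar>x\<bar>)))) \<partial>lborel) < \<infinity>" .
  qed measurable
qed

lemma integrable_phi: "integrable lborel phi"
proof -
  obtain c K where cK: "c > 0" "\<And>x. \<bar>phi x\<bar> \<le> K * exp (- (c * \<bar>x\<bar>))" using phi_decay by blast
  have "integrable lborel (\<lambda>x. K * exp (- (c * \<bar>x\<bar>)))" using integrable_exp_abs[OF cK(1)] by simp
  then show ?thesis
    by (rule Bochner_Integration.integrable_bound) (use cK(2) in \<open>auto intro: order.trans[OF _ abs_ge_self]\<close>)
qed

text \<open>By Levy's inversion formula, an integrable characteristic function forces a bounded density.\<close>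

lemma limit_law_interval_le:
  assumes ab: "a \<le> b" "measure limit_law {a} = 0" "measure limit_law {b} = 0"
  shows "measure limit_law {a<..b} \<le> (b - a) * (LINT x|lborel. phi x)"
proof -
  let ?F = "\<lambda>t. (iexp (- (t * a)) - iexp (- (t * b))) / (\<i> * t) * char limit_law t"
  have "cmod (1 / (2 * pi) * (CLBINT t=-real T..real T. ?F t)) \<le> (b - a) * (LINT x|lborel. phi x)" for T :: nat
  proof -
    have "cmod (CLBINT t=-real T..real T. ?F t) = cmod (CLINT t|lborel. indicator (einterval (-real T) (real T)) t *\<^sub>R ?F t)"
      by (simp add: interval_lebesgue_integral_def set_lebesgue_integral_def)
    also have "\<dots> \<le> (LINT t|lborel. cmod (indicator (einterval (-real T) (real T)) t *\<^sub>R ?F t))"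
      by (rule integral_norm_bound)
    also have "\<dots> \<le> (LINT t|lborel. (b - a) * phi t)"
    proof (rule integral_mono_AE')
      show "integrable lborel (\<lambda>t. (b - a) * phi t)" using integrable_phi by simp
      show "AE t in lborel. 0 \<le> (b - a) * phi t" using ab phi_nonneg by simp
      have "AE t in lborel. t \<noteq> (0::real)" by (rule AE_lborel_singleton)
      then show "AE t in lborel. cmod (indicator (einterval (-real T) (real T)) t *\<^sub>R ?F t) \<le> (b - a) * phi t"
      proof eventually_elim
        case (elim t)
        have "cmod ((iexp (t * - a) - iexp (t * - b)) / (\<i> * t)) \<le> - a - (- b)"
          using ab elim by (intro Levy_Inversion_aux2) auto
        then have "cmod (?F t) \<le> (b - a) * phi t"
          unfolding norm_mult char_limit_law using phi_nonneg[of t] ab(1) by (intro mult_mono) auto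
        then show ?case using ab phi_nonneg[of t] by (auto split: split_indicator)
      qed
    qed
    finally have "cmod (CLBINT t=-real T..real T. ?F t) \<le> (b - a) * (LINT x|lborel. phi x)" by simp
    moreover have "cmod (1 / (2 * pi) * (CLBINT t=-real T..real T. ?F t)) \<le> 1 * cmod (CLBINT t=-real T..real T. ?F t)"
      unfolding norm_mult using pi_gt3 by (intro mult_right_mono) (auto simp: norm_divide norm_mult divide_le_eq)
    ultimately show ?thesis by linarith
  qed
  moreover have "(\<lambda>T. cmod (1 / (2 * pi) * (CLBINT t=-real T..real T. ?F t))) \<longlonglongrightarrow> cmod (complex_of_real (measure limit_law {a<..b}))"
    using L.Levy_Inversion[OF ab] by (intro tendsto_norm) simp
  ultimately have "cmod (complex_of_real (measure limit_law {a<..b})) \<le> (b - a) * (LINT x|lborel. phi x)"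
    by (intro LIMSEQ_le_const2[OF _ ]) blast+
  then show ?thesis by simp
qed

text \<open>Enclose the point in a short interval whose end points are not among the countably many atoms.\<close>

lemma limit_law_no_atom: "measure limit_law {x} = 0"
proof (rule ccontr)
  assume "measure limit_law {x} \<noteq> 0"
  then have pos: "measure limit_law {x} > 0" by (simp add: less_le)
  define I where "I = (LINT x|lborel. phi x)"
  have I: "I \<ge> 0" unfolding I_def using phi_nonneg by simp
  define d where "d = measure limit_law {x} / (4 * (I + 1))"
  have d: "d > 0" using pos I by (simp add: d_def)
  obtain a where a: "x - d < a" "a < x" "measure limit_law {a} = 0"
    using open_minus_countable[OF L.countable_support, of "{x - d<..<x}"] d by auto
  obtain b where b: "x < b" "b < x + d" "measure limit_law {b} = 0"
    using open_minus_countable[OF L.countable_support, of "{x<..<x + d}"] d by auto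
  have "measure limit_law {x} \<le> measure limit_law {a<..b}" using a b by (intro L.finite_measure_mono) auto
  also have "\<dots> \<le> (b - a) * I" unfolding I_def using a b by (intro limit_law_interval_le) auto
  also have "\<dots> \<le> 2 * d * (I + 1)" using a b I by (intro mult_mono) auto
  also have "\<dots> = measure limit_law {x} / 2" using I by (simp add: d_def field_simps)
  finally show False using pos by simp
qed

lemma isCont_cdf_limit_law: "isCont (cdf limit_law) x"
  using limit_law_no_atom by (simp add: L.isCont_cdf)

lemma cdf_model_tendsto: "(\<lambda>T. cdf (model T) x) \<longlonglongrightarrow> cdf limit_law x"
  using weak_conv_limit_law isCont_cdf_limit_law unfolding weak_conv_m_def weak_conv_def by blast

text \<open>The characteristic function is even, and there is no mass at \<open>x\<close>.\<close>

lemma limit_law_symmetric: "cdf limit_law (- x) = 1 - cdf limit_law x"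
proof -
  have "distr limit_law borel uminus = limit_law"
  proof (rule Levy_uniqueness)
    show "real_distribution (distr limit_law borel uminus)" by (rule L.real_distribution_distr) simp
    show "char (distr limit_law borel uminus) = char limit_law"
    proof
      fix t
      have "char (distr limit_law borel uminus) t = char limit_law (- t)"
        unfolding char_def by (subst integral_distr) auto
      then show "char (distr limit_law borel uminus) t = char limit_law t" by (simp add: char_limit_law phi_minus)
    qed
  qed (rule real_distribution_limit_law)
  then have "cdf limit_law (- x) = measure (distr limit_law borel uminus) {..- x}" by (simp add: cdf_def)
  also have "\<dots> = measure limit_law {x..}"
    by (subst measure_distr) (auto intro!: arg_cong[where f = "measure limit_law"])
  also have "{x..} = {x} \<union> {x<..}" by auto
  also have "measure limit_law ({x} \<union> {x<..}) = measure limit_law {x} + measure limit_law {x<..}"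
    by (intro L.finite_measure_Union) auto
  also have "{x<..} = space limit_law - {..x}" by auto
  also have "measure limit_law (space limit_law - {..x}) = 1 - measure limit_law {..x}"
    by (intro L.prob_compl) simp
  finally show ?thesis by (simp add: limit_law_no_atom cdf_def)
qed

text \<open>Levy's inversion formula at \<open>-r\<close> and \<open>r\<close>. The integrand \<open>2 * sin (r*t) * phi t / t\<close> is even and integrable over
the whole line, so the symmetric truncations converge to twice the integral over the half line.\<close>

lemma limit_law_interval_eq:
  assumes r: "r \<ge> 0"
  shows "measure limit_law {- r<..r} = 2 / pi * (LBINT t:{0<..}. sin (r * t) * phi t / t)"
proof -
  let ?J = "\<lambda>(T::nat) (t::real). indicator (einterval (-real T) (real T)) t :: real"
  define h where "h t = sin (r * t) * phi t / t" for t
  let ?F = "\<lambda>t. (iexp (- (t * - r)) - iexp (- (t * r))) / (\<i> * t) * char limit_law t"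
  let ?S = "\<lambda>T. LINT t|lborel. ?J T t *\<^sub>R h t"
  have hm [measurable]: "h \<in> borel_measurable borel" unfolding h_def by measurable
  have hb: "\<bar>h t\<bar> \<le> r * phi t" for t
  proof (cases "t = 0")
    case False
    have "\<bar>sin (r * t)\<bar> \<le> \<bar>r * t\<bar>" by (rule abs_sin_x_le_abs_x)
    then have "\<bar>sin (r * t)\<bar> / \<bar>t\<bar> \<le> r" using False r by (simp add: field_simps abs_mult)
    then have "\<bar>sin (r * t)\<bar> / \<bar>t\<bar> * phi t \<le> r * phi t" by (rule mult_right_mono) (rule phi_nonneg)
    then show ?thesis using phi_nonneg[of t] by (simp add: h_def abs_mult)
  qed (use r phi_nonneg in \<open>simp add: h_def\<close>)
  have irp: "integrable lborel (\<lambda>t. r * phi t)" using integrable_phi by simp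
  have hi: "integrable lborel h"
    by (rule Bochner_Integration.integrable_bound[OF irp]) (auto intro!: AE_I2 order.trans[OF hb])
  have hminus: "h (- t) = h t" for t by (simp add: h_def phi_minus)
  have "(LINT t|lborel. h t) = 2 * (LBINT t:{0<..}. h t)"
  proof -
    have i1: "integrable lborel (\<lambda>t. indicator {0<..} t *\<^sub>R h t)" using hi by (rule integrable_mult_indicator[rotated]) simp
    have i2: "integrable lborel (\<lambda>t. indicator {0<..} (- t) *\<^sub>R h (- t))"
      using lborel_integrable_real_affine[OF i1, of "- 1" 0] by simp
    have "(LINT t|lborel. h t) = (LINT t|lborel. indicator {0<..} t *\<^sub>R h t + indicator {0<..} (- t) *\<^sub>R h (- t))"
    proof (rule Bochner_Integration.integral_cong_AE)
      have "AE t in lborel. t \<noteq> (0::real)" by (rule AE_lborel_singleton)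
      then show "AE t in lborel. h t = indicator {0<..} t *\<^sub>R h t + indicator {0<..} (- t) *\<^sub>R h (- t)"
        by eventually_elim (auto simp: hminus split: split_indicator)
    qed measurable
    also have "\<dots> = (LINT t|lborel. indicator {0<..} t *\<^sub>R h t) + (LINT t|lborel. indicator {0<..} (- t) *\<^sub>R h (- t))"
      by (rule Bochner_Integration.integral_add[OF i1 i2])
    also have "(LINT t|lborel. indicator {0<..} (- t) *\<^sub>R h (- t)) = (LINT t|lborel. indicator {0<..} t *\<^sub>R h t)"
      using lborel_integral_real_affine[of "- 1" "\<lambda>t. indicator {0<..} t *\<^sub>R h t" 0] by simp
    finally show ?thesis by (simp add: set_lebesgue_integral_def)
  qed
  moreover have "?S \<longlonglongrightarrow> (LINT t|lborel. h t)"
  proof (rule integral_dominated_convergence[where w = "\<lambda>t. r * phi t"])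
    show "AE t in lborel. (\<lambda>T::nat. ?J T t *\<^sub>R h t) \<longlonglongrightarrow> h t"
    proof (rule AE_I2)
      fix t :: real
      have "\<forall>\<^sub>F T::nat in sequentially. real T > \<bar>t\<bar>"
        using filterlim_real_sequentially by (auto simp: filterlim_at_top_dense)
      then have "\<forall>\<^sub>F T::nat in sequentially. ?J T t *\<^sub>R h t = h t"
        by eventually_elim (auto simp: einterval_def indicator_def)
      then show "(\<lambda>T::nat. ?J T t *\<^sub>R h t) \<longlonglongrightarrow> h t"
        by (rule tendsto_eventually)
    qed
    show "AE t in lborel. norm (?J T t *\<^sub>R h t) \<le> r * phi t" for T :: nat
      using hb r phi_nonneg by (intro AE_I2) (auto split: split_indicator)
  qed (use irp in measurable)
  ultimately have lim1: "?S \<longlonglongrightarrow> 2 * (LBINT t:{0<..}. h t)"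
    by simp
  have "(\<lambda>T. 1 / (2 * pi) * (CLBINT t=-real T..real T. ?F t))
    \<longlonglongrightarrow> complex_of_real (measure limit_law {- r<..r})"
    using L.Levy_Inversion[of "- r" r] r limit_law_no_atom by simp
  moreover have "1 / (2 * pi) * (CLBINT t=-real T..real T. ?F t)
    = complex_of_real (1 / pi * ?S T)" for T :: nat
  proof -
    have "?F t = complex_of_real (2 * h t)" for t
      unfolding char_limit_law h_def
      by (simp add: complex_eq_iff Re_exp Im_exp Re_divide Im_divide power2_eq_square mult.commute[of r])
    then have "(CLBINT t=-real T..real T. ?F t)
      = (CLBINT t=-real T..real T. complex_of_real (2 * h t))" by (simp only:)
    also have "\<dots> = complex_of_real (LBINT t=-real T..real T. 2 * h t)" by (rule interval_lebesgue_integral_of_real)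
    also have "(LBINT t=-real T..real T. 2 * h t) = 2 * ?S T"
      by (simp add: interval_lebesgue_integral_def set_lebesgue_integral_def mult.left_commute)
    finally show ?thesis by simp
  qed
  ultimately have "(\<lambda>T::nat. complex_of_real (1 / pi * ?S T))
     \<longlonglongrightarrow> complex_of_real (measure limit_law {- r<..r})" by simp
  then have "(\<lambda>T::nat. 1 / pi * ?S T) \<longlonglongrightarrow> measure limit_law {- r<..r}"
    by (simp only: tendsto_of_real_iff)
  moreover have "(\<lambda>T::nat. 1 / pi * ?S T) \<longlonglongrightarrow> 1 / pi * (2 * (LBINT t:{0<..}. h t))"
    by (intro tendsto_mult tendsto_const lim1)
  ultimately have "measure limit_law {- r<..r} = 1 / pi * (2 * (LBINT t:{0<..}. h t))" by (rule LIMSEQ_unique)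
  then show ?thesis by (simp add: h_def)
qed

text \<open>Symmetry turns the mass of \<open>(-r, r]\<close> into the distribution function at \<open>r\<close>; both sides are \<open>1\<close> minus themselves under \<open>\<rho> \<mapsto> -\<rho>\<close>.\<close>

theorem c_rho_eq_cdf: "c_rho \<rho> = cdf limit_law (pi * \<rho>)"
proof -
  have c: "c_rho \<rho> = 1 / 2 + 1 / pi * (LBINT x:{0<..}. sin (\<rho> * pi * x) * phi x / x)" for \<rho>
    by (simp add: c_rho_def phi_def)
  have pos: "c_rho \<rho> = cdf limit_law (pi * \<rho>)" if \<rho>: "\<rho> \<ge> 0" for \<rho>
  proof -
    define r where "r = pi * \<rho>"
    have r: "r \<ge> 0" using \<rho> by (simp add: r_def)
    have "measure limit_law {- r<..r} = cdf limit_law r - cdf limit_law (- r)"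
    proof (cases "r = 0")
      case False
      then show ?thesis using r L.cdf_diff_eq[of "- r" r] by simp
    qed simp
    then have "cdf limit_law r = 1 / 2 + measure limit_law {- r<..r} / 2" by (simp add: limit_law_symmetric field_simps)
    also have "\<dots> = c_rho \<rho>" unfolding c limit_law_interval_eq[OF r] by (simp add: r_def mult.commute[of pi])
    finally show ?thesis by (simp add: r_def)
  qed
  show ?thesis
  proof (cases "\<rho> \<ge> 0")
    case False
    have "(LBINT x:{0<..}. sin (\<rho> * pi * x) * phi x / x) = - (LBINT x:{0<..}. sin (- \<rho> * pi * x) * phi x / x)"
      by (simp add: set_lebesgue_integral_def)
    then have "c_rho \<rho> = 1 - c_rho (- \<rho>)" unfolding c by simp
    also have "\<dots> = 1 - cdf limit_law (- (pi * \<rho>))" using pos[of "- \<rho>"] False by simp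
    also have "\<dots> = cdf limit_law (pi * \<rho>)" by (simp add: limit_law_symmetric)
    finally show ?thesis .
  qed (rule pos)
qed

section \<open>Tails of the limit law and convergence along the primes\<close>

lemma model_upper_tail_tendsto: "(\<lambda>T. 1 - cdf (model T) r) \<longlonglongrightarrow> 1 - cdf limit_law r"
  by (intro tendsto_intros cdf_model_tendsto)

lemma cdf_model_compl: "1 - cdf (model T) r = measure (model T) {r<..}"
proof -
  interpret real_distribution "model T" by (rule real_distribution_model)
  have "{r<..} = space (model T) - {..r}" by auto
  then show ?thesis using prob_compl[of "{..r}"] by (simp add: cdf_def)
qed

lemma limit_law_tail_upper:
  fixes N :: nat
  assumes "N > 0"
  shows "1 - cdf limit_law r \<le> exp (- (N * (r - 9 - 2 * ln N)))"
proof (rule LIMSEQ_le_const2[OF model_upper_tail_tendsto], intro exI allI impI)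
  fix T
  interpret real_distribution "model T" by (rule real_distribution_model)
  have "1 - cdf (model T) r \<le> measure (model T) {r..}"
    unfolding cdf_model_compl by (intro finite_measure_mono) auto
  also have "\<dots> \<le> exp (- (N * (r - 9 - 2 * ln N)))" by (rule model_tail_upper[OF assms])
  finally show "1 - cdf (model T) r \<le> exp (- (N * (r - 9 - 2 * ln N)))" .
qed

lemma limit_law_tail_lower:
  assumes "r < 2 * ln (real N + 1)"
  shows "1 - cdf limit_law r \<ge> 1 / 2 ^ (2 * N + 1)"
proof (rule LIMSEQ_le_const[OF model_upper_tail_tendsto], intro exI allI impI)
  fix T assume T: "N \<le> T"
  interpret real_distribution "model T" by (rule real_distribution_model)
  have "1 / 2 ^ (2 * N + 1) \<le> measure (model T) {2 * ln (real N + 1)..}" by (rule model_tail_lower[OF T]) simp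
  also have "\<dots> \<le> 1 - cdf (model T) r" unfolding cdf_model_compl using assms by (intro finite_measure_mono) auto
  finally show "1 / 2 ^ (2 * N + 1) \<le> 1 - cdf (model T) r" .
qed

lemma limit_law_tail_le_half:
  assumes "r \<ge> 0" shows "1 - cdf limit_law r \<le> 1 / 2"
proof -
  have "cdf limit_law (- r) \<le> cdf limit_law r" using assms by (intro L.cdf_nondecreasing) simp
  then show ?thesis using limit_law_symmetric[of r] by simp
qed

text \<open>The exponent \<open>N * (r - 9 - 2 * ln N)\<close> is at least \<open>N\<close> when \<open>N \<le> exp ((r - 10)/2)\<close>, and this choice is possible for
\<open>r \<ge> 10\<close>. For smaller \<open>r\<close> the symmetry bound \<open>1/2\<close> is good enough.\<close>

lemma limit_law_tail_double_exp_upper: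
  assumes "r \<ge> 0"
  shows "1 - cdf limit_law r \<le> exp (- exp (r / 2 - 20))"
proof (cases "r \<ge> 10")
  case True
  define y where "y = exp ((r - 10) / 2)"
  have y: "y \<ge> 1" using True by (simp add: y_def)
  define N where "N = nat \<lfloor>y\<rfloor>"
  have "\<lfloor>y\<rfloor> \<ge> 1" using y by simp
  then have "real N = real_of_int \<lfloor>y\<rfloor>" "N > 0" by (simp_all add: N_def)
  moreover from \<open>N > 0\<close> have "real N \<ge> 1" by linarith
  moreover have "real_of_int \<lfloor>y\<rfloor> \<le> y" "y < real_of_int \<lfloor>y\<rfloor> + 1" by linarith+
  ultimately have N: "real N \<le> y" "y / 2 \<le> real N" "N > 0" by linarith+
  have "ln (real N) \<le> ln y" using N by simp
  then have "r - 9 - 2 * ln N \<ge> 1" by (simp add: y_def)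
  then have "real N * (r - 9 - 2 * ln N) \<ge> real N * 1" by (intro mult_left_mono) auto
  moreover have "exp (r / 2 - 20) \<le> y / 2"
  proof -
    have "2 * exp (r / 2 - 20) \<le> exp 1 * exp (r / 2 - 20)" using exp_ge_add_one_self[of 1] by (intro mult_right_mono) auto
    also have "\<dots> \<le> y" unfolding y_def by (simp flip: exp_add)
    finally show ?thesis by simp
  qed
  ultimately have "- (N * (r - 9 - 2 * ln N)) \<le> - exp (r / 2 - 20)" using N by linarith
  then have "exp (- (N * (r - 9 - 2 * ln N))) \<le> exp (- exp (r / 2 - 20))" by simp
  then show ?thesis using limit_law_tail_upper[OF N(3), of r] by linarith
next
  case False
  have "exp (r / 2 - 20) \<le> exp (- 1)" using False by simp
  also have "exp (- 1) \<le> (1 / 2 :: real)" using exp_ge_add_one_self[of 1] by (simp add: exp_minus field_simps)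
  finally have "exp (- (1 / 2)) \<le> exp (- exp (r / 2 - 20))" by simp
  moreover have "1 / 2 \<le> exp (- (1 / 2 :: real))" using exp_ge_add_one_self[of "- (1 / 2)"] by simp
  ultimately show ?thesis using limit_law_tail_le_half[OF assms] by linarith
qed

text \<open>Take \<open>N\<close> with \<open>exp (r/2) \<le> N\<close>, so that \<open>r < 2 * ln (N + 1)\<close>; the cost \<open>2^(2*N + 1)\<close> is at most \<open>exp (5 * exp (r/2))\<close>.\<close>

lemma limit_law_tail_double_exp_lower:
  assumes "r \<ge> 0"
  shows "1 - cdf limit_law r \<ge> exp (- exp (r / 2 + 20))"
proof -
  define y where "y = exp (r / 2)"
  have y: "y \<ge> 1" using assms by (simp add: y_def)
  define N where "N = nat \<lceil>y\<rceil>"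
  have N: "y \<le> real N" "real N \<le> y + 1" using y unfolding N_def by linarith+
  have "ln y < ln (real N + 1)" using N y by simp
  then have "r < 2 * ln (real N + 1)" by (simp add: y_def)
  then have "1 / 2 ^ (2 * N + 1) \<le> 1 - cdf limit_law r" by (rule limit_law_tail_lower)
  moreover have "exp (- exp (r / 2 + 20)) \<le> 1 / 2 ^ (2 * N + 1)"
  proof -
    have "(2::real) ^ (2 * N + 1) \<le> exp 1 ^ (2 * N + 1)" using exp_ge_add_one_self[of 1] by (intro power_mono) auto
    also have "\<dots> = exp (real (2 * N + 1) * 1)" by (rule exp_of_nat_mult[symmetric])
    also have "real (2 * N + 1) * 1 = real (2 * N + 1)" by (rule mult_1_right)
    also have "exp (real (2 * N + 1)) \<le> exp (exp (r / 2 + 20))"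
    proof -
      have "real (2 * N + 1) \<le> 5 * y" using N y by simp
      also have "\<dots> \<le> exp 20 * y" using exp_ge_add_one_self[of 20] y by (intro mult_right_mono) auto
      finally show ?thesis by (subst exp_le_cancel_iff) (simp add: y_def exp_add mult.commute)
    qed
    finally show ?thesis by (simp add: exp_minus field_simps)
  qed
  ultimately show ?thesis by linarith
qed

lemma double_exp_form:
  fixes x t :: real
  assumes "exp (- exp (x + 20)) \<le> t" "t \<le> exp (- exp (x - 20))"
  shows "\<exists>e. \<bar>e\<bar> \<le> 20 \<and> t = exp (- exp (x + e))"
proof -
  have t0: "t > 0" using assms(1) exp_gt_zero[of "- exp (x + 20)"] by linarith
  define L where "L = - ln t"
  have "ln (exp (- exp (x + 20))) \<le> ln t" by (subst ln_le_cancel_iff) (simp_all add: t0 assms)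
  then have L1: "L \<le> exp (x + 20)" by (simp add: L_def)
  have "ln t \<le> ln (exp (- exp (x - 20)))" by (subst ln_le_cancel_iff) (simp_all add: t0 assms)
  then have L2: "exp (x - 20) \<le> L" by (simp add: L_def)
  have L0: "L > 0" using L2 exp_gt_zero[of "x - 20"] by linarith
  have "ln L \<le> ln (exp (x + 20))" by (subst ln_le_cancel_iff) (simp_all add: L0 L1)
  moreover have "ln (exp (x - 20)) \<le> ln L" by (subst ln_le_cancel_iff) (simp_all add: L0 L2)
  ultimately have "\<bar>ln L - x\<bar> \<le> 20" by simp
  moreover have "t = exp (- exp (x + (ln L - x)))" using L0 t0 by (simp add: L_def)
  ultimately show ?thesis by blast
qed

theorem c_rho_tail:
  assumes "\<rho> > 0"
  shows "\<exists>e. \<bar>e\<bar> \<le> 20 \<and> c_rho (- \<rho>) = exp (- exp (pi * \<rho> / 2 + e))"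
    and "\<exists>e. \<bar>e\<bar> \<le> 20 \<and> 1 - c_rho \<rho> = exp (- exp (pi * \<rho> / 2 + e))"
proof -
  have r: "pi * \<rho> \<ge> 0" using assms by simp
  show 1: "\<exists>e. \<bar>e\<bar> \<le> 20 \<and> 1 - c_rho \<rho> = exp (- exp (pi * \<rho> / 2 + e))"
    unfolding c_rho_eq_cdf
    by (rule double_exp_form[OF limit_law_tail_double_exp_lower[OF r] limit_law_tail_double_exp_upper[OF r]])
  have "c_rho (- \<rho>) = 1 - c_rho \<rho>" unfolding c_rho_eq_cdf using limit_law_symmetric[of "pi * \<rho>"] by simp
  with 1 show "\<exists>e. \<bar>e\<bar> \<le> 20 \<and> c_rho (- \<rho>) = exp (- exp (pi * \<rho> / 2 + e))" by simp
qed

lemma c_rho_pos: "c_rho \<rho> > 0"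
proof (cases "\<rho> \<ge> 0")
  case True
  have "1 - cdf limit_law (pi * \<rho>) \<le> 1 / 2" using True by (intro limit_law_tail_le_half) simp
  then show ?thesis by (simp add: c_rho_eq_cdf)
next
  case False
  then have "0 < - \<rho>" by simp
  from c_rho_tail(1)[OF this] obtain e where "c_rho (- (- \<rho>)) = exp (- exp (pi * (- \<rho>) / 2 + e))"
    by blast
  then show ?thesis by simp
qed

text \<open>The minus sign makes the strict inequality \<open>H_p < \<rho> * sqrt p\<close> the complement of an event \<open>\<le>\<close>, which a
distribution function measures.\<close>

definition Hp_law :: "nat \<Rightarrow> real measure" where
  "Hp_law p = empirical {1..int p} (\<lambda>k. - (pi * Hp p ((of_int k + 1 / 2) / real p) / sqrt (real p)))"

text \<open>At nonprime indices the limit itself is inserted, so that convergence along the primes becomes convergence of a sequence.\<close>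

definition prime_law :: "nat \<Rightarrow> real measure" where
  "prime_law p = (if prime p then Hp_law p else limit_law)"

lemma real_distribution_prime_law: "real_distribution (prime_law p)"
proof (cases "prime p")
  case True
  then show ?thesis using prime_gt_0_nat[of p] unfolding prime_law_def Hp_law_def
    by (auto intro!: real_distribution_empirical)
qed (simp add: prime_law_def real_distribution_limit_law)

lemma weak_conv_prime_law: "weak_conv_m prime_law limit_law"
proof (rule levy_continuity)
  fix x :: real
  show "(\<lambda>p. char (prime_law p) x) \<longlonglongrightarrow> char limit_law x"
  proof (rule tendstoI)
    fix e :: real assume e: "e > 0"
    have "\<forall>\<^sub>F p in sequentially. prime p \<longrightarrow> (\<forall>s. s = 1 \<or> s = -1 \<longrightarrow>
      cmod ((\<Sum>k = 1..int p. cis (x * cot_sum p s k)) / p - complex_of_real (phi x)) \<le> e / 2)"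
      by (rule char_cot_sum_tendsto[OF cos_prod_tendsto]) (use e in simp)
    moreover have "\<forall>\<^sub>F p::nat in sequentially. p > 2" by (rule eventually_gt_at_top)
    ultimately show "\<forall>\<^sub>F p in sequentially. dist (char (prime_law p) x) (char limit_law x) < e"
    proof eventually_elim
      case (elim p)
      show ?case
      proof (cases "prime p")
        case True
        obtain s where s: "s = 1 \<or> s = -1" "\<And>k::int. - (pi * Hp p ((real_of_int k + 1 / 2) / real p) / sqrt p) = cot_sum p s k"
          using Hp_eq_cot_sum[OF True elim(2)] by blast
        have "char (prime_law p) x = (\<Sum>k = 1..int p. cis (x * cot_sum p s k)) / p"
          using True elim(2) unfolding prime_law_def Hp_law_def by (simp add: char_empirical s(2))
        then have "dist (char (prime_law p) x) (char limit_law x) \<le> e / 2"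
          using elim(1)[rule_format, OF True s(1)] by (simp add: dist_norm char_limit_law)
        then show ?thesis using e by simp
      qed (use e in \<open>simp add: prime_law_def\<close>)
    qed
  qed
qed (rule real_distribution_prime_law real_distribution_limit_law)+

lemma count_ratio_tendsto:
  "((\<lambda>p::nat. real (card {k::int. 1 \<le> k \<and> k \<le> int p \<and>
      Hp p ((of_int k + 1 / 2) / real p) < \<rho> * sqrt (real p)}) / real p) \<longlongrightarrow> c_rho \<rho>)
    (inf at_top (principal {p. prime p}))"
proof -
  let ?N = "\<lambda>p. {k::int. 1 \<le> k \<and> k \<le> int p \<and> Hp p ((of_int k + 1 / 2) / real p) < \<rho> * sqrt (real p)}"
  have "(\<lambda>p. cdf (prime_law p) (- (pi * \<rho>))) \<longlonglongrightarrow> cdf limit_law (- (pi * \<rho>))"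
    using weak_conv_prime_law isCont_cdf_limit_law unfolding weak_conv_m_def weak_conv_def by blast
  then have "(\<lambda>p. 1 - cdf (prime_law p) (- (pi * \<rho>))) \<longlonglongrightarrow> 1 - cdf limit_law (- (pi * \<rho>))"
    by (intro tendsto_intros)
  also have "1 - cdf limit_law (- (pi * \<rho>)) = c_rho \<rho>" by (simp add: limit_law_symmetric c_rho_eq_cdf)
  finally have lim: "(\<lambda>p. 1 - cdf (prime_law p) (- (pi * \<rho>))) \<longlonglongrightarrow> c_rho \<rho>" .
  have eq: "1 - cdf (prime_law p) (- (pi * \<rho>)) = real (card (?N p)) / real p" if p: "prime p" for p
  proof -
    let ?Y = "\<lambda>k::int. - (pi * Hp p ((of_int k + 1 / 2) / real p) / sqrt (real p))"
    have p0: "p > 0" using prime_gt_0_nat[OF p] .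
    have Y: "?Y k \<le> - (pi * \<rho>) \<longleftrightarrow> \<not> Hp p ((of_int k + 1 / 2) / real p) < \<rho> * sqrt (real p)" for k
      using p0 pi_gt_zero by (simp add: pos_le_divide_eq mult.assoc not_less)
    have sub: "?N p \<subseteq> {1..int p}" by auto
    have "{k \<in> {1..int p}. ?Y k \<in> {..- (pi * \<rho>)}} = {1..int p} - ?N p"
    proof (rule Set.set_eqI)
      fix k
      show "k \<in> {k \<in> {1..int p}. ?Y k \<in> {..- (pi * \<rho>)}} \<longleftrightarrow> k \<in> {1..int p} - ?N p"
        unfolding mem_Collect_eq Diff_iff atMost_iff atLeastAtMost_iff Y by blast
    qed
    then have "cdf (prime_law p) (- (pi * \<rho>)) = card ({1..int p} - ?N p) / p"
      using p p0 by (simp add: cdf_def prime_law_def Hp_law_def measure_empirical)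
    also have "card ({1..int p} - ?N p) = p - card (?N p)"
      by (subst card_Diff_subset) (auto intro: finite_subset[of _ "{1..int p}"])
    also have "real (p - card (?N p)) = real p - card (?N p)"
      using card_mono[OF _ sub] by (intro of_nat_diff) simp
    finally show ?thesis using p0 by (simp add: diff_divide_distrib)
  qed
  have "((\<lambda>p. 1 - cdf (prime_law p) (- (pi * \<rho>))) \<longlongrightarrow> c_rho \<rho>) (inf at_top (principal {p. prime p}))"
    by (rule tendsto_mono[OF inf_le1 lim])
  then show ?thesis
    by (rule Lim_transform_eventually) (auto simp: eventually_inf_principal eq)
qed

theorem theorem4:
  shows "(\<forall>\<rho>::real.
           (\<lambda>p::nat. real (card {k::int. 1 \<le> k \<and> k \<le> int p \<and>
                 Hp p ((of_int k + 1 / 2) / real p) < \<rho> * sqrt (real p)}))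
             \<sim>[inf at_top (principal {p. prime p})] (\<lambda>p. c_rho \<rho> * real p)) \<and>
         (\<exists>C::real. \<forall>\<rho>::real. \<rho> > 0 \<longrightarrow>
           (\<exists>e. \<bar>e\<bar> \<le> C \<and> c_rho (- \<rho>) = exp (- exp (pi * \<rho> / 2 + e))) \<and>
           (\<exists>e. \<bar>e\<bar> \<le> C \<and> 1 - c_rho \<rho> = exp (- exp (pi * \<rho> / 2 + e))))"
proof (intro conjI allI)
  fix \<rho> :: real
  let ?F = "inf at_top (principal {p::nat. prime p})"
  let ?n = "\<lambda>p::nat. real (card {k::int. 1 \<le> k \<and> k \<le> int p \<and>
                 Hp p ((of_int k + 1 / 2) / real p) < \<rho> * sqrt (real p)})"
  show "?n \<sim>[?F] (\<lambda>p. c_rho \<rho> * real p)"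
  proof (rule asymp_equivI')
    have "((\<lambda>p. ?n p / real p / c_rho \<rho>) \<longlongrightarrow> c_rho \<rho> / c_rho \<rho>) ?F"
      using c_rho_pos[of \<rho>] by (intro tendsto_divide count_ratio_tendsto tendsto_const) simp
    then show "((\<lambda>p. ?n p / (c_rho \<rho> * real p)) \<longlongrightarrow> 1) ?F"
      using c_rho_pos[of \<rho>] by (simp add: mult.commute divide_divide_eq_left)
  qed
next
  show "\<exists>C::real. \<forall>\<rho>::real. \<rho> > 0 \<longrightarrow>
           (\<exists>e. \<bar>e\<bar> \<le> C \<and> c_rho (- \<rho>) = exp (- exp (pi * \<rho> / 2 + e))) \<and>
           (\<exists>e. \<bar>e\<bar> \<le> C \<and> 1 - c_rho \<rho> = exp (- exp (pi * \<rho> / 2 + e)))"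
    using c_rho_tail by blast
qed

end
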